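(* Let $N\ge1$ be an integer, and consider any probability distribution on the space $V_N\oplus V_N$ of pairs of curves that has an integrable density (with respect to the Euclidean volume) depending only on the maximum of the $L_2$-norms of the two curves, i.e. a density of the form $(f,g)\mapsto p(\max(\|f\|,\|g\|))$. Then the average number of intersection points of the two curves $f,g$ with respect to this distribution is equal to $$\frac{2^{8N+3}\,((2N)!)^4}{((4N+1)!)^2}\left(1+4+\cdots+N^2\right).$$
   Context: For a natural number $N$, let $V_N$ be the $2(2N+1)$-dimensional real vector space of maps $f=(x,y):S^1=\mathbb{R}/2\pi\mathbb{Z}\to\mathbb{R}^2$ whose two components are trigonometric polynomials of degree $\le N$: $x(\varphi)=a_0+\sum_{j=1}^N(a_j\cos j\varphi+b_j\sin j\varphi)$, $y(\varphi)=\tilde a_0+\sum_{j=1}^N(\tilde a_j\cos j\varphi+\tilde b_j\sin j\varphi)$, with real coefficients. Equip $V_N$ with the Euclidean ($L_2$) structure in which the dot product of $(x_1,y_1)$ and $(x_2,y_2)$ is $\frac1\pi\int_0^{2\pi}(x_1x_2+y_1y_2)\,d\varphi$; equivalently, the squared norm of $f$ is $\|f\|^2=2(a_0^2+\tilde a_0^2)+\sum_{j=1}^N(a_j^2+b_j^2+\tilde a_j^2+\tilde b_j^2)$. The space $V_N\oplus V_N$ carries the Euclidean volume of the direct sum. The number of intersection points of a pair of curves $(f,g)$ is the number of pairs $(\varphi,\psi)\in S^1\times S^1$ with $f(\varphi)=g(\psi)$; for almost all pairs this is finite and agrees with the number of common points of the two plane curves. *)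

theory Defs
  imports "HOL-Probability.Probability"
begin

text \<open>A map from the circle to the plane is represented by the corresponding
  \<open>2 * pi\<close>-periodic function on the real line; the points of the circle
  correspond to the parameters in \<open>{0..<2 * pi}\<close>.\<close>

type_synonym curve = "real \<Rightarrow> real \<times> real"

definition trig_curves :: "nat \<Rightarrow> curve set" where
  "trig_curves N =
    {f. \<exists>a b a' b' :: nat \<Rightarrow> real. f = (\<lambda>\<phi>.
          (a 0 + (\<Sum>j=1..N. a j * cos (real j * \<phi>) + b j * sin (real j * \<phi>)),
           a' 0 + (\<Sum>j=1..N. a' j * cos (real j * \<phi>) + b' j * sin (real j * \<phi>))))}"

definition L2_inner :: "curve \<Rightarrow> curve \<Rightarrow> real" where
  "L2_inner f g = 1 / pi * integral {0..2 * pi} (\<lambda>\<phi>. f \<phi> \<bullet> g \<phi>)"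

definition L2_norm_curve :: "curve \<Rightarrow> real" where
  "L2_norm_curve f = sqrt (L2_inner f f)"

text \<open>The functions \<open>1 / sqrt 2, cos \<phi>, sin \<phi>, cos (2 * \<phi>), sin (2 * \<phi>), \<dots>\<close>;
  they are orthonormal for \<open>1 / pi\<close> times the integral over a period.\<close>

definition trig_basis :: "nat \<Rightarrow> real \<Rightarrow> real" where
  "trig_basis k \<phi> =
    (if k = 0 then 1 / sqrt 2
     else if odd k then cos (real ((k + 1) div 2) * \<phi>)
     else sin (real (k div 2) * \<phi>))"

definition curve_of_coords :: "nat \<Rightarrow> (nat \<Rightarrow> real \<times> real) \<Rightarrow> curve" where
  "curve_of_coords N c = (\<lambda>\<phi>. \<Sum>k\<le>2 * N. trig_basis k \<phi> *\<^sub>R c k)"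

text \<open>The Euclidean volume: Lebesgue measure transported along the linear isometry
  from orthonormal coordinates (one vector of the plane for each of the \<open>2 * N + 1\<close>
  basis functions) onto the space of curves.\<close>

definition curve_volume :: "nat \<Rightarrow> curve measure" where
  "curve_volume N = embed_measure (Pi\<^sub>M {..2 * N} (\<lambda>_. lborel)) (curve_of_coords N)"

text \<open>The value is infinite if there are infinitely many such pairs.\<close>

definition intersection_number :: "curve \<Rightarrow> curve \<Rightarrow> ennreal" where
  "intersection_number f g =
    emeasure (count_space UNIV)
      {(\<phi>, \<psi>). \<phi> \<in> {0..<2 * pi} \<and> \<psi> \<in> {0..<2 * pi} \<and> f \<phi> = g \<psi>}"


lemma has_integral_cos_period:
  fixes m :: int
  shows "((\<lambda>x::real. cos (m * x)) has_integral (if m = 0 then 2 * pi else 0)) {0..2 * pi}"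
proof (cases "m = 0")
  case True
  then show ?thesis using has_integral_const_real[of "1::real" 0 "2*pi"] by simp
next
  case False
  have "((\<lambda>x::real. cos (m * x)) has_integral
      (sin (m * (2 * pi)) / m - sin (m * (0::real)) / m)) {0..2 * pi}"
    using False
    by (intro fundamental_theorem_of_calculus[where f = "\<lambda>x::real. sin (m * x) / m"])
       (auto intro!: derivative_eq_intros
             simp flip: has_real_derivative_iff_has_vector_derivative)
  moreover have "sin (m * (2 * pi)) = 0"
    using sin_int_2pin[of m] by (simp add: mult_ac)
  ultimately show ?thesis using False by simp
qed

lemma has_integral_sin_period:
  fixes m :: int
  shows "((\<lambda>x::real. sin (m * x)) has_integral 0) {0..2 * pi}"
proof (cases "m = 0")
  case True
  then show ?thesis by simp
next
  case False
  have "((\<lambda>x::real. sin (m * x)) has_integral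
      (- cos (m * (2 * pi)) / m - - cos (m * (0::real)) / m)) {0..2 * pi}"
    using False
    by (intro fundamental_theorem_of_calculus[where f = "\<lambda>x::real. - cos (m * x) / m"])
       (auto intro!: derivative_eq_intros
             simp flip: has_real_derivative_iff_has_vector_derivative)
  moreover have "cos (m * (2 * pi)) = 1"
    using cos_int_2pin[of m] by (simp add: mult_ac)
  ultimately show ?thesis using False by simp
qed

lemma has_integral_cos_cos:
  fixes m n :: int
  shows "((\<lambda>x::real. cos (m * x) * cos (n * x)) has_integral
    ((if m = n then pi else 0) + (if m + n = 0 then pi else 0))) {0..2 * pi}"
proof -
  have "((\<lambda>x::real. (cos ((m - n) * x) + cos ((m + n) * x)) / 2) has_integral
     ((if m - n = 0 then 2 * pi else 0) + (if m + n = 0 then 2 * pi else 0)) / 2) {0..2 * pi}"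
    using has_integral_cos_period[of "m - n"] has_integral_cos_period[of "m + n"]
    by (intro has_integral_divide has_integral_add) auto
  moreover have "(\<lambda>x::real. (cos ((m - n) * x) + cos ((m + n) * x)) / 2) =
      (\<lambda>x::real. cos (m * x) * cos (n * x))"
    by (simp add: fun_eq_iff cos_times_cos algebra_simps)
  ultimately show ?thesis by (auto split: if_splits)
qed

lemma has_integral_sin_sin:
  fixes m n :: int
  shows "((\<lambda>x::real. sin (m * x) * sin (n * x)) has_integral
    ((if m = n then pi else 0) - (if m + n = 0 then pi else 0))) {0..2 * pi}"
proof -
  have "((\<lambda>x::real. (cos ((m - n) * x) - cos ((m + n) * x)) / 2) has_integral
     ((if m - n = 0 then 2 * pi else 0) - (if m + n = 0 then 2 * pi else 0)) / 2) {0..2 * pi}"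
    using has_integral_cos_period[of "m - n"] has_integral_cos_period[of "m + n"]
    by (intro has_integral_divide has_integral_diff) auto
  moreover have "(\<lambda>x::real. (cos ((m - n) * x) - cos ((m + n) * x)) / 2) =
      (\<lambda>x::real. sin (m * x) * sin (n * x))"
    by (simp add: fun_eq_iff sin_times_sin algebra_simps)
  ultimately show ?thesis by (auto split: if_splits)
qed

lemma has_integral_sin_cos:
  fixes m n :: int
  shows "((\<lambda>x::real. sin (m * x) * cos (n * x)) has_integral 0) {0..2 * pi}"
proof -
  have "((\<lambda>x::real. (sin ((m + n) * x) + sin ((m - n) * x)) / 2) has_integral (0 + 0) / 2) {0..2 * pi}"
    using has_integral_sin_period[of "m - n"] has_integral_sin_period[of "m + n"]
    by (intro has_integral_divide has_integral_add) auto
  moreover have "(\<lambda>x::real. (sin ((m + n) * x) + sin ((m - n) * x)) / 2) =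
      (\<lambda>x::real. sin (m * x) * cos (n * x))"
    by (simp add: fun_eq_iff distrib_right left_diff_distrib sin_add sin_diff)
  ultimately show ?thesis by simp
qed

definition trig_freq :: "nat \<Rightarrow> int" where
  "trig_freq k = int ((k + 1) div 2)"

lemma trig_basis_freq:
  fixes x :: real
  shows "trig_basis k x =
    (if k = 0 then cos (trig_freq k * x) / sqrt 2
     else if odd k then cos (trig_freq k * x)
     else sin (trig_freq k * x))"
  by (auto simp: trig_basis_def trig_freq_def)

lemma trig_basis_orthonormal:
  "((\<lambda>x. trig_basis i x * trig_basis j x) has_integral (if i = j then pi else 0)) {0..2 * pi}"
proof -
  let ?f = trig_freq
  have cc: "((\<lambda>x::real. cos (?f i * x) * cos (?f j * x)) has_integral
      (if ?f i = ?f j then pi else 0) + (if ?f i + ?f j = 0 then pi else 0)) {0..2 * pi}"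
    by (rule has_integral_cos_cos)
  have ss: "((\<lambda>x::real. sin (?f i * x) * sin (?f j * x)) has_integral
      (if ?f i = ?f j then pi else 0) - (if ?f i + ?f j = 0 then pi else 0)) {0..2 * pi}"
    by (rule has_integral_sin_sin)
  have sc: "((\<lambda>x::real. sin (?f i * x) * cos (?f j * x)) has_integral 0) {0..2 * pi}"
    by (rule has_integral_sin_cos)
  have cs: "((\<lambda>x::real. cos (?f i * x) * sin (?f j * x)) has_integral 0) {0..2 * pi}"
    using has_integral_sin_cos[of "?f j" "?f i"] by (simp add: mult.commute)
  have f0: "?f k = 0 \<longleftrightarrow> k = 0" for k
    by (auto simp: trig_freq_def)
  have fp: "?f i + ?f j = 0 \<longleftrightarrow> i = 0 \<and> j = 0"
    by (auto simp: trig_freq_def)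
  have feq: "?f i = ?f j \<longleftrightarrow> i = j" if "odd i = odd j" "i \<noteq> 0" "j \<noteq> 0"
    using that by (auto simp: trig_freq_def elim!: oddE evenE)
  consider "i = 0" "j = 0" | "i = 0" "j \<noteq> 0" "odd j" | "i = 0" "j \<noteq> 0" "even j"
    | "i \<noteq> 0" "odd i" "j = 0" | "i \<noteq> 0" "even i" "j = 0"
    | "i \<noteq> 0" "j \<noteq> 0" "odd i" "odd j" | "i \<noteq> 0" "j \<noteq> 0" "odd i" "even j"
    | "i \<noteq> 0" "j \<noteq> 0" "even i" "odd j" | "i \<noteq> 0" "j \<noteq> 0" "even i" "even j"
    by blast
  then show ?thesis
  proof cases
    case 1
    then show ?thesis
      using has_integral_const_real[of "1 / 2 :: real" 0 "2 * pi"]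
      by (simp add: trig_basis_def)
  next
    case 2
    then show ?thesis using has_integral_divide[OF cc, of "sqrt 2"] f0[of 0] f0[of j] fp
      by (simp add: trig_basis_freq)
  next
    case 3
    then show ?thesis using has_integral_divide[OF cs, of "sqrt 2"] f0[of 0] f0[of j]
      by (simp add: trig_basis_freq)
  next
    case 4
    then show ?thesis using has_integral_divide[OF cc, of "sqrt 2"] f0[of 0] f0[of i] fp
      by (simp add: trig_basis_freq)
  next
    case 5
    then show ?thesis using has_integral_divide[OF sc, of "sqrt 2"] f0[of 0] f0[of i]
      by (simp add: trig_basis_freq)
  next
    case 6
    then show ?thesis using cc fp feq by (simp add: trig_basis_freq)
  next
    case 7
    then show ?thesis using cs by (auto simp add: trig_basis_freq)
  next
    case 8
    then show ?thesis using sc by (auto simp add: trig_basis_freq)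
  next
    case 9
    then show ?thesis using ss fp feq by (simp add: trig_basis_freq)
  qed
qed

lemma L2_inner_curve_of_coords:
  "L2_inner (curve_of_coords N c) (curve_of_coords N d) = (\<Sum>k\<le>2 * N. c k \<bullet> d k)"
proof -
  have "((\<lambda>x. \<Sum>i\<le>2 * N. \<Sum>j\<le>2 * N. (trig_basis i x * trig_basis j x) * (c i \<bullet> d j))
      has_integral (\<Sum>i\<le>2 * N. \<Sum>j\<le>2 * N. (if i = j then pi else 0) * (c i \<bullet> d j))) {0..2 * pi}"
    by (intro has_integral_sum has_integral_mult_left trig_basis_orthonormal) auto
  moreover have "(\<lambda>x. \<Sum>i\<le>2 * N. \<Sum>j\<le>2 * N. (trig_basis i x * trig_basis j x) * (c i \<bullet> d j))
      = (\<lambda>x. curve_of_coords N c x \<bullet> curve_of_coords N d x)"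
    unfolding curve_of_coords_def
    by (subst inner_sum_left, subst inner_sum_right) (simp add: mult_ac)
  moreover have "(\<Sum>i\<le>2 * N. \<Sum>j\<le>2 * N. (if i = j then pi else 0) * (c i \<bullet> d j))
      = pi * (\<Sum>k\<le>2 * N. c k \<bullet> d k)"
    by (simp add: if_distrib[of "\<lambda>t. t * _"] sum.delta sum_distrib_left cong: if_cong)
  ultimately show ?thesis
    by (simp add: L2_inner_def integral_unique)
qed

lemma L2_norm_curve_of_coords:
  "L2_norm_curve (curve_of_coords N c) = sqrt (\<Sum>k\<le>2 * N. (norm (c k))\<^sup>2)"
  by (simp add: L2_norm_curve_def L2_inner_curve_of_coords dot_square_norm)

lemma inj_on_curve_of_coords:
  "inj_on (curve_of_coords N) (space (Pi\<^sub>M {..2 * N} (\<lambda>_. lborel)))"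
proof (rule inj_onI)
  fix c d :: "nat \<Rightarrow> real \<times> real"
  assume c: "c \<in> space (Pi\<^sub>M {..2 * N} (\<lambda>_. lborel))"
    and d: "d \<in> space (Pi\<^sub>M {..2 * N} (\<lambda>_. lborel))"
    and eq: "curve_of_coords N c = curve_of_coords N d"
  have "curve_of_coords N (\<lambda>k. c k - d k) = (\<lambda>_. 0)"
    using eq by (simp add: curve_of_coords_def fun_eq_iff scaleR_diff_right sum_subtractf)
  then have "L2_inner (curve_of_coords N (\<lambda>k. c k - d k)) (curve_of_coords N (\<lambda>k. c k - d k)) = 0"
    by (simp add: L2_inner_def)
  then have "\<forall>k\<in>{..2 * N}. (c k - d k) \<bullet> (c k - d k) = 0"
    unfolding L2_inner_curve_of_coords by (subst (asm) sum_nonneg_eq_0_iff) auto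
  then have "c k = d k" if "k \<in> {..2 * N}" for k
    using that by simp
  with c d show "c = d"
    by (intro PiE_ext[of c "{..2 * N}" "\<lambda>_. UNIV" d])
       (auto simp: space_PiM)
qed

lemma curve_of_coords_altdef:
  "curve_of_coords N c = (\<lambda>\<phi>. (1 / sqrt 2) *\<^sub>R c 0 +
     (\<Sum>j=1..N. cos (real j * \<phi>) *\<^sub>R c (2 * j - 1) + sin (real j * \<phi>) *\<^sub>R c (2 * j)))"
proof (induction N)
  case 0
  then show ?case by (simp add: curve_of_coords_def trig_basis_def fun_eq_iff)
next
  case (Suc N)
  have "curve_of_coords (Suc N) c = (\<lambda>\<phi>. curve_of_coords N c \<phi> +
      trig_basis (2 * N + 1) \<phi> *\<^sub>R c (2 * N + 1) + trig_basis (2 * N + 2) \<phi> *\<^sub>R c (2 * N + 2))"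
    by (simp add: curve_of_coords_def fun_eq_iff)
  then show ?case
    unfolding Suc.IH by (simp add: trig_basis_def fun_eq_iff add.assoc)
qed

lemma space_curve_volume: "space (curve_volume N) = trig_curves N"
proof -
  have "curve_of_coords N ` space (Pi\<^sub>M {..2 * N} (\<lambda>_. lborel)) = trig_curves N" (is "?A = _")
  proof (intro equalityI subsetI)
    fix f assume "f \<in> ?A"
    then obtain c where f: "f = curve_of_coords N c" by blast
    show "f \<in> trig_curves N"
      unfolding f curve_of_coords_altdef trig_curves_def mem_Collect_eq
      by (rule exI[of _ "\<lambda>j. if j = 0 then fst (c 0) / sqrt 2 else fst (c (2 * j - 1))"],
          rule exI[of _ "\<lambda>j. fst (c (2 * j))"],
          rule exI[of _ "\<lambda>j. if j = 0 then snd (c 0) / sqrt 2 else snd (c (2 * j - 1))"],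
          rule exI[of _ "\<lambda>j. snd (c (2 * j))"])
         (auto simp: fun_eq_iff prod_eq_iff fst_sum snd_sum mult_ac intro!: sum.cong)
  next
    fix f assume "f \<in> trig_curves N"
    then obtain a b a' b' :: "nat \<Rightarrow> real" where f: "f = (\<lambda>\<phi>.
          (a 0 + (\<Sum>j=1..N. a j * cos (real j * \<phi>) + b j * sin (real j * \<phi>)),
           a' 0 + (\<Sum>j=1..N. a' j * cos (real j * \<phi>) + b' j * sin (real j * \<phi>))))"
      unfolding trig_curves_def by blast
    define c where "c = (\<lambda>k. if k = 0 then (sqrt 2 * a 0, sqrt 2 * a' 0)
      else if odd k then (a ((k + 1) div 2), a' ((k + 1) div 2))
      else (b (k div 2), b' (k div 2)))"
    have "f = curve_of_coords N c"
      unfolding f curve_of_coords_altdef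
      by (auto simp: fun_eq_iff prod_eq_iff fst_sum snd_sum c_def mult_ac intro!: sum.cong)
    also have "\<dots> = curve_of_coords N (restrict c {..2 * N})"
      by (auto simp: curve_of_coords_def intro!: sum.cong)
    finally show "f \<in> ?A"
      by (auto simp: space_PiM)
  qed
  then show ?thesis
    by (simp add: curve_volume_def space_embed_measure)
qed

lemma sigma_finite_curve_volume: "sigma_finite_measure (curve_volume N)"
proof -
  interpret product_sigma_finite "\<lambda>_::nat. lborel :: (real \<times> real) measure"
    by unfold_locales
  let ?M = "Pi\<^sub>M {..2 * N} (\<lambda>_. lborel :: (real \<times> real) measure)"
  let ?f = "curve_of_coords N"
  interpret M: sigma_finite_measure ?M
    by (rule sigma_finite) simp
  obtain A where A: "countable A" "A \<subseteq> sets ?M" "\<Union>A = space ?M" "\<And>X. X \<in> A \<Longrightarrow> emeasure ?M X \<noteq> \<infinity>"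
    using M.sigma_finite_countable by blast
  have "emeasure (curve_volume N) (?f ` X) \<noteq> \<infinity>" if "X \<in> A" for X
  proof -
    have "X \<subseteq> space ?M" using that A(2) sets.sets_into_space by blast
    then have "?f -` (?f ` X) \<inter> space ?M = X"
      using inj_on_curve_of_coords[of N] by (auto dest: inj_onD)
    moreover have "?f ` X \<in> sets (embed_measure ?M ?f)"
      using that A(2) by (intro in_sets_embed_measure) auto
    ultimately show ?thesis
      using A(4)[OF that]
      by (simp add: curve_volume_def emeasure_embed_measure'[OF inj_on_curve_of_coords])
  qed
  moreover have "(`) ?f ` A \<subseteq> sets (curve_volume N)"
    using A(2) by (auto simp: curve_volume_def intro!: in_sets_embed_measure)
  moreover have "\<Union>((`) ?f ` A) = space (curve_volume N)"
    unfolding curve_volume_def space_embed_measure A(3)[symmetric] by blast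
  ultimately show ?thesis
    using A(1) by unfold_locales (auto intro!: exI[of _ "(`) ?f ` A"])
qed

end

theory Submission
  imports Defs
begin

text \<open>In orthonormal coordinates the constant coefficient \<open>c 0\<close> of the first curve is determined by
  its other coefficients, by the second curve, and by the parameters \<open>(\<phi>, \<psi>)\<close> of an
  intersection point.  The area formula for this map of \<open>(\<phi>, \<psi>)\<close> turns the expected number of
  intersections into an integral over \<open>(\<phi>, \<psi>)\<close> of an integral over the pairs of curves with
  \<open>f \<phi> = g \<psi>\<close>, weighted by the area spanned by the tangents \<open>f' \<phi>\<close> and \<open>g' \<psi>\<close>.  The vectors of
  values and of derivatives of the orthonormal basis at a parameter are orthogonal and have norms
  independent of the parameter, so rotations of the coefficient space make the inner integral
  independent of \<open>(\<phi>, \<psi>)\<close>.  It is homogeneous of the same degree as the volume of the set of pairs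
  with \<open>max (\<parallel>f\<parallel>) (\<parallel>g\<parallel>) < r\<close>, so the profile \<open>p\<close> enters only through the normalization,
  and the constant is a ratio of two explicit volumes.\<close>

text \<open>The constant coefficient is the one to eliminate because it translates the first curve
  without changing its tangents, so the first curve enters the Jacobian only through its other
  coefficients. The maximum in the density couples the two curves, and the meeting condition couples
  them again, so neither can be integrated out alone. The way out is to put the eliminated
  coefficient back: once the second curve is rotated, its point is a free plane vector, and this
  vector can be traded for the missing coefficient of the first curve. What results is two
  coefficient vectors sharing one plane coordinate, and over each value of it the condition on the
  maximum splits into two balls. Squared norms are the right variable, since the squared norm of a
  plane vector has constant density \<open>pi\<close>. Each tangent coordinate then adds the
  exponent \<open>3 / 2\<close>; this is the source of \<open>pochhammer (5 / 2)\<close> and finally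
  of \<open>fact (4 * N + 1)\<close>. The sum of squares is the squared length of the vector of
  derivatives of the basis, and \<open>N + 1 / 2\<close> that of the vector of values.\<close>

section \<open>Area formula\<close>

text \<open>The image is measurable because it is the preimage of \<open>S\<close> under the
  continuous inverse \<open>g\<close>, cut down to the open set \<open>V\<close>. The volume is the
  change of variables theorem for injective differentiable maps, extended to the value infinity on
  both sides.\<close>

lemma emeasure_image_injective_C1:
  fixes f :: "real^'n::{finite,wellorder} \<Rightarrow> real^'n::_"
  assumes der: "\<And>x. (f has_derivative (*v) (f' x)) (at x)"
    and meas: "(\<lambda>x. det (f' x)) \<in> borel_measurable borel"
    and hom: "homeomorphism U V f g" and V: "open V" and S: "S \<in> sets borel" "S \<subseteq> U"
  shows "f ` S \<in> sets borel"
    and "emeasure lborel (f ` S) = (\<integral>\<^sup>+x\<in>S. ennreal \<bar>det (f' x)\<bar> \<partial>lborel)"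
proof -
  have fS: "f ` S = g -` S \<inter> V"
    using hom S(2) unfolding homeomorphism_def by force
  have "g \<in> borel_measurable (restrict_space borel V)"
    using hom by (auto intro!: borel_measurable_continuous_on_restrict simp: homeomorphism_def)
  then have "g -` S \<inter> space (restrict_space borel V) \<in> sets (restrict_space borel V)"
    using S(1) by (rule measurable_sets)
  then show fSm: "f ` S \<in> sets borel"
    using V by (simp add: fS space_restrict_space sets_restrict_space_iff Int_absorb1)
  have inj: "inj_on f S"
    using hom S(2) unfolding homeomorphism_def inj_on_def by (metis subsetD)
  let ?d = "\<lambda>x. indicator S x * \<bar>det (f' x)\<bar>"
  have d[measurable]: "?d \<in> borel_measurable borel"
    using meas S(1) by measurable
  \<comment> \<open>Stated for every candidate value \<open>m\<close> at once: if the integral is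
    infinite, no \<open>m\<close> fits, so the image cannot have finite measure either.\<close>
  have I: "f ` S \<in> lmeasurable \<and> measure lebesgue (f ` S) = m \<longleftrightarrow>
      0 \<le> m \<and> integral\<^sup>N lborel (\<lambda>x. ennreal (?d x)) = ennreal m" for m
  proof -
    have "f ` S \<in> lmeasurable \<and> measure lebesgue (f ` S) = m
      \<longleftrightarrow> ((\<lambda>x. \<bar>det (matrix ((*v) (f' x)))\<bar>) has_integral m) S"
      using S inj der
      by (intro has_measure_differentiable_image) (auto intro: has_derivative_at_withinI)
    also have "\<dots> \<longleftrightarrow> (?d has_integral m) UNIV"
      by (subst has_integral_restrict_UNIV[symmetric], rule has_integral_cong)
        (auto simp: indicator_def)
    also have "\<dots> \<longleftrightarrow> 0 \<le> m \<and> integral\<^sup>N lborel (\<lambda>x. ennreal (?d x)) = ennreal m"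
      by (subst has_integral_iff_nn_integral_lebesgue)
        (auto simp: nn_integral_completion intro: measurable_completion)
    finally show ?thesis .
  qed
  have e: "emeasure lborel (f ` S) = emeasure lebesgue (f ` S)"
    using fSm by simp
  have "emeasure lborel (f ` S) = integral\<^sup>N lborel (\<lambda>x. ennreal (?d x))"
  proof (cases "integral\<^sup>N lborel (\<lambda>x. ennreal (?d x)) = \<infinity>")
    case True
    with I have "f ` S \<notin> lmeasurable" by fastforce
    then have "emeasure lebesgue (f ` S) = \<infinity>"
      using fSm unfolding fmeasurable_def by (auto simp: not_less top_unique)
    then show ?thesis using True e by simp
  next
    case False
    then obtain m where m: "0 \<le> m" "integral\<^sup>N lborel (\<lambda>x. ennreal (?d x)) = ennreal m"
      by (cases "integral\<^sup>N lborel (\<lambda>x. ennreal (?d x))") auto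
    with I have "f ` S \<in> lmeasurable" "measure lebesgue (f ` S) = m" by blast+
    then show ?thesis using e m(2) by (simp add: emeasure_eq_measure2)
  qed
  then show "emeasure lborel (f ` S) = (\<integral>\<^sup>+x\<in>S. ennreal \<bar>det (f' x)\<bar> \<partial>lborel)"
    by (auto intro!: nn_integral_cong split: split_indicator)
qed

text \<open>Lebesgue measure on the image is the push-forward of Lebesgue measure on
  \<open>S\<close> weighted by the Jacobian. The previous lemma gives this on a Borel set
  \<open>B\<close> when applied to the part of \<open>S\<close> that \<open>f\<close> maps into
  \<open>B\<close>.\<close>

lemma nn_integral_injective_C1:
  fixes f :: "real^'n::{finite,wellorder} \<Rightarrow> real^'n::_"
  assumes der: "\<And>x. (f has_derivative (*v) (f' x)) (at x)"
    and meas[measurable]: "(\<lambda>x. det (f' x)) \<in> borel_measurable borel"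
    and hom: "homeomorphism U V f g" and V: "open V" and S[measurable]: "S \<in> sets borel" and SU: "S \<subseteq> U"
    and h[measurable]: "h \<in> borel_measurable borel"
  shows "(\<integral>\<^sup>+y\<in>f ` S. h y \<partial>lborel) = (\<integral>\<^sup>+x\<in>S. h (f x) * ennreal \<bar>det (f' x)\<bar> \<partial>lborel)"
proof -
  note image = emeasure_image_injective_C1[OF der meas hom V]
  have [measurable]: "f \<in> borel_measurable borel"
    using der by (intro borel_measurable_continuous_onI) (meson has_derivative_continuous_on has_derivative_at_withinI)
  note [measurable] = image(1)[OF S SU]
  let ?M = "density lborel (\<lambda>x. indicator S x * ennreal \<bar>det (f' x)\<bar>)"
  have eq: "density lborel (indicator (f ` S)) = distr ?M borel f"
  proof (rule measure_eqI)
    fix B assume "B \<in> sets (density lborel (indicator (f ` S)))"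
    then have B[measurable]: "B \<in> sets borel" by simp
    have "emeasure (density lborel (indicator (f ` S))) B = emeasure lborel (f ` (S \<inter> f -` B))"
      by (subst emeasure_density)
        (auto simp flip: indicator_inter_arith intro!: arg_cong[where f = "emeasure lborel"])
    also have "\<dots> = (\<integral>\<^sup>+x\<in>S \<inter> f -` B. ennreal \<bar>det (f' x)\<bar> \<partial>lborel)"
      using measurable_sets[of f borel borel B] SU by (intro image(2)) auto
    also have "\<dots> = emeasure (distr ?M borel f) B"
      by (subst emeasure_distr, measurable, subst emeasure_density)
        (auto intro!: nn_integral_cong measurable_sets[of f borel borel B, simplified] split: split_indicator)
    finally show "emeasure (density lborel (indicator (f ` S))) B = emeasure (distr ?M borel f) B" .
  qed simp
  have "(\<integral>\<^sup>+y\<in>f ` S. h y \<partial>lborel) = integral\<^sup>N (density lborel (indicator (f ` S))) h"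
    by (subst nn_integral_density) (auto simp: mult.commute)
  also have "\<dots> = (\<integral>\<^sup>+x\<in>S. h (f x) * ennreal \<bar>det (f' x)\<bar> \<partial>lborel)"
    unfolding eq by (subst nn_integral_distr, measurable, subst nn_integral_density) (auto simp: mult_ac)
  finally show ?thesis .
qed

lemma locally_homeomorphism_C1:
  fixes f :: "real^'n::{finite,wellorder} \<Rightarrow> real^'n::_"
  assumes der: "\<And>x. (f has_derivative (*v) (f' x)) (at x)"
    and cont: "continuous_on UNIV f'" and "det (f' x) \<noteq> 0"
  obtains U V g where "open U" "x \<in> U" "open V" "homeomorphism U V f g"
proof -
  let ?f' = "\<lambda>x. Blinfun ((*v) (f' x))"
  obtain B where B: "B ** f' x = mat 1"
    using assms(3) invertible_det_nz[of "f' x"] unfolding invertible_def by auto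
  have a: "blinfun_apply (?f' z) = (*v) (f' z)" for z
    by (simp add: bounded_linear_Blinfun_apply)
  have c: "continuous_on UNIV ?f'"
    by (intro continuous_on_blinfun_componentwise)
      (auto simp: a matrix_vector_mult_def intro!: continuous_intros cont)
  have i: "Blinfun ((*v) B) o\<^sub>L ?f' x = id_blinfun"
    by (rule blinfun_eqI) (simp add: a bounded_linear_Blinfun_apply matrix_vector_mul_assoc B)
  obtain U V g where "open U" "x \<in> U" "open V" "homeomorphism U V f g"
    by (rule inverse_function_theorem[OF open_UNIV _ c UNIV_I i]) (use der a in auto)
  then show ?thesis by (rule that)
qed

text \<open>Critical points contribute to neither side: their values form a null set by Sard's
  theorem, and the Jacobian vanishes at them. The rest of \<open>S\<close> is cut into countably
  many disjoint pieces \<open>T n\<close> on each of which \<open>f\<close> is injective, so a point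
  that is not a critical value has as many preimages as there are pieces whose image contains
  it.\<close>

lemma area_formula:
  fixes f :: "real^'n::{finite,wellorder} \<Rightarrow> real^'n::_"
  assumes der: "\<And>x. (f has_derivative (*v) (f' x)) (at x)"
    and cont: "continuous_on UNIV f'" and S[measurable]: "S \<in> sets borel"
    and h[measurable]: "h \<in> borel_measurable borel"
  shows "(\<integral>\<^sup>+y. h y * emeasure (count_space UNIV) {x\<in>S. f x = y} \<partial>lborel)
    = (\<integral>\<^sup>+x\<in>S. h (f x) * ennreal \<bar>det (f' x)\<bar> \<partial>lborel)"
proof -
  have cdet: "continuous_on UNIV (\<lambda>x. det (f' x))"
    unfolding det_def by (intro continuous_intros cont)
  have meas[measurable]: "(\<lambda>x. det (f' x)) \<in> borel_measurable borel"
    by (rule borel_measurable_continuous_onI[OF cdet])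
  have [measurable]: "f \<in> borel_measurable borel"
    using der by (intro borel_measurable_continuous_onI) (meson has_derivative_continuous_on has_derivative_at_withinI)
  define Z where "Z = {x. det (f' x) = 0}"
  have Zm[measurable]: "Z \<in> sets borel" unfolding Z_def by measurable
  have "\<exists>U V g. open U \<and> x \<in> U \<and> open V \<and> homeomorphism U V f g" if "x \<notin> Z" for x
  proof -
    have "det (f' x) \<noteq> 0" using that by (simp add: Z_def)
    from locally_homeomorphism_C1[OF der cont this] show ?thesis by metis
  qed
  then obtain U V g where UV: "\<And>x. x \<notin> Z \<Longrightarrow> open (U x) \<and> x \<in> U x \<and> open (V x) \<and> homeomorphism (U x) (V x) f (g x)"
    by metis
  obtain \<F> where \<F>: "\<F> \<subseteq> U ` (- Z)" "countable \<F>" "\<Union>\<F> = \<Union> (U ` (- Z))"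
    by (rule Lindelof[of "U ` (- Z)"]) (use UV in auto)
  \<comment> \<open>Inserting the empty set keeps the enumeration meaningful when the cover
    \<open>\<F>\<close> is empty, that is, when every point is critical.\<close>
  define W where "W = from_nat_into (insert {} \<F>)"
  have W: "\<exists>V g. open (W n) \<and> open V \<and> homeomorphism (W n) V f g" for n
  proof -
    have "W n \<in> insert {} \<F>"
      unfolding W_def by (rule from_nat_into) simp
    then consider "W n = {}" | x where "x \<notin> Z" "W n = U x" using \<F>(1) by auto
    then show ?thesis
    proof cases
      case 1
      then have "open (W n) \<and> open {} \<and> homeomorphism (W n) {} f f"
        by (simp add: homeomorphism_def)
      then show ?thesis by blast
    next
      case 2
      then show ?thesis using UV[of x] by auto
    qed
  qed
  have "(\<Union>n. W n) = \<Union>\<F>"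
    unfolding W_def using range_from_nat_into[of "insert {} \<F>"] \<F>(2) by simp
  then have cov: "- Z \<subseteq> (\<Union>n. W n)"
    using UV by (auto simp: \<F>(3))
  define T where "T n = disjointed (\<lambda>n. W n \<inter> (S - Z)) n" for n
  have [measurable]: "W n \<in> sets borel" for n using W[of n] by (auto intro: borel_open)
  have Tm[measurable]: "T n \<in> sets borel" for n
    unfolding T_def by (rule sets.range_disjointed_sets'[THEN range_subsetD]) (auto intro!: sets.Int sets.Diff)
  have TW: "T n \<subseteq> W n" for n
    unfolding T_def using disjointed_subset[of "\<lambda>n. W n \<inter> (S - Z)" n] by blast
  have Tdisj: "disjoint_family T" unfolding T_def by (rule disjoint_family_disjointed)
  have TU: "(\<Union>n. T n) = S - Z"
    unfolding T_def UN_disjointed_eq using cov by auto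
  have inj: "inj_on f (T n)" for n
  proof -
    obtain V g where "homeomorphism (W n) V f g" using W by blast
    then show ?thesis using TW[of n] unfolding homeomorphism_def inj_on_def by (metis subsetD)
  qed
  have Tim[measurable]: "f ` T n \<in> sets borel" for n
    using emeasure_image_injective_C1(1)[OF der meas _ _ Tm TW] W by blast
  have count: "emeasure (count_space UNIV) {x\<in>S. f x = y} = (\<Sum>n. indicator (f ` T n) y)"
    if "y \<notin> f ` Z" for y
  proof -
    have eq: "{x\<in>S. f x = y} = (\<Union>n. {x\<in>T n. f x = y})"
      using that TU by auto
    have one: "emeasure (count_space UNIV) {x\<in>T n. f x = y} = indicator (f ` T n) y" for n
    proof (cases "y \<in> f ` T n")
      case True
      then obtain x where "x \<in> T n" "f x = y" by auto
      then have "{x\<in>T n. f x = y} = {x}" using inj[of n] by (auto dest: inj_onD)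
      then show ?thesis using True by simp
    next
      case False
      then have empty: "{x\<in>T n. f x = y} = {}" by auto
      show ?thesis using False unfolding empty by simp
    qed
    have "emeasure (count_space UNIV) {x\<in>S. f x = y}
        = (\<Sum>n. emeasure (count_space UNIV) {x\<in>T n. f x = y})"
      unfolding eq using Tdisj
      by (intro suminf_emeasure[symmetric]) (auto simp: disjoint_family_on_def)
    then show ?thesis unfolding one .
  qed
  have "negligible (f ` Z)"
    by (rule baby_Sard[where f' = "\<lambda>x. (*v) (f' x)"])
      (auto simp: Z_def det_eq_0_rank intro: has_derivative_at_withinI der)
  then have "f ` Z \<in> null_sets lebesgue" by (simp add: negligible_iff_null_sets)
  then have "AE y in lebesgue. y \<notin> f ` Z" by (rule AE_not_in)
  then have "AE y in lborel. y \<notin> f ` Z" by (simp add: AE_completion_iff)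
  then have "(\<integral>\<^sup>+y. h y * emeasure (count_space UNIV) {x\<in>S. f x = y} \<partial>lborel)
      = (\<integral>\<^sup>+y. (\<Sum>n. h y * indicator (f ` T n) y) \<partial>lborel)"
    by (intro nn_integral_cong_AE) (auto simp: count ennreal_suminf_cmult)
  also have "\<dots> = (\<Sum>n. \<integral>\<^sup>+y\<in>f ` T n. h y \<partial>lborel)"
    by (rule nn_integral_suminf) measurable
  also have "\<dots> = (\<Sum>n. \<integral>\<^sup>+x\<in>T n. h (f x) * ennreal \<bar>det (f' x)\<bar> \<partial>lborel)"
  proof (rule suminf_cong)
    fix n
    obtain V g where "homeomorphism (W n) V f g" "open V" using W by blast
    then show "(\<integral>\<^sup>+y\<in>f ` T n. h y \<partial>lborel) = (\<integral>\<^sup>+x\<in>T n. h (f x) * ennreal \<bar>det (f' x)\<bar> \<partial>lborel)"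
      using der meas Tm TW h by (intro nn_integral_injective_C1)
  qed
  also have "\<dots> = (\<integral>\<^sup>+x. (\<Sum>n. h (f x) * ennreal \<bar>det (f' x)\<bar> * indicator (T n) x) \<partial>lborel)"
    by (rule nn_integral_suminf[symmetric]) measurable
  also have "\<dots> = (\<integral>\<^sup>+x. h (f x) * ennreal \<bar>det (f' x)\<bar> * indicator (S - Z) x \<partial>lborel)"
    unfolding TU[symmetric]
    by (intro nn_integral_cong) (simp add: suminf_indicator[OF Tdisj] ennreal_suminf_cmult)
  also have "\<dots> = (\<integral>\<^sup>+x\<in>S. h (f x) * ennreal \<bar>det (f' x)\<bar> \<partial>lborel)"
    by (intro nn_integral_cong) (auto simp: Z_def split: split_indicator)
  finally show ?thesis .
qed

section \<open>Transfer of the area formula to pairs of real numbers\<close>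

lemma distr_lborel_real2_prod:
  "distr lborel borel (\<lambda>x :: real^2. (x $ 1, x $ 2)) = (lborel :: (real \<times> real) measure)"
proof (rule lborel_eqI[symmetric])
  fix l u :: "real \<times> real"
  assume le: "\<And>b. b \<in> Basis \<Longrightarrow> l \<bullet> b \<le> u \<bullet> b"
  obtain l1 l2 u1 u2 where lu: "l = (l1, l2)" "u = (u1, u2)" by fastforce
  have le': "l1 \<le> u1" "l2 \<le> u2"
    using le[of "(1, 0)"] le[of "(0, 1)"] by (auto simp: lu Basis_prod_def)
  have "(\<lambda>x :: real^2. (x $ 1, x $ 2)) -` box l u = box (vector [l1, l2]) (vector [u1, u2])"
    by (auto simp: lu box_prod mem_box_cart forall_2)
  moreover have "(\<lambda>x :: real^2. (x $ 1, x $ 2)) \<in> borel_measurable borel"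
    by (intro borel_measurable_continuous_onI continuous_intros)
  ultimately have "emeasure (distr lborel borel (\<lambda>x :: real^2. (x $ 1, x $ 2))) (box l u)
      = emeasure lborel (box (vector [l1, l2]) (vector [u1, u2]) :: (real^2) set)"
    by (subst emeasure_distr) auto
  also have "\<dots> = ennreal (\<Prod>b\<in>Basis. (u - l) \<bullet> b)"
  proof -
    have B: "(Basis :: (real^2) set) = {axis 1 1, axis 2 1}"
      by (auto simp: Basis_vec_def UNIV_2)
    have ne: "(axis 1 1 :: real^2) \<noteq> axis 2 1" by (simp add: axis_eq_axis)
    show ?thesis using le'
      by (subst emeasure_lborel_box)
        (auto simp: B ne lu inner_axis Basis_prod_def algebra_simps)
  qed
  finally show "emeasure (distr lborel borel (\<lambda>x :: real^2. (x $ 1, x $ 2))) (box l u)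
      = ennreal (\<Prod>b\<in>Basis. (u - l) \<bullet> b)" .
qed simp

text \<open>Valid without measurability of \<open>k\<close>: a simple function below
  \<open>k\<close> pulls back to one below \<open>k (T x)\<close> with the same integral. For a
  bijection that is measurable in both directions, two uses give equality.\<close>

lemma nn_integral_distr_le:
  assumes T: "T \<in> measurable M N"
  shows "integral\<^sup>N (distr M N T) k \<le> (\<integral>\<^sup>+x. k (T x) \<partial>M)"
  unfolding nn_integral_def[of "distr M N T"]
proof (rule SUP_least)
  fix g assume "g \<in> {g. simple_function (distr M N T) g \<and> g \<le> k}"
  then have g: "simple_function (distr M N T) g" "g \<le> k" by auto
  have "integral\<^sup>S (distr M N T) g = integral\<^sup>N (distr M N T) g"
    using g(1) by (rule nn_integral_eq_simple_integral[symmetric])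
  also have "\<dots> = (\<integral>\<^sup>+x. g (T x) \<partial>M)"
    using borel_measurable_simple_function[OF g(1)] T by (intro nn_integral_distr) auto
  also have "\<dots> \<le> (\<integral>\<^sup>+x. k (T x) \<partial>M)"
    using g(2) by (intro nn_integral_mono) (auto simp: le_fun_def)
  finally show "integral\<^sup>S (distr M N T) g \<le> (\<integral>\<^sup>+x. k (T x) \<partial>M)" .
qed

lemma emeasure_count_space_bij:
  assumes "bij_betw f A B"
  shows "emeasure (count_space UNIV) A = emeasure (count_space UNIV) B"
  using bij_betw_finite[OF assms] bij_betw_same_card[OF assms]
  by (simp add: emeasure_count_space)

lemma area_formula_plane:
  fixes H :: "real \<times> real \<Rightarrow> real \<times> real"
  assumes der: "\<And>x. (H has_derivative (\<lambda>(s, t). (a x * s + b x * t, c x * s + d x * t))) (at x)"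
    and cont: "continuous_on UNIV a" "continuous_on UNIV b" "continuous_on UNIV c" "continuous_on UNIV d"
    and S[measurable]: "S \<in> sets borel"
    and h[measurable]: "h \<in> borel_measurable borel"
  shows "(\<integral>\<^sup>+y. h y * emeasure (count_space UNIV) {x\<in>S. H x = y} \<partial>lborel)
    = (\<integral>\<^sup>+x\<in>S. h (H x) * ennreal \<bar>a x * d x - b x * c x\<bar> \<partial>lborel)"
proof -
  let ?T = "\<lambda>x :: real^2. (x $ 1, x $ 2)"
  let ?R = "\<lambda>y :: real \<times> real. vector [fst y, snd y] :: real^2"
  have TR[simp]: "?T (?R y) = y" for y by simp
  have RT[simp]: "vector [x $ 1, x $ 2] = x" for x :: "real^2" by (simp add: vec_eq_iff forall_2)
  have Tm[measurable]: "?T \<in> borel_measurable borel"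
    by (intro borel_measurable_continuous_onI continuous_intros)
  let ?f = "\<lambda>x. ?R (H (?T x))"
  let ?f' = "\<lambda>x. vector [vector [a (?T x), b (?T x)], vector [c (?T x), d (?T x)]] :: real^2^2"
  have bT: "bounded_linear ?T"
    by (intro bounded_linear_Pair bounded_linear_vec_nth)
  have bR: "bounded_linear ?R"
    by (rule linear_conv_bounded_linear[THEN iffD1])
      (auto intro!: linearI simp: vec_eq_iff forall_2)
  have derf: "(?f has_derivative (*v) (?f' x)) (at x)" for x
  proof -
    have "(?f has_derivative (\<lambda>z. ?R ((\<lambda>(s, t). (a (?T x) * s + b (?T x) * t, c (?T x) * s + d (?T x) * t)) (?T z)))) (at x)"
      by (intro bounded_linear.has_derivative[OF bR]
          has_derivative_compose[OF bounded_linear.has_derivative[OF bT has_derivative_ident] der])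
    also have "(\<lambda>z. ?R ((\<lambda>(s, t). (a (?T x) * s + b (?T x) * t, c (?T x) * s + d (?T x) * t)) (?T z))) = (*v) (?f' x)"
      by (auto simp: fun_eq_iff vec_eq_iff forall_2 matrix_vector_mult_def sum_2)
    finally show ?thesis .
  qed
  have cT: "continuous_on UNIV (\<lambda>x. k (?T x))" if "continuous_on UNIV k" for k :: "real \<times> real \<Rightarrow> real"
    by (rule continuous_on_compose2[OF that]) (auto intro!: continuous_intros)
  have contf: "continuous_on UNIV ?f'"
  proof -
    have eq: "?f' = (\<lambda>x. \<chi> i j. if i = 1 then (if j = 1 then a (?T x) else b (?T x))
        else (if j = 1 then c (?T x) else d (?T x)))"
      by (auto simp: fun_eq_iff vec_eq_iff forall_2)
    have "continuous_on UNIV (\<lambda>x. if i = 1 then (if j = 1 then a (?T x) else b (?T x))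
        else (if j = 1 then c (?T x) else d (?T x)))" for i j :: 2
      using cont[THEN cT] by (cases "i = 1"; cases "j = 1") auto
    then show ?thesis unfolding eq by (intro continuous_on_vec_lambda)
  qed
  have "(\<integral>\<^sup>+y. h (?T y) * emeasure (count_space UNIV) {x\<in>?T -` S. ?f x = y} \<partial>lborel)
    = (\<integral>\<^sup>+x\<in>?T -` S. h (?T (?f x)) * ennreal \<bar>det (?f' x)\<bar> \<partial>lborel)"
    by (intro area_formula derf contf) (use measurable_sets[OF Tm S] in auto)
  moreover have "emeasure (count_space UNIV) {x\<in>?T -` S. ?f x = y}
      = emeasure (count_space UNIV) {x\<in>S. H x = ?T y}" for y
  proof -
    have "bij_betw ?T {x\<in>?T -` S. ?f x = y} {x\<in>S. H x = ?T y}"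
      by (rule bij_betw_byWitness[where f' = ?R]) (auto simp: vec_eq_iff forall_2 prod_eq_iff)
    then show ?thesis by (rule emeasure_count_space_bij)
  qed
  moreover have "det (?f' x) = a (?T x) * d (?T x) - b (?T x) * c (?T x)" for x
    by (simp add: det_2)
  ultimately have main: "(\<integral>\<^sup>+y. h (?T y) * emeasure (count_space UNIV) {x\<in>S. H x = ?T y} \<partial>lborel)
    = (\<integral>\<^sup>+x. h (H (?T x)) * ennreal \<bar>a (?T x) * d (?T x) - b (?T x) * c (?T x)\<bar> * indicator S (?T x) \<partial>lborel)"
    by (simp add: indicator_vimage)
  \<comment> \<open>The integrand contains a count of preimages that is not known to be measurable
    here, so equality comes from the one-sided estimate for \<open>?T\<close> and for its inverse
    \<open>?R\<close>.\<close>
  have transfer: "integral\<^sup>N (lborel :: (real \<times> real) measure) k = (\<integral>\<^sup>+x. k (?T x) \<partial>lborel)"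
    for k :: "real \<times> real \<Rightarrow> ennreal"
  proof (rule antisym)
    show "integral\<^sup>N (lborel :: (real \<times> real) measure) k \<le> (\<integral>\<^sup>+x. k (?T x) \<partial>lborel)"
      using nn_integral_distr_le[OF Tm[unfolded measurable_lborel2[symmetric]], of k]
      by (simp add: distr_lborel_real2_prod)
    have Rm: "?R \<in> borel_measurable borel"
      by (intro borel_measurable_continuous_onI linear_continuous_on bR)
    have "(lborel :: (real^2) measure) = distr (distr lborel borel ?T) borel ?R"
      using Rm by (subst distr_distr) (auto simp: comp_def distr_id2)
    then have "distr (lborel :: (real \<times> real) measure) borel ?R = lborel"
      by (simp add: distr_lborel_real2_prod)
    with nn_integral_distr_le[OF Rm[unfolded measurable_lborel2[symmetric]], of "\<lambda>x. k (?T x)"]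
    show "(\<integral>\<^sup>+x. k (?T x) \<partial>lborel) \<le> integral\<^sup>N (lborel :: (real \<times> real) measure) k"
      by simp
  qed
  show ?thesis using main unfolding transfer .
qed

section \<open>Measurability of the number of zeros\<close>

text \<open>On a compact set a continuous function has a zero iff its norm becomes arbitrarily small
  on a countable dense subset, because the norm attains its infimum. This replaces an uncountable
  union by countable operations.\<close>

lemma measurable_zero_in_compact:
  fixes F :: "'c \<Rightarrow> 'a::euclidean_space \<Rightarrow> 'b::{second_countable_topology, real_normed_vector}"
  assumes K: "compact K" and cont: "\<And>c. c \<in> space M \<Longrightarrow> continuous_on K (F c)"
    and meas: "\<And>x. x \<in> K \<Longrightarrow> (\<lambda>c. F c x) \<in> borel_measurable M"
  shows "{c \<in> space M. \<exists>x\<in>K. F c x = 0} \<in> sets M"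
proof -
  obtain D where D: "countable D" "D \<subseteq> K" "K \<subseteq> closure D"
    by (rule separable)
  have "(\<exists>x\<in>K. F c x = 0) \<longleftrightarrow> (\<forall>n. \<exists>x\<in>D. norm (F c x) < 1 / Suc n)" if c: "c \<in> space M" for c
  proof
    assume "\<exists>x\<in>K. F c x = 0"
    then obtain x where x: "x \<in> K" "F c x = 0" by blast
    show "\<forall>n. \<exists>x\<in>D. norm (F c x) < 1 / Suc n"
    proof
      fix n
      have "0 < 1 / real (Suc n)" by simp
      then obtain d where d: "d > 0" "\<And>y. y \<in> K \<Longrightarrow> dist y x < d \<Longrightarrow> dist (F c y) (F c x) < 1 / Suc n"
        using cont[OF c] x(1) unfolding continuous_on_iff by blast
      obtain y where "y \<in> D" "dist y x < d"
        using closure_approachable[of x D] D(3) x(1) d(1) by blast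
      with d(2)[of y] D(2) x(2) show "\<exists>x\<in>D. norm (F c x) < 1 / Suc n" by auto
    qed
  next
    assume *: "\<forall>n. \<exists>x\<in>D. norm (F c x) < 1 / Suc n"
    then have "K \<noteq> {}" using D(2) by blast
    then obtain m where m: "m \<in> K" "\<And>y. y \<in> K \<Longrightarrow> norm (F c m) \<le> norm (F c y)"
      using continuous_attains_inf[OF K, of "\<lambda>y. norm (F c y)"] cont[OF c]
      by (auto intro: continuous_intros)
    have "norm (F c m) < 1 / Suc n" for n
      using * m(2) D(2) by (meson le_less_trans subsetD)
    then have "\<not> 0 < norm (F c m)"
      by (metis inverse_eq_divide less_asym reals_Archimedean)
    with m(1) show "\<exists>x\<in>K. F c x = 0" by auto
  qed
  then have "{c \<in> space M. \<exists>x\<in>K. F c x = 0}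
      = (\<Inter>n. \<Union>x\<in>D. {c \<in> space M. norm (F c x) < 1 / Suc n})"
    using D(1) by auto
  also have "\<dots> \<in> sets M"
  proof -
    have "{c \<in> space M. norm (F c x) < 1 / Suc n} \<in> sets M" if "x \<in> D" for x n
    proof -
      have [measurable]: "(\<lambda>c. F c x) \<in> borel_measurable M" using that D(2) meas by blast
      show ?thesis by measurable
    qed
    then have "(\<Union>x\<in>D. {c \<in> space M. norm (F c x) < 1 / Suc n}) \<in> sets M" for n
      by (intro sets.countable_UN'[OF D(1)]) auto
    then show ?thesis by (intro sets.countable_INT) auto
  qed
  finally show ?thesis .
qed

text \<open>A half-open rectangle is a countable union of compact ones. Half-open rectangles are
  wanted because they tile the plane without overlap.\<close>

lemma measurable_zero_in_rectangle:
  fixes F :: "'c \<Rightarrow> real \<times> real \<Rightarrow> 'b::{second_countable_topology, real_normed_vector}"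
  assumes cont: "\<And>c. c \<in> space M \<Longrightarrow> continuous_on UNIV (F c)"
    and meas: "\<And>x. (\<lambda>c. F c x) \<in> borel_measurable M"
  shows "{c \<in> space M. \<exists>x\<in>{a..<b} \<times> {a'..<b'}. F c x = 0} \<in> sets M"
proof -
  have "{a..<b} \<times> {a'..<b'} = (\<Union>n. {a..b - 1 / Suc n} \<times> {a'..b' - 1 / Suc n})"
  proof (intro equalityI subsetI)
    fix x assume x: "x \<in> {a..<b} \<times> {a'..<b'}"
    then obtain n where "inverse (real (Suc n)) < min (b - fst x) (b' - snd x)"
      using reals_Archimedean[of "min (b - fst x) (b' - snd x)"] by (auto simp: mem_Times_iff)
    with x show "x \<in> (\<Union>n. {a..b - 1 / Suc n} \<times> {a'..b' - 1 / Suc n})"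
      by (intro UN_I[of n]) (auto simp: mem_Times_iff inverse_eq_divide)
  next
    fix x assume "x \<in> (\<Union>n. {a..b - 1 / Suc n} \<times> {a'..b' - 1 / Suc n})"
    then obtain n where n: "x \<in> {a..b - 1 / Suc n} \<times> {a'..b' - 1 / Suc n}" by blast
    define e where "e = 1 / real (Suc n)"
    have "e > 0" by (simp add: e_def)
    then show "x \<in> {a..<b} \<times> {a'..<b'}"
      using n unfolding e_def[symmetric] by (auto simp: mem_Times_iff)
  qed
  then have "{c \<in> space M. \<exists>x\<in>{a..<b} \<times> {a'..<b'}. F c x = 0}
      = (\<Union>n. {c \<in> space M. \<exists>x\<in>{a..b - 1 / Suc n} \<times> {a'..b' - 1 / Suc n}. F c x = 0})"
    by auto
  also have "\<dots> \<in> sets M"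
    by (intro sets.countable_UN'' measurable_zero_in_compact compact_Times meas)
      (auto intro: continuous_on_subset[OF cont])
  finally show ?thesis .
qed

definition dyadic_cell :: "nat \<Rightarrow> real \<times> real \<Rightarrow> int \<times> int" where
  "dyadic_cell n x = (\<lfloor>2 ^ n * fst x\<rfloor>, \<lfloor>2 ^ n * snd x\<rfloor>)"

lemma eventually_floor_power_neq:
  fixes x y :: real
  assumes "x \<noteq> y"
  shows "\<forall>\<^sub>F n in sequentially. \<lfloor>2 ^ n * x\<rfloor> \<noteq> \<lfloor>2 ^ n * y\<rfloor>"
proof -
  obtain N where N: "1 / \<bar>x - y\<bar> < 2 ^ N" using real_arch_pow[of 2] by auto
  show ?thesis
  proof (rule eventually_sequentiallyI[of N])
    fix n assume "N \<le> n"
    then have "(2::real) ^ N \<le> 2 ^ n" by (rule power_increasing) simp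
    then have "2 ^ N * \<bar>x - y\<bar> \<le> 2 ^ n * \<bar>x - y\<bar>" by (rule mult_right_mono) simp
    moreover have "1 < 2 ^ N * \<bar>x - y\<bar>" using N assms by (simp add: field_simps)
    ultimately have "1 < 2 ^ n * \<bar>x - y\<bar>" by linarith
    also have "\<dots> = \<bar>2 ^ n * x - 2 ^ n * y\<bar>" by (simp add: abs_mult flip: right_diff_distrib)
    finally show "\<lfloor>2 ^ n * x\<rfloor> \<noteq> \<lfloor>2 ^ n * y\<rfloor>" by linarith
  qed
qed

lemma inj_on_dyadic_cell:
  assumes "finite T"
  shows "\<exists>n. inj_on (dyadic_cell n) T"
proof -
  have "\<forall>\<^sub>F n in sequentially. x \<noteq> y \<longrightarrow> dyadic_cell n x \<noteq> dyadic_cell n y" for x y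
  proof (cases "fst x = fst y")
    case True
    then show ?thesis using eventually_floor_power_neq[of "snd x" "snd y"]
      by (auto simp: dyadic_cell_def prod_eq_iff elim: eventually_mono)
  next
    case False
    then show ?thesis using eventually_floor_power_neq[of "fst x" "fst y"]
      by (auto simp: dyadic_cell_def prod_eq_iff elim: eventually_mono)
  qed
  then have "\<forall>\<^sub>F n in sequentially. \<forall>x\<in>T. \<forall>y\<in>T. x \<noteq> y \<longrightarrow> dyadic_cell n x \<noteq> dyadic_cell n y"
    using assms by (intro eventually_ball_finite ballI) auto
  then obtain n where "\<forall>x\<in>T. \<forall>y\<in>T. x \<noteq> y \<longrightarrow> dyadic_cell n x \<noteq> dyadic_cell n y"
    by (auto simp: eventually_sequentially)
  then show ?thesis by (auto simp: inj_on_def)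
qed

text \<open>Distinct points of a finite set lie in different dyadic squares once the side is small
  enough, so some level counts a given finite subset fully, while no level can overcount. An
  infinite \<open>A\<close> has finite subsets of every size, which makes the supremum
  infinite.\<close>

lemma count_eq_SUP_dyadic_cells:
  "emeasure (count_space UNIV) A = (SUP n. emeasure (count_space UNIV) (dyadic_cell n ` A))"
proof (rule antisym)
  have fin: "\<exists>n. of_nat (card T) \<le> emeasure (count_space UNIV) (dyadic_cell n ` A)"
    if T: "finite T" "T \<subseteq> A" for T
  proof -
    obtain n where n: "inj_on (dyadic_cell n) T" using inj_on_dyadic_cell[OF T(1)] by blast
    have "of_nat (card T) = emeasure (count_space UNIV) (dyadic_cell n ` T)"
      using T(1) card_image[OF n] by simp
    also have "\<dots> \<le> emeasure (count_space UNIV) (dyadic_cell n ` A)"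
      using T(2) by (intro emeasure_mono) auto
    finally show ?thesis by blast
  qed
  let ?s = "SUP n. emeasure (count_space UNIV) (dyadic_cell n ` A)"
  have fin': "of_nat (card T) \<le> ?s" if "finite T" "T \<subseteq> A" for T
    using fin[OF that] by (meson SUP_upper2 UNIV_I)
  show "emeasure (count_space UNIV) A \<le> ?s"
  proof (cases "finite A")
    case True
    then show ?thesis using fin'[of A] by simp
  next
    case False
    have "of_nat m \<le> ?s" for m
      using infinite_arbitrarily_large[OF False, of m] fin' by metis
    then have "\<not> ?s < \<top>"
      using ennreal_Ex_less_of_nat[of ?s] by (meson not_le)
    then show ?thesis unfolding not_less by (rule order_trans[OF top_greatest])
  qed
  have "emeasure (count_space UNIV) (dyadic_cell n ` A) \<le> emeasure (count_space UNIV) A" for n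
    by (cases "finite A") (auto simp: card_image_le)
  then show "?s \<le> emeasure (count_space UNIV) A" by (intro SUP_least)
qed

text \<open>At each level the number of dyadic squares containing a zero is a finite sum of
  indicators of measurable sets, since finitely many squares meet the bounded region. The number of
  zeros is the supremum over the levels.\<close>

lemma borel_measurable_count_zeros:
  fixes F :: "'c \<Rightarrow> real \<times> real \<Rightarrow> 'b::{second_countable_topology, real_normed_vector}"
  assumes cont: "\<And>c. c \<in> space M \<Longrightarrow> continuous_on UNIV (F c)"
    and meas: "\<And>x. (\<lambda>c. F c x) \<in> borel_measurable M"
  shows "(\<lambda>c. emeasure (count_space UNIV) {x \<in> {0..<L} \<times> {0..<L}. F c x = 0}) \<in> borel_measurable M"
proof -
  let ?S = "{0..<L} \<times> {0..<L}"
  let ?A = "\<lambda>n p. {c \<in> space M. \<exists>x\<in>?S. F c x = 0 \<and> dyadic_cell n x = p}"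
  have A: "?A n p \<in> sets M" for n p
  proof -
    obtain i j where p: "p = (i, j)" by fastforce
    have cell: "x \<in> ?S \<and> dyadic_cell n x = p \<longleftrightarrow>
        x \<in> {max 0 (i / 2 ^ n)..<min L ((i + 1) / 2 ^ n)} \<times> {max 0 (j / 2 ^ n)..<min L ((j + 1) / 2 ^ n)}" for x
      by (auto simp: p dyadic_cell_def floor_eq_iff field_simps mem_Times_iff)
    have "?A n p = {c \<in> space M. \<exists>x\<in>{max 0 (i / 2 ^ n)..<min L ((i + 1) / 2 ^ n)} \<times>
        {max 0 (j / 2 ^ n)..<min L ((j + 1) / 2 ^ n)}. F c x = 0}"
      using cell by blast
    then show ?thesis
      using measurable_zero_in_rectangle[OF cont meas] by simp
  qed
  let ?I = "\<lambda>n. {0..\<lfloor>2 ^ n * L\<rfloor>} \<times> {0..\<lfloor>2 ^ n * L\<rfloor>}"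
  have I: "dyadic_cell n x \<in> ?I n" if "x \<in> ?S" for n x
    using that by (auto simp: dyadic_cell_def mem_Times_iff intro!: floor_mono)
  have "emeasure (count_space UNIV) (dyadic_cell n ` {x \<in> ?S. F c x = 0}) = (\<Sum>p\<in>?I n. indicator (?A n p) c)"
    if c: "c \<in> space M" for n c
  proof -
    let ?C = "dyadic_cell n ` {x \<in> ?S. F c x = 0}"
    have C: "?C \<subseteq> ?I n" by (rule image_subsetI) (use I in blast)
    have "(\<Sum>p\<in>?I n. indicator (?A n p) c :: ennreal) = (\<Sum>p\<in>?I n. indicator ?C p)"
    proof (rule sum.cong)
      fix p
      have "c \<in> ?A n p \<longleftrightarrow> p \<in> ?C" using c by blast
      then show "indicator (?A n p) c = (indicator ?C p :: ennreal)" by (simp add: indicator_def)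
    qed simp
    also have "\<dots> = of_nat (card (?I n \<inter> ?C))"
      by (simp add: indicator_def of_bool_def sum.If_cases)
    also have "?I n \<inter> ?C = ?C" using C by blast
    finally show ?thesis using finite_subset[OF C] by simp
  qed
  then have "emeasure (count_space UNIV) {x \<in> ?S. F c x = 0}
      = (SUP n. \<Sum>p\<in>?I n. indicator (?A n p) c)" if "c \<in> space M" for c
    using that by (subst count_eq_SUP_dyadic_cells) simp
  moreover have "(\<lambda>c. SUP n. \<Sum>p\<in>?I n. indicator (?A n p) c :: ennreal) \<in> borel_measurable M"
    using A by (intro borel_measurable_SUP borel_measurable_sum borel_measurable_indicator) auto
  ultimately show ?thesis by (subst measurable_cong) auto
qed

section \<open>Rotations of the coefficient space\<close>

lemma nn_integral_lborel_translate:
  fixes f :: "'a::euclidean_space \<Rightarrow> ennreal"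
  assumes [measurable]: "f \<in> borel_measurable borel"
  shows "(\<integral>\<^sup>+x. f (a + x) \<partial>lborel) = integral\<^sup>N lborel f"
proof -
  have "integral\<^sup>N lborel f = integral\<^sup>N (distr lborel borel ((+) a)) f"
    by (simp add: lborel_distr_plus)
  then show ?thesis by (simp add: nn_integral_distr)
qed

lemma nn_integral_shear_snd:
  fixes h :: "'a::euclidean_space \<times> 'a \<Rightarrow> ennreal"
  assumes [measurable]: "h \<in> borel_measurable borel"
  shows "(\<integral>\<^sup>+x. \<integral>\<^sup>+y. h (x, y + t *\<^sub>R x) \<partial>lborel \<partial>lborel) = (\<integral>\<^sup>+x. \<integral>\<^sup>+y. h (x, y) \<partial>lborel \<partial>lborel)"
proof (rule nn_integral_cong)
  fix x
  show "(\<integral>\<^sup>+y. h (x, y + t *\<^sub>R x) \<partial>lborel) = (\<integral>\<^sup>+y. h (x, y) \<partial>lborel)"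
    using nn_integral_lborel_translate[of "\<lambda>y. h (x, y)" "t *\<^sub>R x"] by (simp add: add.commute)
qed

lemma nn_integral_shear_fst:
  fixes h :: "'a::euclidean_space \<times> 'a \<Rightarrow> ennreal"
  assumes [measurable]: "h \<in> borel_measurable borel"
  shows "(\<integral>\<^sup>+x. \<integral>\<^sup>+y. h (x + t *\<^sub>R y, y) \<partial>lborel \<partial>lborel) = (\<integral>\<^sup>+x. \<integral>\<^sup>+y. h (x, y) \<partial>lborel \<partial>lborel)"
proof -
  have [measurable]: "(\<lambda>(y, x). h (x, y)) \<in> borel_measurable borel"
    by (subst borel_prod[symmetric]) measurable
  have "(\<integral>\<^sup>+x. \<integral>\<^sup>+y. h (x + t *\<^sub>R y, y) \<partial>lborel \<partial>lborel) = (\<integral>\<^sup>+y. \<integral>\<^sup>+x. h (x + t *\<^sub>R y, y) \<partial>lborel \<partial>lborel)"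
    by (rule lborel_pair.Fubini'[symmetric]) measurable
  also have "\<dots> = (\<integral>\<^sup>+y. \<integral>\<^sup>+x. h (x, y) \<partial>lborel \<partial>lborel)"
    using nn_integral_shear_snd[of "\<lambda>(y, x). h (x, y)" t] by simp
  also have "\<dots> = (\<integral>\<^sup>+x. \<integral>\<^sup>+y. h (x, y) \<partial>lborel \<partial>lborel)"
    by (rule lborel_pair.Fubini') measurable
  finally show ?thesis .
qed

text \<open>A rotation by an angle other than \<open>pi\<close> is the product of three shears.\<close>

lemma nn_integral_rotation:
  fixes h :: "'a::euclidean_space \<times> 'a \<Rightarrow> ennreal"
  assumes h[measurable]: "h \<in> borel_measurable borel" and ab: "a\<^sup>2 + b\<^sup>2 = 1"
  shows "(\<integral>\<^sup>+x. \<integral>\<^sup>+y. h (a *\<^sub>R x - b *\<^sub>R y, b *\<^sub>R x + a *\<^sub>R y) \<partial>lborel \<partial>lborel)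
    = (\<integral>\<^sup>+x. \<integral>\<^sup>+y. h (x, y) \<partial>lborel \<partial>lborel)"
proof -
  have main: "(\<integral>\<^sup>+x. \<integral>\<^sup>+y. h (a *\<^sub>R x - b *\<^sub>R y, b *\<^sub>R x + a *\<^sub>R y) \<partial>lborel \<partial>lborel)
      = (\<integral>\<^sup>+x. \<integral>\<^sup>+y. h (x, y) \<partial>lborel \<partial>lborel)"
    if [measurable]: "h \<in> borel_measurable borel" and ab: "a\<^sup>2 + b\<^sup>2 = 1" and ne: "a \<noteq> -1"
    for a b and h :: "'a \<times> 'a \<Rightarrow> ennreal"
  proof -
    \<comment> \<open>For \<open>a = cos \<theta>\<close> and \<open>b = sin \<theta>\<close> this
      is the tangent of half the angle; the three shears have the parameters \<open>- t\<close>,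
      \<open>b\<close> and \<open>- t\<close>.\<close>
    define t where "t = b / (1 + a)"
    have t: "t * (1 + a) = b" "b * t = 1 - a"
    proof -
      have "1 + a \<noteq> 0" using ne by linarith
      then show "t * (1 + a) = b" by (simp add: t_def)
      have "b * b = (1 - a) * (1 + a)" using ab by (simp add: algebra_simps power2_eq_square)
      with \<open>1 + a \<noteq> 0\<close> show "b * t = 1 - a" by (simp add: t_def field_simps)
    qed
    have e2: "x + (- t) *\<^sub>R y + (- t) *\<^sub>R (y + b *\<^sub>R (x + (- t) *\<^sub>R y)) = a *\<^sub>R x - b *\<^sub>R y" for x y :: 'a
    proof -
      have "x + (- t) *\<^sub>R y + (- t) *\<^sub>R (y + b *\<^sub>R (x + (- t) *\<^sub>R y))
          = (1 - b * t) *\<^sub>R x - (t + t * (1 - b * t)) *\<^sub>R y"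
        by (simp add: algebra_simps, simp flip: scaleR_add_left)
      moreover have "1 - b * t = a" "t + t * a = b" using t by (simp_all add: algebra_simps)
      ultimately show ?thesis by (simp add: t)
    qed
    have e1: "y + b *\<^sub>R (x + (- t) *\<^sub>R y) = b *\<^sub>R x + a *\<^sub>R y" for x y :: 'a
    proof -
      have "y + b *\<^sub>R (x + (- t) *\<^sub>R y) = b *\<^sub>R x + (1 - b * t) *\<^sub>R y"
        by (simp add: algebra_simps)
      then show ?thesis by (simp add: t)
    qed
    let ?h1 = "\<lambda>(x, y). h (x + (- t) *\<^sub>R y, y)"
    let ?h2 = "\<lambda>(x, y). ?h1 (x, y + b *\<^sub>R x)"
    have "(\<integral>\<^sup>+x. \<integral>\<^sup>+y. h (a *\<^sub>R x - b *\<^sub>R y, b *\<^sub>R x + a *\<^sub>R y) \<partial>lborel \<partial>lborel)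
        = (\<integral>\<^sup>+x. \<integral>\<^sup>+y. ?h2 (x + (- t) *\<^sub>R y, y) \<partial>lborel \<partial>lborel)"
      by (simp only: e1 e2[unfolded e1] prod.case)
    also have "\<dots> = (\<integral>\<^sup>+x. \<integral>\<^sup>+y. ?h2 (x, y) \<partial>lborel \<partial>lborel)"
      by (rule nn_integral_shear_fst, subst borel_prod[symmetric], measurable)
    also have "\<dots> = (\<integral>\<^sup>+x. \<integral>\<^sup>+y. ?h1 (x, y + b *\<^sub>R x) \<partial>lborel \<partial>lborel)" by simp
    also have "\<dots> = (\<integral>\<^sup>+x. \<integral>\<^sup>+y. ?h1 (x, y) \<partial>lborel \<partial>lborel)"
      by (rule nn_integral_shear_snd, subst borel_prod[symmetric], measurable)
    also have "\<dots> = (\<integral>\<^sup>+x. \<integral>\<^sup>+y. h (x + (- t) *\<^sub>R y, y) \<partial>lborel \<partial>lborel)" by simp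
    also have "\<dots> = (\<integral>\<^sup>+x. \<integral>\<^sup>+y. h (x, y) \<partial>lborel \<partial>lborel)"
      by (rule nn_integral_shear_fst) measurable
    finally show ?thesis .
  qed
  show ?thesis
  proof (cases "a = -1")
    case False
    then show ?thesis using main h ab by blast
  next
    \<comment> \<open>The half turn is the quarter turn applied twice.\<close>
    case True
    with ab have [simp]: "b = 0" by simp
    have "(\<lambda>(x, y). h (- y, x)) \<in> borel_measurable borel"
      by (subst borel_prod[symmetric]) measurable
    then show ?thesis
      using main[of "\<lambda>(x, y). h (- y, x)" 0 1] main[of h 0 1] True by simp
  qed
qed

section \<open>Plane rotations of two coefficients\<close>

lemma nn_integral_PiM_insert2:
  fixes h :: "('i \<Rightarrow> 'a::euclidean_space) \<Rightarrow> ennreal"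
  assumes K: "finite K" "i \<notin> K" "j \<notin> K" "i \<noteq> j"
    and h[measurable]: "h \<in> borel_measurable (Pi\<^sub>M (insert i (insert j K)) (\<lambda>_. lborel))"
  shows "integral\<^sup>N (Pi\<^sub>M (insert i (insert j K)) (\<lambda>_. lborel)) h
    = (\<integral>\<^sup>+c. \<integral>\<^sup>+y. \<integral>\<^sup>+x. h (c(j := y, i := x)) \<partial>lborel \<partial>lborel \<partial>Pi\<^sub>M K (\<lambda>_. lborel))"
proof -
  interpret product_sigma_finite "\<lambda>_::'i. lborel :: 'a measure" by unfold_locales
  have "integral\<^sup>N (Pi\<^sub>M (insert i (insert j K)) (\<lambda>_. lborel)) h
      = (\<integral>\<^sup>+c. \<integral>\<^sup>+x. h (c(i := x)) \<partial>lborel \<partial>Pi\<^sub>M (insert j K) (\<lambda>_. lborel))"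
    using K by (intro product_nn_integral_insert) auto
  also have "\<dots> = (\<integral>\<^sup>+c. \<integral>\<^sup>+y. \<integral>\<^sup>+x. h (c(j := y, i := x)) \<partial>lborel \<partial>lborel \<partial>Pi\<^sub>M K (\<lambda>_. lborel))"
    using K by (intro product_nn_integral_insert) auto
  finally show ?thesis .
qed

lemma nn_integral_givens:
  fixes h :: "('i \<Rightarrow> 'a::euclidean_space) \<Rightarrow> ennreal"
  assumes I: "finite I" "i \<in> I" "j \<in> I" "i \<noteq> j"
    and h[measurable]: "h \<in> borel_measurable (Pi\<^sub>M I (\<lambda>_. lborel))" and ab: "a\<^sup>2 + b\<^sup>2 = 1"
  shows "(\<integral>\<^sup>+c. h (c(j := b *\<^sub>R c i + a *\<^sub>R c j, i := a *\<^sub>R c i - b *\<^sub>R c j)) \<partial>Pi\<^sub>M I (\<lambda>_. lborel))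
    = integral\<^sup>N (Pi\<^sub>M I (\<lambda>_. lborel)) h"
proof -
  define K where "K = I - {i, j}"
  have K: "finite K" "i \<notin> K" "j \<notin> K" and I_eq: "I = insert i (insert j K)"
    using I by (auto simp: K_def)
  note ins = nn_integral_PiM_insert2[OF K \<open>i \<noteq> j\<close>]
  define G where "G c = c(j := b *\<^sub>R c i + a *\<^sub>R c j, i := a *\<^sub>R c i - b *\<^sub>R c j)" for c :: "'i \<Rightarrow> 'a"
  have [measurable]: "G \<in> Pi\<^sub>M I (\<lambda>_. lborel) \<rightarrow>\<^sub>M Pi\<^sub>M I (\<lambda>_. lborel)"
    unfolding G_def using I by (intro measurable_fun_upd[where J = I]) auto
  \<comment> \<open>The outer variable \<open>y\<close> is the coefficient \<open>j\<close> and the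
    inner variable \<open>x\<close> the coefficient \<open>i\<close>; in this order the pair turns
    by the opposite angle, hence the \<open>- b\<close>.\<close>
  have G: "G (c(j := y, i := x)) = c(j := a *\<^sub>R y - (- b) *\<^sub>R x, i := (- b) *\<^sub>R y + a *\<^sub>R x)" for c x y
    using I(4) by (auto simp: G_def fun_eq_iff)
  have "(\<integral>\<^sup>+c. h (G c) \<partial>Pi\<^sub>M I (\<lambda>_. lborel))
    = (\<integral>\<^sup>+c. \<integral>\<^sup>+y. \<integral>\<^sup>+x. h (c(j := a *\<^sub>R y - (- b) *\<^sub>R x, i := (- b) *\<^sub>R y + a *\<^sub>R x)) \<partial>lborel \<partial>lborel
        \<partial>Pi\<^sub>M K (\<lambda>_. lborel))"
    unfolding G[symmetric] I_eq by (rule ins) (simp flip: I_eq)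
  also have "\<dots> = (\<integral>\<^sup>+c. \<integral>\<^sup>+y. \<integral>\<^sup>+x. h (c(j := y, i := x)) \<partial>lborel \<partial>lborel \<partial>Pi\<^sub>M K (\<lambda>_. lborel))"
  proof (rule nn_integral_cong)
    fix c assume c: "c \<in> space (Pi\<^sub>M K (\<lambda>_. lborel :: 'a measure))"
    have "(\<lambda>p. c(j := fst p)) \<in> borel \<Otimes>\<^sub>M borel \<rightarrow>\<^sub>M Pi\<^sub>M (insert j K) (\<lambda>_. lborel :: 'a measure)"
      by (rule measurable_fun_upd[where J = K]) (use c in auto)
    then have "(\<lambda>p. c(j := fst p, i := snd p)) \<in> borel \<Otimes>\<^sub>M borel \<rightarrow>\<^sub>M Pi\<^sub>M I (\<lambda>_. lborel :: 'a measure)"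
      by (rule measurable_fun_upd[where J = "insert j K", rotated]) (use I_eq in auto)
    then have "(\<lambda>p. h (c(j := fst p, i := snd p))) \<in> borel_measurable (borel \<Otimes>\<^sub>M borel)"
      by measurable
    then have [measurable]: "(\<lambda>p. h (c(j := fst p, i := snd p))) \<in> borel_measurable borel"
      by (simp add: borel_prod)
    show "(\<integral>\<^sup>+y. \<integral>\<^sup>+x. h (c(j := a *\<^sub>R y - (- b) *\<^sub>R x, i := (- b) *\<^sub>R y + a *\<^sub>R x)) \<partial>lborel \<partial>lborel)
        = (\<integral>\<^sup>+y. \<integral>\<^sup>+x. h (c(j := y, i := x)) \<partial>lborel \<partial>lborel)"
      using nn_integral_rotation[of "\<lambda>p. h (c(j := fst p, i := snd p))" a "- b"] ab by simp
  qed
  also have "\<dots> = integral\<^sup>N (Pi\<^sub>M I (\<lambda>_. lborel)) h"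
    unfolding I_eq by (rule ins[symmetric]) (simp flip: I_eq)
  finally show ?thesis unfolding G_def .
qed

definition lincomb :: "'i set \<Rightarrow> ('i \<Rightarrow> real) \<Rightarrow> ('i \<Rightarrow> 'a::real_vector) \<Rightarrow> 'a" where
  "lincomb I u c = (\<Sum>k\<in>I. u k *\<^sub>R c k)"

definition sqnorm :: "'i set \<Rightarrow> ('i \<Rightarrow> 'a::real_normed_vector) \<Rightarrow> real" where
  "sqnorm I c = (\<Sum>k\<in>I. (norm (c k))\<^sup>2)"

lemma measurable_lincomb[measurable (raw)]:
  assumes "\<And>k. k \<in> I \<Longrightarrow> (\<lambda>x. c x k) \<in> borel_measurable M"
  shows "(\<lambda>x. lincomb I u (c x) :: 'a::euclidean_space) \<in> borel_measurable M"
  unfolding lincomb_def using assms by measurable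

lemma measurable_sqnorm[measurable (raw)]:
  assumes "\<And>k. k \<in> I \<Longrightarrow> (\<lambda>x. c x k :: 'a::euclidean_space) \<in> borel_measurable M"
  shows "(\<lambda>x. sqnorm I (c x)) \<in> borel_measurable M"
  unfolding sqnorm_def using assms by measurable

text \<open>Substituting the rotation into a linear combination acts on its weight vector by the
  inverse rotation, and the squared norm does not change. Such rotations can therefore be used to
  bring the weight vectors into a standard position.\<close>

lemma nn_integral_givens_lincomb:
  fixes h :: "'a::euclidean_space \<times> 'a \<times> real \<Rightarrow> ennreal"
  assumes I: "finite I" "i \<in> I" "j \<in> I" "i \<noteq> j"
    and [measurable]: "h \<in> borel_measurable borel" and ab: "a\<^sup>2 + b\<^sup>2 = 1"
    and u': "u' = u(i := a * u i + b * u j, j := a * u j - b * u i)"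
    and v': "v' = v(i := a * v i + b * v j, j := a * v j - b * v i)"
  shows "(\<integral>\<^sup>+c. h (lincomb I u c, lincomb I v c, sqnorm I c) \<partial>Pi\<^sub>M I (\<lambda>_. lborel))
    = (\<integral>\<^sup>+c. h (lincomb I u' c, lincomb I v' c, sqnorm I c) \<partial>Pi\<^sub>M I (\<lambda>_. lborel))"
proof -
  define G where "G c = c(j := b *\<^sub>R c i + a *\<^sub>R c j, i := a *\<^sub>R c i - b *\<^sub>R c j)" for c :: "'b \<Rightarrow> 'a"
  define K where "K = I - {i, j}"
  have K: "finite K" "i \<notin> K" "j \<notin> K" and I_eq: "I = insert i (insert j K)"
    using I by (auto simp: K_def)
  have lin: "lincomb I w (G c) = lincomb I (w(i := a * w i + b * w j, j := a * w j - b * w i)) c" for w c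
  proof -
    have "(\<Sum>k\<in>K. w k *\<^sub>R G c k) = (\<Sum>k\<in>K. w k *\<^sub>R c k)"
      "(\<Sum>k\<in>K. (w(i := a * w i + b * w j, j := a * w j - b * w i)) k *\<^sub>R c k) = (\<Sum>k\<in>K. w k *\<^sub>R c k)"
      using K by (auto simp: G_def intro!: sum.cong)
    then show ?thesis
      using K I(4) by (simp add: lincomb_def I_eq G_def algebra_simps)
  qed
  have sq: "sqnorm I (G c) = sqnorm I c" for c
  proof -
    have "(norm (a *\<^sub>R c i - b *\<^sub>R c j))\<^sup>2 + (norm (b *\<^sub>R c i + a *\<^sub>R c j))\<^sup>2
        = (a\<^sup>2 + b\<^sup>2) * ((norm (c i))\<^sup>2 + (norm (c j))\<^sup>2)"
      unfolding power2_norm_eq_inner by (simp add: algebra_simps inner_commute power2_eq_square)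
    moreover have "(\<Sum>k\<in>K. (norm (G c k))\<^sup>2) = (\<Sum>k\<in>K. (norm (c k))\<^sup>2)"
      using K by (auto simp: G_def intro!: sum.cong)
    ultimately show ?thesis
      using K I(4) ab by (simp add: sqnorm_def I_eq G_def)
  qed
  have "(\<integral>\<^sup>+c. h (lincomb I u (G c), lincomb I v (G c), sqnorm I (G c)) \<partial>Pi\<^sub>M I (\<lambda>_. lborel))
    = (\<integral>\<^sup>+c. h (lincomb I u c, lincomb I v c, sqnorm I c) \<partial>Pi\<^sub>M I (\<lambda>_. lborel))"
    unfolding G_def by (rule nn_integral_givens[OF I _ ab]) measurable
  then show ?thesis by (simp add: lin sq u' v')
qed

lemma sum_givens:
  fixes u v :: "'i \<Rightarrow> real"
  assumes I: "finite I" "i \<in> I" "j \<in> I" "i \<noteq> j" and ab: "a\<^sup>2 + b\<^sup>2 = 1"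
    and u': "u' = u(i := a * u i + b * u j, j := a * u j - b * u i)"
    and v': "v' = v(i := a * v i + b * v j, j := a * v j - b * v i)"
  shows "(\<Sum>k\<in>I. u' k * v' k) = (\<Sum>k\<in>I. u k * v k)"
proof -
  define K where "K = I - {i, j}"
  have K: "finite K" "i \<notin> K" "j \<notin> K" and I_eq: "I = insert i (insert j K)"
    using I by (auto simp: K_def)
  have "(\<Sum>k\<in>K. u' k * v' k) = (\<Sum>k\<in>K. u k * v k)"
    using K by (auto simp: u' v' intro!: sum.cong)
  moreover have "u' i * v' i + u' j * v' j = (a\<^sup>2 + b\<^sup>2) * (u i * v i + u j * v j)"
    using I(4) by (simp add: u' v' algebra_simps power2_eq_square)
  ultimately show ?thesis using K I(4) ab by (simp add: I_eq)
qed

text \<open>One rotation in the coordinates \<open>i\<close> and \<open>j\<close> for each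
  \<open>j\<close> in \<open>J\<close> moves the entry of \<open>u\<close> at \<open>j\<close> into
  the pivot \<open>i\<close>. The last two conjuncts record what happens to \<open>v\<close> and to
  the other indices, so that a second use with exchanged roles does not spoil the first. The pivot
  entry is a length, hence nonnegative, as soon as one rotation has taken place.\<close>

lemma rotate_onto_pivot:
  fixes u v :: "'i \<Rightarrow> real"
  assumes "finite J" "finite I" "i \<in> I" "J \<subseteq> I - {i}"
  shows "\<exists>u' v'. (\<forall>h \<in> borel_measurable (borel :: ('a::euclidean_space \<times> 'a \<times> real) measure).
        (\<integral>\<^sup>+c. h (lincomb I u c, lincomb I v c, sqnorm I c) \<partial>Pi\<^sub>M I (\<lambda>_. lborel))
      = (\<integral>\<^sup>+c. h (lincomb I u' c, lincomb I v' c, sqnorm I c) \<partial>Pi\<^sub>M I (\<lambda>_. lborel)))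
    \<and> (\<Sum>k\<in>I. u' k * u' k) = (\<Sum>k\<in>I. u k * u k)
    \<and> (\<Sum>k\<in>I. u' k * v' k) = (\<Sum>k\<in>I. u k * v k)
    \<and> (\<Sum>k\<in>I. v' k * v' k) = (\<Sum>k\<in>I. v k * v k)
    \<and> (\<forall>k\<in>J. u' k = 0) \<and> (J \<noteq> {} \<longrightarrow> 0 \<le> u' i)
    \<and> (\<forall>k. k \<notin> insert i J \<longrightarrow> u' k = u k \<and> v' k = v k)
    \<and> ((\<forall>k\<in>insert i J. v k = 0) \<longrightarrow> (\<forall>k\<in>insert i J. v' k = 0))"
  using assms(1,4)
proof (induction J)
  case empty
  then show ?case by (intro exI[of _ u] exI[of _ v]) simp
next
  case (insert j J)
  have "J \<subseteq> I - {i}" using insert.prems by blast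
  from insert.IH[OF this] obtain u1 v1 where 1:
    "\<forall>h \<in> borel_measurable (borel :: ('a \<times> 'a \<times> real) measure).
        (\<integral>\<^sup>+c. h (lincomb I u c, lincomb I v c, sqnorm I c) \<partial>Pi\<^sub>M I (\<lambda>_. lborel))
      = (\<integral>\<^sup>+c. h (lincomb I u1 c, lincomb I v1 c, sqnorm I c) \<partial>Pi\<^sub>M I (\<lambda>_. lborel))"
    "(\<Sum>k\<in>I. u1 k * u1 k) = (\<Sum>k\<in>I. u k * u k)" "(\<Sum>k\<in>I. u1 k * v1 k) = (\<Sum>k\<in>I. u k * v k)"
    "(\<Sum>k\<in>I. v1 k * v1 k) = (\<Sum>k\<in>I. v k * v k)" "\<forall>k\<in>J. u1 k = 0"
    "\<forall>k. k \<notin> insert i J \<longrightarrow> u1 k = u k \<and> v1 k = v k"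
    "(\<forall>k\<in>insert i J. v k = 0) \<longrightarrow> (\<forall>k\<in>insert i J. v1 k = 0)"
    by (elim exE conjE) (rule that)
  have j: "j \<in> I" "i \<noteq> j" "j \<notin> J" "i \<notin> J" using insert by auto
  \<comment> \<open>The rotation carries \<open>(u1 i, u1 j)\<close> to \<open>(r, 0)\<close>. If
    \<open>r = 0\<close> the identity is taken, so that \<open>a\<^sup>2 + b\<^sup>2 = 1\<close>
    holds in either case.\<close>
  define r where "r = sqrt ((u1 i)\<^sup>2 + (u1 j)\<^sup>2)"
  define a where "a = (if r = 0 then 1 else u1 i / r)"
  define b where "b = (if r = 0 then 0 else u1 j / r)"
  have r2: "r\<^sup>2 = (u1 i)\<^sup>2 + (u1 j)\<^sup>2" by (simp add: r_def)
  have r0: "r = 0 \<longleftrightarrow> u1 i = 0 \<and> u1 j = 0" by (simp add: r_def)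
  have "r \<ge> 0" by (simp add: r_def)
  have ab: "a\<^sup>2 + b\<^sup>2 = 1"
    using r2 by (auto simp: a_def b_def power_divide simp flip: add_divide_distrib)
  define u2 where "u2 = u1(i := a * u1 i + b * u1 j, j := a * u1 j - b * u1 i)"
  define v2 where "v2 = v1(i := a * v1 i + b * v1 j, j := a * v1 j - b * v1 i)"
  have "a * u1 i + b * u1 j = (if r = 0 then 0 else r\<^sup>2 / r)"
    using r0 unfolding r2 by (auto simp: a_def b_def power2_eq_square add_divide_distrib)
  then have "0 \<le> u2 i" using \<open>r \<ge> 0\<close> j by (simp add: u2_def)
  moreover have "u2 j = 0" using r0 by (auto simp: u2_def a_def b_def)
  moreover have "u2 k = 0" if "k \<in> J" for k
    using that 1(5) j by (auto simp: u2_def)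
  moreover have "\<forall>k. k \<notin> insert i (insert j J) \<longrightarrow> u2 k = u k \<and> v2 k = v k"
    using 1(6) by (auto simp: u2_def v2_def)
  moreover have "(\<forall>k\<in>insert i (insert j J). v k = 0) \<longrightarrow> (\<forall>k\<in>insert i (insert j J). v2 k = 0)"
    using 1(7) spec[OF 1(6), of j] j by (auto simp: v2_def)
  moreover have "\<forall>h \<in> borel_measurable (borel :: ('a \<times> 'a \<times> real) measure).
        (\<integral>\<^sup>+c. h (lincomb I u c, lincomb I v c, sqnorm I c) \<partial>Pi\<^sub>M I (\<lambda>_. lborel))
      = (\<integral>\<^sup>+c. h (lincomb I u2 c, lincomb I v2 c, sqnorm I c) \<partial>Pi\<^sub>M I (\<lambda>_. lborel))"
  proof
    fix h :: "'a \<times> 'a \<times> real \<Rightarrow> ennreal" assume h: "h \<in> borel_measurable borel"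
    show "(\<integral>\<^sup>+c. h (lincomb I u c, lincomb I v c, sqnorm I c) \<partial>Pi\<^sub>M I (\<lambda>_. lborel))
      = (\<integral>\<^sup>+c. h (lincomb I u2 c, lincomb I v2 c, sqnorm I c) \<partial>Pi\<^sub>M I (\<lambda>_. lborel))"
      using bspec[OF 1(1) h] nn_integral_givens_lincomb[OF assms(2,3) j(1,2) h ab u2_def v2_def]
      by (rule trans)
  qed
  moreover note sum_givens[OF assms(2,3) j(1,2) ab u2_def u2_def]
    sum_givens[OF assms(2,3) j(1,2) ab u2_def v2_def] sum_givens[OF assms(2,3) j(1,2) ab v2_def v2_def]
  ultimately show ?case
    using 1(2-4) by (intro exI[of _ u2] exI[of _ v2] conjI) auto
qed

lemma sum_eq_single_term:
  assumes "finite I" "i \<in> I" "\<And>k. k \<in> I \<Longrightarrow> k \<noteq> i \<Longrightarrow> f k = 0"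
  shows "sum f I = f i"
  using assms by (subst sum.remove[of I i]) auto

text \<open>A first series of rotations turns \<open>u\<close> into a multiple of the
  \<open>p\<close>-th unit vector. As \<open>u\<close> is not zero, orthogonality forces the
  \<open>p\<close>-th entry of the rotated \<open>v\<close> to vanish, and a second series that
  leaves index \<open>p\<close> alone turns \<open>v\<close> into a multiple of the
  \<open>q\<close>-th unit vector. An index outside \<open>{p, q}\<close> makes the second multiple
  nonnegative too, so both are lengths.\<close>

lemma nn_integral_orthogonal_lincombs:
  fixes h :: "'a::euclidean_space \<times> 'a \<times> real \<Rightarrow> ennreal"
  assumes I: "finite I" "p \<in> I" "q \<in> I" "p \<noteq> q" "I - {p, q} \<noteq> {}"
    and h[measurable]: "h \<in> borel_measurable borel"
    and orth: "(\<Sum>k\<in>I. u k * v k) = 0" and pos: "(\<Sum>k\<in>I. u k * u k) > 0"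
  shows "(\<integral>\<^sup>+c. h (lincomb I u c, lincomb I v c, sqnorm I c) \<partial>Pi\<^sub>M I (\<lambda>_. lborel))
    = (\<integral>\<^sup>+c. h (sqrt (\<Sum>k\<in>I. u k * u k) *\<^sub>R c p, sqrt (\<Sum>k\<in>I. v k * v k) *\<^sub>R c q, sqnorm I c)
        \<partial>Pi\<^sub>M I (\<lambda>_. lborel))"
proof -
  have "I - {p} \<subseteq> I - {p}" "finite (I - {p})" and ne: "I - {p} \<noteq> {}" using I by auto
  from rotate_onto_pivot[OF this(2) I(1,2) this(1), of u v, where 'a = 'a] obtain u1 v1 where
    eq1: "\<forall>h \<in> borel_measurable (borel :: ('a \<times> 'a \<times> real) measure).
        (\<integral>\<^sup>+c. h (lincomb I u c, lincomb I v c, sqnorm I c) \<partial>Pi\<^sub>M I (\<lambda>_. lborel))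
      = (\<integral>\<^sup>+c. h (lincomb I u1 c, lincomb I v1 c, sqnorm I c) \<partial>Pi\<^sub>M I (\<lambda>_. lborel))"
    and sums1: "(\<Sum>k\<in>I. u1 k * u1 k) = (\<Sum>k\<in>I. u k * u k)"
    "(\<Sum>k\<in>I. u1 k * v1 k) = (\<Sum>k\<in>I. u k * v k)" "(\<Sum>k\<in>I. v1 k * v1 k) = (\<Sum>k\<in>I. v k * v k)"
    and zero1: "\<forall>k\<in>I - {p}. u1 k = 0" and "I - {p} \<noteq> {} \<longrightarrow> 0 \<le> u1 p"
    by (elim exE conjE) (rule that)
  then have nonneg1: "0 \<le> u1 p" using ne by blast
  have "I - {p, q} \<subseteq> I - {q}" "finite (I - {p, q})" using I by auto
  \<comment> \<open>The roles of \<open>u\<close> and \<open>v\<close> are exchanged;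
    \<open>u1\<close> is zero at all indices other than \<open>p\<close>, where these rotations take
    place, and stays so.\<close>
  from rotate_onto_pivot[OF this(2) I(1,3) this(1), of v1 u1, where 'a = 'a] obtain v2 u2 where
    eq2: "\<forall>h \<in> borel_measurable (borel :: ('a \<times> 'a \<times> real) measure).
        (\<integral>\<^sup>+c. h (lincomb I v1 c, lincomb I u1 c, sqnorm I c) \<partial>Pi\<^sub>M I (\<lambda>_. lborel))
      = (\<integral>\<^sup>+c. h (lincomb I v2 c, lincomb I u2 c, sqnorm I c) \<partial>Pi\<^sub>M I (\<lambda>_. lborel))"
    and sums2: "(\<Sum>k\<in>I. v2 k * v2 k) = (\<Sum>k\<in>I. v1 k * v1 k)"
    and zero2: "\<forall>k\<in>I - {p, q}. v2 k = 0" and "I - {p, q} \<noteq> {} \<longrightarrow> 0 \<le> v2 q"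
    and "\<forall>k. k \<notin> insert q (I - {p, q}) \<longrightarrow> v2 k = v1 k \<and> u2 k = u1 k"
    and "(\<forall>k\<in>insert q (I - {p, q}). u1 k = 0) \<longrightarrow> (\<forall>k\<in>insert q (I - {p, q}). u2 k = 0)"
    by (elim exE conjE) (rule that)
  moreover have "insert q (I - {p, q}) = I - {p}" using I by auto
  ultimately have nonneg2: "0 \<le> v2 q" and p2: "v2 p = v1 p" "u2 p = u1 p"
    and zero2': "\<forall>k\<in>I - {p}. u2 k = 0"
    using I(5) zero1 by simp_all
  have h': "(\<lambda>(x, y, z). h (y, x, z)) \<in> borel_measurable (borel :: ('a \<times> 'a \<times> real) measure)"
    by (simp only: borel_prod[symmetric], measurable)
  have "u1 p * u1 p = (\<Sum>k\<in>I. u k * u k)"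
    using sum_eq_single_term[OF I(1,2), of "\<lambda>k. u1 k * u1 k"] sums1 zero1 by simp
  then have u1p: "u1 p = sqrt (\<Sum>k\<in>I. u k * u k)"
    using nonneg1 by (metis abs_of_nonneg real_sqrt_abs2)
  have "u1 p * v1 p = 0"
    using sum_eq_single_term[OF I(1,2), of "\<lambda>k. u1 k * v1 k"] sums1 zero1 orth by simp
  then have "v1 p = 0" using u1p pos by auto
  then have v2: "v2 k = 0" if "k \<in> I" "k \<noteq> q" for k
    using that zero2 p2 by auto
  have "v2 q * v2 q = (\<Sum>k\<in>I. v k * v k)"
    using sum_eq_single_term[OF I(1,3), of "\<lambda>k. v2 k * v2 k"] sums1 sums2 v2 by simp
  then have v2q: "v2 q = sqrt (\<Sum>k\<in>I. v k * v k)"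
    using nonneg2 by (metis abs_of_nonneg real_sqrt_abs2)
  have "lincomb I u2 c = u1 p *\<^sub>R c p" "lincomb I v2 c = v2 q *\<^sub>R c q" for c :: "'b \<Rightarrow> 'a"
    unfolding lincomb_def
    using sum_eq_single_term[OF I(1,2), of "\<lambda>k. u2 k *\<^sub>R c k"] sum_eq_single_term[OF I(1,3), of "\<lambda>k. v2 k *\<^sub>R c k"]
      p2 zero2' v2 by auto
  then show ?thesis using bspec[OF eq1 h] bspec[OF eq2 h'] by (simp flip: u1p v2q)
qed

section \<open>Volumes\<close>

lemma measure_eqI_lessThan_real:
  fixes M N :: "real measure"
  assumes "sets M = sets borel" "sets N = sets borel"
    and eq: "\<And>R. emeasure M {..<R} = emeasure N {..<R}" and fin: "\<And>R. emeasure M {..<R} \<noteq> \<infinity>"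
  shows "M = N"
proof (rule measure_eqI_generator_eq[where E = "range lessThan" and \<Omega> = UNIV and A = "\<lambda>n. {..<real n}"])
  show "Int_stable (range (lessThan :: real \<Rightarrow> _))"
  proof (rule Int_stableI)
    fix a b :: "real set" assume "a \<in> range lessThan" "b \<in> range lessThan"
    then obtain x y where "a = {..<x}" "b = {..<y}" by auto
    then have "a \<inter> b = {..<min x y}" by auto
    then show "a \<inter> b \<in> range lessThan" by blast
  qed
  show "sets M = sigma_sets UNIV (range lessThan)" "sets N = sigma_sets UNIV (range lessThan)"
    using assms(1,2) by (simp_all add: borel_Iio)
  show "(\<Union>n. {..<real n}) = UNIV"
    using reals_Archimedean2 by auto
qed (use eq fin in auto)

text \<open>The truncated power, zero for nonpositive \<open>y\<close> even when
  \<open>a = 0\<close>. Thus \<open>pos_powr 0 (R - s)\<close> is the indicator of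
  \<open>s < R\<close>, and the indicator of a ball and its iterated integrals belong to one family
  of functions.\<close>

definition pos_powr :: "real \<Rightarrow> real \<Rightarrow> real" where
  "pos_powr a y = (if 0 < y then y powr a else 0)"

lemma pos_powr_nonneg[simp]: "0 \<le> pos_powr a y"
  by (simp add: pos_powr_def)

lemma measurable_pos_powr[measurable]: "pos_powr a \<in> borel_measurable borel"
  unfolding pos_powr_def by measurable

lemma pos_powr_0: "pos_powr 0 y = indicator {0<..} y"
  by (simp add: pos_powr_def)

lemma pos_powr_mult: "pos_powr a y * pos_powr b y = pos_powr (a + b) y"
  by (simp add: pos_powr_def powr_add)

lemma nn_integral_pos_powr:
  assumes "a > -1"
  shows "(\<integral>\<^sup>+s. ennreal (pos_powr a s) * indicator {..R} s \<partial>lborel) = ennreal (pos_powr (a + 1) R / (a + 1))"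
proof (cases "0 < R")
  case True
  have "(\<integral>\<^sup>+s. ennreal (indicator {0..R} s * s powr a) \<partial>lborel) = ennreal (R powr (a + 1) / (a + 1))"
    using True assms by (intro nn_integral_has_integral_lebesgue has_integral_powr_from_0) auto
  also have "(\<integral>\<^sup>+s. ennreal (indicator {0..R} s * s powr a) \<partial>lborel)
      = (\<integral>\<^sup>+s. ennreal (pos_powr a s) * indicator {..R} s \<partial>lborel)"
    by (intro nn_integral_cong) (auto simp: pos_powr_def split: split_indicator)
  finally show ?thesis using True by (simp add: pos_powr_def)
next
  case False
  then have "(\<integral>\<^sup>+s. ennreal (pos_powr a s) * indicator {..R} s \<partial>lborel) = (\<integral>\<^sup>+s. 0 \<partial>(lborel :: real measure))"
    by (intro nn_integral_cong) (auto simp: pos_powr_def split: split_indicator)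
  then show ?thesis using False by (simp add: pos_powr_def)
qed

text \<open>The disc \<open>(norm x)\<^sup>2 < R\<close> has area \<open>pi * R\<close>, which is
  linear in \<open>R\<close>. Radial integrals over a plane coefficient thereby reduce to integrals
  of powers of one real variable.\<close>

lemma distr_norm_sq_plane:
  "distr lborel borel (\<lambda>x :: real \<times> real. (norm x)\<^sup>2) = density lborel (\<lambda>s. ennreal pi * indicator {0<..} s)"
proof (rule measure_eqI_lessThan_real)
  have e: "emeasure (distr lborel borel (\<lambda>x :: real \<times> real. (norm x)\<^sup>2)) {..<R}
      = (if 0 < R then ennreal (pi * R) else 0)" for R
  proof (cases "0 < R")
    case True
    have "(norm x)\<^sup>2 < R \<longleftrightarrow> norm x < sqrt R" for x :: "real \<times> real"
      using real_sqrt_less_iff[of "(norm x)\<^sup>2" R] by simp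
    then have "(\<lambda>x :: real \<times> real. (norm x)\<^sup>2) -` {..<R} = ball 0 (sqrt R)"
      by (intro set_eqI) (simp add: mem_ball_0)
    then show ?thesis using True
      by (subst emeasure_distr) (auto simp: emeasure_ball unit_ball_vol_2)
  next
    case False
    have "\<not> (norm x)\<^sup>2 < R" for x :: "real \<times> real"
      using False zero_le_power2[of "norm x"] by linarith
    then have "(\<lambda>x :: real \<times> real. (norm x)\<^sup>2) -` {..<R} = {}"
      by (intro set_eqI) simp
    then show ?thesis using False by (subst emeasure_distr) auto
  qed
  show "emeasure (distr lborel borel (\<lambda>x :: real \<times> real. (norm x)\<^sup>2)) {..<R} \<noteq> \<infinity>" for R
    unfolding e by simp
  show "emeasure (distr lborel borel (\<lambda>x :: real \<times> real. (norm x)\<^sup>2)) {..<R}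
      = emeasure (density lborel (\<lambda>s. ennreal pi * indicator {0<..} s)) {..<R}" for R
  proof -
    have "emeasure (density lborel (\<lambda>s. ennreal pi * indicator {0<..} s)) {..<R}
        = (\<integral>\<^sup>+s. ennreal pi * indicator {0<..<R} s \<partial>lborel)"
      by (subst emeasure_density) (auto intro!: nn_integral_cong split: split_indicator)
    also have "\<dots> = (if 0 < R then ennreal (pi * R) else 0)"
      by (subst nn_integral_cmult_indicator) (auto simp: ennreal_mult')
    finally show ?thesis by (simp add: e)
  qed
qed auto

lemma nn_integral_radial_plane:
  assumes [measurable]: "h \<in> borel_measurable borel"
  shows "(\<integral>\<^sup>+x. h ((norm (x :: real \<times> real))\<^sup>2) \<partial>lborel) = ennreal pi * (\<integral>\<^sup>+s. h s * indicator {0<..} s \<partial>lborel)"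
proof -
  have "(\<integral>\<^sup>+x. h ((norm (x :: real \<times> real))\<^sup>2) \<partial>lborel)
      = integral\<^sup>N (distr lborel borel (\<lambda>x :: real \<times> real. (norm x)\<^sup>2)) h"
    by (subst nn_integral_distr) auto
  also have "\<dots> = ennreal pi * (\<integral>\<^sup>+s. h s * indicator {0<..} s \<partial>lborel)"
    unfolding distr_norm_sq_plane
    by (subst nn_integral_density, measurable, subst nn_integral_cmult[symmetric]) (auto simp: mult_ac)
  finally show ?thesis .
qed

lemma nn_integral_pos_powr_plane:
  assumes "a \<ge> 0"
  shows "(\<integral>\<^sup>+x. ennreal (pos_powr a (R - (norm (x :: real \<times> real))\<^sup>2)) \<partial>lborel)
    = ennreal (pi / (a + 1) * pos_powr (a + 1) R)"
proof -
  have "(\<integral>\<^sup>+x. ennreal (pos_powr a (R - (norm (x :: real \<times> real))\<^sup>2)) \<partial>lborel)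
      = ennreal pi * (\<integral>\<^sup>+s. ennreal (pos_powr a (R - s)) * indicator {0<..} s \<partial>lborel)"
    by (rule nn_integral_radial_plane[where h = "\<lambda>s. ennreal (pos_powr a (R - s))"]) measurable
  also have "(\<integral>\<^sup>+s. ennreal (pos_powr a (R - s)) * indicator {0<..} s \<partial>lborel)
      = (\<integral>\<^sup>+s. ennreal (pos_powr a s) * indicator {0<..} (R - s) \<partial>lborel)"
    by (subst nn_integral_real_affine[where c = "-1" and t = R]) auto
  also have "\<dots> = (\<integral>\<^sup>+s. ennreal (pos_powr a s) * indicator {..R} s \<partial>lborel)"
  proof (rule nn_integral_cong_AE)
    have "AE s in lborel. s \<noteq> R" by (rule AE_lborel_singleton)
    then show "AE s in lborel. ennreal (pos_powr a s) * indicator {0<..} (R - s)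
        = ennreal (pos_powr a s) * indicator {..R} s"
      by eventually_elim (auto split: split_indicator)
  qed
  also have "\<dots> = ennreal (pos_powr (a + 1) R / (a + 1))"
    using assms by (intro nn_integral_pos_powr) auto
  finally show ?thesis using assms by (simp add: ennreal_mult'[symmetric])
qed

lemma sqnorm_insert_upd:
  "finite I \<Longrightarrow> i \<notin> I \<Longrightarrow> sqnorm (insert i I) (c(i := x)) = (norm x)\<^sup>2 + sqnorm I c"
  by (auto simp: sqnorm_def intro!: sum.cong)

text \<open>Each coefficient integrated out contributes \<open>pi\<close>, raises the exponent by
  one and divides by the new exponent, whence the Pochhammer symbol. The case \<open>a = 0\<close>
  is the volume of a ball in \<open>2 * card I\<close> dimensions; \<open>a = 3 / 2\<close> occurs
  once a tangent coordinate has been integrated.\<close>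

lemma nn_integral_pos_powr_sqnorm:
  fixes I :: "'i set"
  assumes "finite I" "a \<ge> 0"
  shows "(\<integral>\<^sup>+c. ennreal (pos_powr a (R - sqnorm I c)) \<partial>Pi\<^sub>M I (\<lambda>_. lborel :: (real \<times> real) measure))
    = ennreal (pi ^ card I / pochhammer (a + 1) (card I) * pos_powr (a + card I) R)"
  using assms
proof (induction I arbitrary: a rule: finite_induct)
  case empty
  then show ?case by (simp add: sqnorm_def PiM_empty nn_integral_count_space_finite)
next
  case (insert i I)
  interpret product_sigma_finite "\<lambda>_::'i. lborel :: (real \<times> real) measure" by unfold_locales
  have "(\<integral>\<^sup>+c. ennreal (pos_powr a (R - sqnorm (insert i I) c)) \<partial>Pi\<^sub>M (insert i I) (\<lambda>_. lborel :: (real \<times> real) measure))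
      = (\<integral>\<^sup>+c. \<integral>\<^sup>+x. ennreal (pos_powr a (R - sqnorm (insert i I) (c(i := x)))) \<partial>lborel \<partial>Pi\<^sub>M I (\<lambda>_. lborel :: (real \<times> real) measure))"
    using insert.hyps by (intro product_nn_integral_insert) auto
  also have "\<dots> = (\<integral>\<^sup>+c. \<integral>\<^sup>+x. ennreal (pos_powr a ((R - sqnorm I c) - (norm (x :: real \<times> real))\<^sup>2)) \<partial>lborel
      \<partial>Pi\<^sub>M I (\<lambda>_. lborel :: (real \<times> real) measure))"
    using insert.hyps by (simp add: sqnorm_insert_upd algebra_simps)
  also have "\<dots> = (\<integral>\<^sup>+c. ennreal (pi / (a + 1)) * ennreal (pos_powr (a + 1) (R - sqnorm I c))
      \<partial>Pi\<^sub>M I (\<lambda>_. lborel :: (real \<times> real) measure))"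
    using insert.prems
    by (simp only: nn_integral_pos_powr_plane) (intro nn_integral_cong ennreal_mult; simp)
  also have "\<dots> = ennreal (pi / (a + 1)) * (\<integral>\<^sup>+c. ennreal (pos_powr (a + 1) (R - sqnorm I c))
      \<partial>Pi\<^sub>M I (\<lambda>_. lborel :: (real \<times> real) measure))"
    by (rule nn_integral_cmult) measurable
  also have "\<dots> = ennreal (pi ^ card (insert i I) / pochhammer (a + 1) (card (insert i I))
      * pos_powr (a + card (insert i I)) R)"
    using insert.hyps insert.prems
    by (subst insert.IH) (auto simp: pochhammer_rec pochhammer_nonneg algebra_simps simp flip: ennreal_mult)
  finally show ?case .
qed

section \<open>Integrals weighted by the area or the length of tangent vectors\<close>

definition cross2 :: "real \<times> real \<Rightarrow> real \<times> real \<Rightarrow> real" where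
  "cross2 x z = fst x * snd z - snd x * fst z"

lemma measurable_cross2[measurable (raw)]:
  assumes "f \<in> borel_measurable M" "g \<in> borel_measurable M"
  shows "(\<lambda>x. cross2 (f x) (g x)) \<in> borel_measurable M"
proof -
  have [measurable]: "(\<lambda>x. fst (f x)) \<in> borel_measurable M" "(\<lambda>x. snd (f x)) \<in> borel_measurable M"
    "(\<lambda>x. fst (g x)) \<in> borel_measurable M" "(\<lambda>x. snd (g x)) \<in> borel_measurable M"
    using assms by (auto simp: borel_prod[symmetric])
  show ?thesis unfolding cross2_def by measurable
qed

lemma nn_integral_abs_less:
  "(\<integral>\<^sup>+y. ennreal \<bar>y\<bar> * ennreal (pos_powr 0 (T - y\<^sup>2)) \<partial>lborel) = ennreal (pos_powr 1 T)"
proof (cases "0 < T")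
  case True
  define m where "m = sqrt T"
  have m: "m > 0" "m\<^sup>2 = T" using True by (auto simp: m_def)
  have "((\<lambda>y. - y) has_integral (- ((0\<^sup>2 - (- m)\<^sup>2) / 2))) {- m..0}"
    using m by (intro has_integral_neg ident_has_integral) auto
  then have a: "((\<lambda>y. \<bar>y\<bar>) has_integral (m\<^sup>2 / 2)) {- m..0}"
    by (subst has_integral_cong[where g = "\<lambda>y. - y"]) auto
  have "((\<lambda>y. y) has_integral ((m\<^sup>2 - 0\<^sup>2) / 2)) {0..m}"
    using m by (intro ident_has_integral) auto
  then have b: "((\<lambda>y. \<bar>y\<bar>) has_integral (m\<^sup>2 / 2)) {0..m}"
    by (subst has_integral_cong[where g = "\<lambda>y. y"]) auto
  have "((\<lambda>y. \<bar>y\<bar>) has_integral (m\<^sup>2 / 2 + m\<^sup>2 / 2)) {- m..m}"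
    using m by (intro has_integral_combine[OF _ _ a b]) auto
  then have "(\<integral>\<^sup>+y. ennreal (indicator {- m..m} y * \<bar>y\<bar>) \<partial>lborel) = ennreal (m\<^sup>2 / 2 + m\<^sup>2 / 2)"
    by (intro nn_integral_has_integral_lebesgue) auto
  moreover have "(\<integral>\<^sup>+y. ennreal \<bar>y\<bar> * ennreal (pos_powr 0 (T - y\<^sup>2)) \<partial>lborel)
      = (\<integral>\<^sup>+y. ennreal (indicator {- m..m} y * \<bar>y\<bar>) \<partial>lborel)"
  proof (rule nn_integral_cong_AE)
    have "AE y in lborel. y \<noteq> m" "AE y in lborel. y \<noteq> - m" by (rule AE_lborel_singleton)+
    then show "AE y in lborel. ennreal \<bar>y\<bar> * ennreal (pos_powr 0 (T - y\<^sup>2)) = ennreal (indicator {- m..m} y * \<bar>y\<bar>)"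
    proof eventually_elim
      case (elim y)
      have "y\<^sup>2 < T \<longleftrightarrow> \<bar>y\<bar> < m"
        using m abs_square_less_1 power2_less_imp_less[of "\<bar>y\<bar>" m] power_strict_mono[of "\<bar>y\<bar>" m 2] by auto
      moreover have "y \<in> {- m..m} \<longleftrightarrow> \<bar>y\<bar> < m" using elim by auto
      ultimately show ?case by (simp add: pos_powr_0 indicator_def)
    qed
  qed
  ultimately show ?thesis using m True by (simp add: pos_powr_def)
next
  case False
  then have "\<not> 0 < T - y\<^sup>2" for y by (metis diff_gt_0_iff_gt le_less_trans zero_le_power2)
  then show ?thesis using False by (simp add: pos_powr_def)
qed

lemma nn_integral_pos_powr_1_line:
  "(\<integral>\<^sup>+x. ennreal (pos_powr 1 (R - x\<^sup>2)) \<partial>lborel) = ennreal (4 / 3 * pos_powr (3 / 2) R)"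
proof (cases "0 < R")
  case True
  define m where "m = sqrt R"
  have m: "m > 0" "m\<^sup>2 = R" using True by (auto simp: m_def)
  have "((\<lambda>x. m\<^sup>2 - x\<^sup>2) has_integral ((m\<^sup>2 * m - m ^ 3 / 3) - (m\<^sup>2 * (- m) - (- m) ^ 3 / 3))) {- m..m}"
    using m by (intro fundamental_theorem_of_calculus)
      (auto intro!: derivative_eq_intros simp flip: has_real_derivative_iff_has_vector_derivative)
  then have "(\<integral>\<^sup>+x. ennreal (indicator {- m..m} x * (m\<^sup>2 - x\<^sup>2)) \<partial>lborel)
      = ennreal ((m\<^sup>2 * m - m ^ 3 / 3) - (m\<^sup>2 * (- m) - (- m) ^ 3 / 3))"
    by (intro nn_integral_has_integral_lebesgue) (auto simp: abs_le_square_iff[symmetric])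
  moreover have "(m\<^sup>2 * m - m ^ 3 / 3) - (m\<^sup>2 * (- m) - (- m) ^ 3 / 3) = 4 / 3 * m ^ 3"
    by (simp add: power2_eq_square power3_eq_cube)
  moreover have "m ^ 3 = R powr (3 / 2)"
  proof -
    have "m ^ 3 = m powr 3" using m by simp
    also have "\<dots> = R powr (3 / 2)" using True by (simp add: m_def powr_half_sqrt[symmetric] powr_powr)
    finally show ?thesis .
  qed
  moreover have "(\<integral>\<^sup>+x. ennreal (pos_powr 1 (R - x\<^sup>2)) \<partial>lborel)
      = (\<integral>\<^sup>+x. ennreal (indicator {- m..m} x * (m\<^sup>2 - x\<^sup>2)) \<partial>lborel)"
  proof (intro nn_integral_cong arg_cong[where f = ennreal])
    fix x
    have "x \<in> {- m..m} \<longleftrightarrow> \<bar>x\<bar> \<le> \<bar>m\<bar>" using m by auto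
    then have "x \<in> {- m..m} \<longleftrightarrow> x\<^sup>2 \<le> m\<^sup>2" by (simp only: abs_le_square_iff)
    then show "pos_powr 1 (R - x\<^sup>2) = indicator {- m..m} x * (m\<^sup>2 - x\<^sup>2)"
      using m by (auto simp: pos_powr_def indicator_def)
  qed
  ultimately show ?thesis using True by (simp add: pos_powr_def)
next
  case False
  then have "\<not> 0 < R - y\<^sup>2" for y by (metis diff_gt_0_iff_gt le_less_trans zero_le_power2)
  then show ?thesis using False by (simp add: pos_powr_def)
qed

text \<open>After a rotation that makes the second coordinate perpendicular to \<open>z\<close>, the
  weight is \<open>norm z\<close> times the absolute value of that coordinate. The result depends on
  \<open>z\<close> only through its length, so the other tangent can then be integrated by
  \<open>nn_integral_norm_plane\<close>.\<close>

lemma nn_integral_cross2_plane: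
  "(\<integral>\<^sup>+x. ennreal \<bar>cross2 x z\<bar> * ennreal (pos_powr 0 (R - (norm x)\<^sup>2)) \<partial>lborel)
    = ennreal (4 / 3 * norm z * pos_powr (3 / 2) R)"
proof (cases "z = 0")
  case True
  then show ?thesis by (simp add: cross2_def)
next
  case False
  obtain z1 z2 where z: "z = (z1, z2)" by fastforce
  define r where "r = norm z"
  have r: "r > 0" "r\<^sup>2 = z1\<^sup>2 + z2\<^sup>2" using False by (auto simp: r_def z norm_Pair zero_prod_def sum_power2_gt_zero_iff)
  \<comment> \<open>Chosen so that \<open>r * (b * x + a * y)\<close> is the cross product of
    \<open>(x, y)\<close> with \<open>z\<close>: the second rotated coordinate is the signed
    distance from the line spanned by \<open>z\<close>.\<close>
  define a b where "a = - z1 / r" and "b = z2 / r"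
  have "a\<^sup>2 + b\<^sup>2 = r\<^sup>2 / r\<^sup>2" 
    by (simp only: a_def b_def power_divide power2_minus add_divide_distrib[symmetric] r(2)[symmetric])
  then have ab: "a\<^sup>2 + b\<^sup>2 = 1" using r(1) by simp
  define h where "h p = ennreal (r * \<bar>snd p\<bar>) * ennreal (pos_powr 0 (R - ((fst p)\<^sup>2 + (snd p)\<^sup>2)))" for p :: "real \<times> real"
  have hm[measurable]: "h \<in> borel_measurable borel"
    unfolding h_def by (subst borel_prod[symmetric]) measurable
  have rot: "(a * x - b * y)\<^sup>2 + (b * x + a * y)\<^sup>2 = x\<^sup>2 + y\<^sup>2" for x y
  proof -
    have "(a * x - b * y)\<^sup>2 + (b * x + a * y)\<^sup>2 = (a\<^sup>2 + b\<^sup>2) * (x\<^sup>2 + y\<^sup>2)"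
      by (simp add: power2_eq_square algebra_simps)
    then show ?thesis by (simp add: ab)
  qed
  have det: "r * \<bar>b * x + a * y\<bar> = \<bar>x * z2 - y * z1\<bar>" for x y
  proof -
    have "r * \<bar>b * x + a * y\<bar> = \<bar>r * (b * x + a * y)\<bar>" using r(1) by (simp add: abs_mult)
    also have "r * (b * x + a * y) = x * z2 - y * z1"
      using r(1) by (simp add: a_def b_def field_simps)
    finally show ?thesis .
  qed
  have "(\<integral>\<^sup>+x. ennreal \<bar>cross2 x z\<bar> * ennreal (pos_powr 0 (R - (norm x)\<^sup>2)) \<partial>lborel)
      = (\<integral>\<^sup>+p. ennreal \<bar>cross2 p z\<bar> * ennreal (pos_powr 0 (R - (norm p)\<^sup>2)) \<partial>(lborel \<Otimes>\<^sub>M lborel))"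
    by (simp add: lborel_prod)
  also have "\<dots> = (\<integral>\<^sup>+x. \<integral>\<^sup>+y. ennreal \<bar>cross2 (x, y) z\<bar> * ennreal (pos_powr 0 (R - (norm (x, y))\<^sup>2)) \<partial>lborel \<partial>lborel)"
    by (rule lborel.nn_integral_fst[symmetric], subst lborel_prod, measurable)
  also have "\<dots> = (\<integral>\<^sup>+x. \<integral>\<^sup>+y. h (a *\<^sub>R x - b *\<^sub>R y, b *\<^sub>R x + a *\<^sub>R y) \<partial>lborel \<partial>lborel)"
    by (simp add: h_def rot det cross2_def z norm_Pair)
  also have "\<dots> = (\<integral>\<^sup>+x. \<integral>\<^sup>+y. h (x, y) \<partial>lborel \<partial>lborel)"
    by (rule nn_integral_rotation[OF hm ab])
  also have "\<dots> = (\<integral>\<^sup>+x. \<integral>\<^sup>+y. ennreal r * (ennreal \<bar>y\<bar> * ennreal (pos_powr 0 ((R - x\<^sup>2) - y\<^sup>2))) \<partial>lborel \<partial>lborel)"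
    using r(1) by (simp add: h_def ennreal_mult mult.assoc diff_diff_eq)
  also have "\<dots> = (\<integral>\<^sup>+x. ennreal r * ennreal (pos_powr 1 (R - x\<^sup>2)) \<partial>lborel)"
    by (subst nn_integral_cmult) (simp_all add: nn_integral_abs_less)
  also have "\<dots> = ennreal r * ennreal (4 / 3 * pos_powr (3 / 2) R)"
    by (subst nn_integral_cmult) (simp_all add: nn_integral_pos_powr_1_line)
  also have "\<dots> = ennreal (4 / 3 * norm z * pos_powr (3 / 2) R)"
    using r(1) by (simp add: r_def mult_ac flip: ennreal_mult)
  finally show ?thesis .
qed

lemma nn_integral_norm_plane:
  "(\<integral>\<^sup>+x. ennreal (norm (x :: real \<times> real)) * ennreal (pos_powr 0 (R - (norm x)\<^sup>2)) \<partial>lborel)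
    = ennreal (2 * pi / 3 * pos_powr (3 / 2) R)"
proof -
  let ?h = "\<lambda>s. ennreal (sqrt s) * ennreal (pos_powr 0 (R - s))"
  have "(\<integral>\<^sup>+x. ennreal (norm (x :: real \<times> real)) * ennreal (pos_powr 0 (R - (norm x)\<^sup>2)) \<partial>lborel)
      = (\<integral>\<^sup>+x. ?h ((norm (x :: real \<times> real))\<^sup>2) \<partial>lborel)"
    by simp
  also have "\<dots> = ennreal pi * (\<integral>\<^sup>+s. ?h s * indicator {0<..} s \<partial>lborel)"
    by (rule nn_integral_radial_plane) measurable
  also have "(\<integral>\<^sup>+s. ?h s * indicator {0<..} s \<partial>lborel) = (\<integral>\<^sup>+s. ennreal (pos_powr (1 / 2) s) * indicator {..R} s \<partial>lborel)"
  proof (rule nn_integral_cong_AE)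
    have "AE s in lborel. s \<noteq> R" by (rule AE_lborel_singleton)
    then show "AE s in lborel. ?h s * indicator {0<..} s = ennreal (pos_powr (1 / 2) s) * indicator {..R} s"
      by eventually_elim (auto simp: pos_powr_def powr_half_sqrt split: split_indicator)
  qed
  also have "\<dots> = ennreal (pos_powr (1 / 2 + 1) R / (1 / 2 + 1))"
    by (rule nn_integral_pos_powr) simp
  finally show ?thesis by (simp flip: ennreal_mult)
qed

text \<open>For \<open>w = norm\<close> and for \<open>w = \<lambda>x. \<bar>cross2 x z\<bar>\<close> the hypothesis is provided by the
  two preceding lemmas.\<close>

lemma nn_integral_weight_sqnorm:
  fixes w :: "real \<times> real \<Rightarrow> real" and K :: "'i set"
  assumes K: "finite K" "q \<notin> K" and [measurable]: "w \<in> borel_measurable borel" and "0 \<le> C"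
    and w: "\<And>R. (\<integral>\<^sup>+x. ennreal (w x) * ennreal (pos_powr 0 (R - (norm x)\<^sup>2)) \<partial>lborel) = ennreal (C * pos_powr (3 / 2) R)"
  shows "(\<integral>\<^sup>+c. ennreal (w (c q)) * ennreal (pos_powr 0 (R - sqnorm (insert q K) c)) \<partial>Pi\<^sub>M (insert q K) (\<lambda>_. lborel :: (real \<times> real) measure))
    = ennreal (C * (pi ^ card K / pochhammer (5 / 2) (card K)) * pos_powr (3 / 2 + card K) R)"
proof -
  interpret product_sigma_finite "\<lambda>_::'i. lborel :: (real \<times> real) measure" by unfold_locales
  have "(\<integral>\<^sup>+c. ennreal (w (c q)) * ennreal (pos_powr 0 (R - sqnorm (insert q K) c)) \<partial>Pi\<^sub>M (insert q K) (\<lambda>_. lborel))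
      = (\<integral>\<^sup>+c. \<integral>\<^sup>+x. ennreal (w ((c(q := x)) q)) * ennreal (pos_powr 0 (R - sqnorm (insert q K) (c(q := x)))) \<partial>lborel
          \<partial>Pi\<^sub>M K (\<lambda>_. lborel :: (real \<times> real) measure))"
    using K by (intro product_nn_integral_insert) auto
  also have "\<dots> = (\<integral>\<^sup>+c. \<integral>\<^sup>+x. ennreal (w x) * ennreal (pos_powr 0 ((R - sqnorm K c) - (norm x)\<^sup>2)) \<partial>lborel
          \<partial>Pi\<^sub>M K (\<lambda>_. lborel :: (real \<times> real) measure))"
    using K by (simp add: sqnorm_insert_upd algebra_simps)
  also have "\<dots> = (\<integral>\<^sup>+c. ennreal C * ennreal (pos_powr (3 / 2) (R - sqnorm K c)) \<partial>Pi\<^sub>M K (\<lambda>_. lborel :: (real \<times> real) measure))"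
    unfolding w using \<open>0 \<le> C\<close> by (simp add: ennreal_mult)
  also have "\<dots> = ennreal C * (\<integral>\<^sup>+c. ennreal (pos_powr (3 / 2) (R - sqnorm K c)) \<partial>Pi\<^sub>M K (\<lambda>_. lborel :: (real \<times> real) measure))"
    by (rule nn_integral_cmult) measurable
  also have "\<dots> = ennreal (C * (pi ^ card K / pochhammer (5 / 2) (card K)) * pos_powr (3 / 2 + card K) R)"
    using K(1) \<open>0 \<le> C\<close>
    by (subst nn_integral_pos_powr_sqnorm) (auto simp: pochhammer_nonneg mult.assoc simp flip: ennreal_mult)
  finally show ?thesis .
qed

lemma sigma_finite_PiM_lborel:
  "finite I \<Longrightarrow> sigma_finite_measure (Pi\<^sub>M I (\<lambda>_. lborel :: 'a::euclidean_space measure))"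
proof -
  interpret product_sigma_finite "\<lambda>_. lborel :: 'a measure" by unfold_locales
  show "finite I \<Longrightarrow> ?thesis" by (rule sigma_finite)
qed

text \<open>For a fixed value \<open>x\<close> of the shared coordinate \<open>c p\<close>, both
  constraints become balls of squared radius \<open>R - (norm x)\<^sup>2\<close>. The tangent
  coordinate of \<open>c\<close> then gives \<open>4 / 3\<close> times the length of that of
  \<open>d\<close>, which in turn gives \<open>2 * pi / 3\<close>; the free coefficients of each
  curve give \<open>C\<close>. The remaining integral over \<open>x\<close> is again of truncated
  power type.\<close>

lemma nn_integral_common_coordinate_ball:
  fixes K :: "'i set"
  assumes K: "finite K" "q \<notin> K" "p \<notin> insert q K"
  defines "C \<equiv> pi ^ card K / pochhammer (5 / 2) (card K)"
  shows "(\<integral>\<^sup>+d. \<integral>\<^sup>+c. ennreal \<bar>cross2 (c q) (d q)\<bar> * (ennreal (pos_powr 0 (R - sqnorm (insert p (insert q K)) c))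
        * ennreal (pos_powr 0 (R - ((norm (c p))\<^sup>2 + sqnorm (insert q K) d))))
      \<partial>Pi\<^sub>M (insert p (insert q K)) (\<lambda>_. lborel) \<partial>Pi\<^sub>M (insert q K) (\<lambda>_. lborel))
    = ennreal (8 * pi\<^sup>2 / 9 * C\<^sup>2 / (2 * card K + 4) * pos_powr (2 * card K + 4) R)"
proof -
  interpret product_sigma_finite "\<lambda>_::'i. lborel :: (real \<times> real) measure" by unfold_locales
  let ?V = "lborel :: (real \<times> real) measure"
  let ?I' = "insert q K"
  let ?PI' = "Pi\<^sub>M ?I' (\<lambda>_. ?V)"
  interpret I': sigma_finite_measure ?PI' using K by (intro sigma_finite_PiM_lborel) auto
  interpret P: pair_sigma_finite ?V ?PI' ..
  \<comment> \<open>The tangent coordinate contributes \<open>3 / 2\<close> and each free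
    coefficient 1. Integrating \<open>x\<close> raises the doubled exponent to
    \<open>\<beta> + \<beta> + 1 = 2 * card K + 4\<close>.\<close>
  define \<beta> where "\<beta> = 3 / 2 + real (card K)"
  have C: "C \<ge> 0" by (simp add: C_def pochhammer_nonneg)
  have inner: "(\<integral>\<^sup>+c. ennreal \<bar>cross2 (c q) z\<bar> * ennreal (pos_powr 0 (T - sqnorm ?I' c)) \<partial>?PI')
      = ennreal (4 / 3 * C) * ennreal (pos_powr \<beta> T) * ennreal (norm z)" for z T
  proof -
    have "(\<integral>\<^sup>+c. ennreal \<bar>cross2 (c q) z\<bar> * ennreal (pos_powr 0 (T - sqnorm ?I' c)) \<partial>?PI')
      = ennreal (4 / 3 * norm z * C * pos_powr \<beta> T)"
      unfolding C_def \<beta>_def using K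
      by (intro nn_integral_weight_sqnorm[where w = "\<lambda>x. \<bar>cross2 x z\<bar>"]) (auto simp: nn_integral_cross2_plane)
    also have "\<dots> = ennreal (4 / 3 * C * pos_powr \<beta> T * norm z)" by (simp add: mult_ac)
    also have "\<dots> = ennreal (4 / 3 * C) * ennreal (pos_powr \<beta> T) * ennreal (norm z)"
      using C by (subst ennreal_mult, simp, simp, subst ennreal_mult) auto
    finally show ?thesis .
  qed
  have inner2: "(\<integral>\<^sup>+d. ennreal (norm (d q)) * ennreal (pos_powr 0 (T - sqnorm ?I' d)) \<partial>?PI')
      = ennreal (2 * pi / 3 * C) * ennreal (pos_powr \<beta> T)" for T
  proof -
    have "(\<integral>\<^sup>+d. ennreal (norm (d q)) * ennreal (pos_powr 0 (T - sqnorm ?I' d)) \<partial>?PI')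
      = ennreal (2 * pi / 3 * C * pos_powr \<beta> T)"
      unfolding C_def \<beta>_def using K
      by (intro nn_integral_weight_sqnorm) (auto simp: nn_integral_norm_plane)
    then show ?thesis using C by (subst (asm) ennreal_mult) auto
  qed
  have step: "(\<integral>\<^sup>+c. ennreal \<bar>cross2 (c q) (d q)\<bar> * (ennreal (pos_powr 0 (R - sqnorm (insert p ?I') c))
        * ennreal (pos_powr 0 (R - ((norm (c p))\<^sup>2 + sqnorm ?I' d)))) \<partial>Pi\<^sub>M (insert p ?I') (\<lambda>_. ?V))
      = (\<integral>\<^sup>+x. ennreal (4 / 3 * C) * ennreal (pos_powr \<beta> (R - (norm x)\<^sup>2)) *
          (ennreal (norm (d q)) * ennreal (pos_powr 0 ((R - (norm x)\<^sup>2) - sqnorm ?I' d))) \<partial>?V)"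
    for d :: "'i \<Rightarrow> real \<times> real"
  proof -
    have "(\<integral>\<^sup>+c. ennreal \<bar>cross2 (c q) (d q)\<bar> * (ennreal (pos_powr 0 (R - sqnorm (insert p ?I') c))
        * ennreal (pos_powr 0 (R - ((norm (c p))\<^sup>2 + sqnorm ?I' d)))) \<partial>Pi\<^sub>M (insert p ?I') (\<lambda>_. ?V))
      = (\<integral>\<^sup>+x. \<integral>\<^sup>+c. ennreal \<bar>cross2 ((c(p := x)) q) (d q)\<bar> * (ennreal (pos_powr 0 (R - sqnorm (insert p ?I') (c(p := x))))
        * ennreal (pos_powr 0 (R - ((norm ((c(p := x)) p))\<^sup>2 + sqnorm ?I' d)))) \<partial>?PI' \<partial>?V)"
      using K by (intro product_nn_integral_insert_rev) auto
    also have "\<dots> = (\<integral>\<^sup>+x. \<integral>\<^sup>+c. ennreal \<bar>cross2 (c q) (d q)\<bar> * ennreal (pos_powr 0 ((R - (norm x)\<^sup>2) - sqnorm ?I' c))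
        * ennreal (pos_powr 0 ((R - (norm x)\<^sup>2) - sqnorm ?I' d)) \<partial>?PI' \<partial>?V)"
      using K by (auto simp: sqnorm_insert_upd diff_diff_eq mult_ac)
    also have "\<dots> = (\<integral>\<^sup>+x. (\<integral>\<^sup>+c. ennreal \<bar>cross2 (c q) (d q)\<bar> * ennreal (pos_powr 0 ((R - (norm x)\<^sup>2) - sqnorm ?I' c)) \<partial>?PI')
        * ennreal (pos_powr 0 ((R - (norm x)\<^sup>2) - sqnorm ?I' d)) \<partial>?V)"
      by (intro nn_integral_cong nn_integral_multc) measurable
    finally show ?thesis unfolding inner by (simp add: mult_ac)
  qed
  have "(\<integral>\<^sup>+d. \<integral>\<^sup>+c. ennreal \<bar>cross2 (c q) (d q)\<bar> * (ennreal (pos_powr 0 (R - sqnorm (insert p ?I') c))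
        * ennreal (pos_powr 0 (R - ((norm (c p))\<^sup>2 + sqnorm ?I' d)))) \<partial>Pi\<^sub>M (insert p ?I') (\<lambda>_. ?V) \<partial>?PI')
      = (\<integral>\<^sup>+x. \<integral>\<^sup>+d. ennreal (4 / 3 * C) * ennreal (pos_powr \<beta> (R - (norm x)\<^sup>2)) *
          (ennreal (norm (d q)) * ennreal (pos_powr 0 ((R - (norm x)\<^sup>2) - sqnorm ?I' d))) \<partial>?PI' \<partial>?V)"
    unfolding step by (rule P.Fubini') measurable
  also have "\<dots> = (\<integral>\<^sup>+x. ennreal (4 / 3 * C) * ennreal (pos_powr \<beta> (R - (norm x)\<^sup>2)) *
      (ennreal (2 * pi / 3 * C) * ennreal (pos_powr \<beta> (R - (norm x)\<^sup>2))) \<partial>?V)"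
    by (subst nn_integral_cmult) (simp_all add: inner2)
  also have "\<dots> = (\<integral>\<^sup>+x. ennreal (8 * pi / 9 * C\<^sup>2) * ennreal (pos_powr (\<beta> + \<beta>) (R - (norm x)\<^sup>2)) \<partial>?V)"
  proof (rule nn_integral_cong)
    fix x :: "real \<times> real"
    define y where "y = R - (norm x)\<^sup>2"
    have "4 / 3 * C * pos_powr \<beta> y * (2 * pi / 3 * C * pos_powr \<beta> y) = 8 * pi / 9 * C\<^sup>2 * pos_powr (\<beta> + \<beta>) y"
      unfolding pos_powr_mult[symmetric] by (simp add: power2_eq_square)
    then show "ennreal (4 / 3 * C) * ennreal (pos_powr \<beta> (R - (norm x)\<^sup>2)) *
        (ennreal (2 * pi / 3 * C) * ennreal (pos_powr \<beta> (R - (norm x)\<^sup>2)))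
      = ennreal (8 * pi / 9 * C\<^sup>2) * ennreal (pos_powr (\<beta> + \<beta>) (R - (norm x)\<^sup>2))"
      unfolding y_def[symmetric] using C by (simp flip: ennreal_mult)
  qed
  also have "\<dots> = ennreal (8 * pi / 9 * C\<^sup>2) * ennreal (pi / (\<beta> + \<beta> + 1) * pos_powr (\<beta> + \<beta> + 1) R)"
    by (subst nn_integral_cmult) (auto simp: nn_integral_pos_powr_plane \<beta>_def)
  also have "\<dots> = ennreal (8 * pi\<^sup>2 / 9 * C\<^sup>2 / (2 * card K + 4) * pos_powr (2 * card K + 4) R)"
  proof -
    have "\<beta> + \<beta> + 1 = 2 * card K + 4" by (simp add: \<beta>_def)
    then show ?thesis by (simp add: power2_eq_square flip: ennreal_mult) (simp add: mult_ac add.commute)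
  qed
  finally show ?thesis .
qed

lemma nn_integral_two_balls:
  assumes "finite I"
  shows "(\<integral>\<^sup>+d. \<integral>\<^sup>+c. ennreal (pos_powr 0 (R - sqnorm I c)) * ennreal (pos_powr 0 (R - sqnorm I d))
      \<partial>Pi\<^sub>M I (\<lambda>_. lborel :: (real \<times> real) measure) \<partial>Pi\<^sub>M I (\<lambda>_. lborel :: (real \<times> real) measure))
    = ennreal ((pi ^ card I / fact (card I))\<^sup>2 * pos_powr (2 * card I) R)"
proof -
  let ?M = "Pi\<^sub>M I (\<lambda>_. lborel :: (real \<times> real) measure)"
  let ?v = "ennreal (pi ^ card I / fact (card I) * pos_powr (card I) R)"
  have v: "(\<integral>\<^sup>+c. ennreal (pos_powr 0 (R - sqnorm I c)) \<partial>?M) = ?v"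
    using assms by (subst nn_integral_pos_powr_sqnorm) (auto simp: pochhammer_fact)
  have "(\<integral>\<^sup>+d. \<integral>\<^sup>+c. ennreal (pos_powr 0 (R - sqnorm I c)) * ennreal (pos_powr 0 (R - sqnorm I d)) \<partial>?M \<partial>?M)
      = (\<integral>\<^sup>+d. ?v * ennreal (pos_powr 0 (R - sqnorm I d)) \<partial>?M)"
    by (subst nn_integral_multc) (simp_all add: v)
  also have "\<dots> = ?v * ?v"
    by (subst nn_integral_cmult) (simp_all add: v)
  also have "\<dots> = ennreal ((pi ^ card I / fact (card I))\<^sup>2 * pos_powr (2 * card I) R)"
    using pos_powr_mult[of "card I" R "card I"]
    by (simp add: power2_eq_square mult_ac flip: ennreal_mult)
  finally show ?thesis .
qed

lemma indicator_max_lessThan: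
  "indicator {..<R} (max s t) = ennreal (pos_powr 0 (R - s)) * ennreal (pos_powr 0 (R - t))"
  by (auto simp: pos_powr_0 indicator_def)

text \<open>Both sides are integrals against measures on the line, which agree on all half lines
  because the two families of volumes are multiples of the same power of the radius.\<close>

lemma nn_integral_common_coordinate:
  fixes K :: "'i set" and P :: "real \<Rightarrow> ennreal"
  assumes K: "finite K" "q \<notin> K" "p \<notin> insert q K" and P[measurable]: "P \<in> borel_measurable borel"
  defines "\<kappa> \<equiv> 8 * pi\<^sup>2 / 9 * (pi ^ card K / pochhammer (5 / 2) (card K))\<^sup>2 / (2 * card K + 4)
      / (pi ^ (card K + 2) / fact (card K + 2))\<^sup>2"
  shows "(\<integral>\<^sup>+d. \<integral>\<^sup>+c. ennreal \<bar>cross2 (c q) (d q)\<bar> *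
        P (max (sqnorm (insert p (insert q K)) c) ((norm (c p))\<^sup>2 + sqnorm (insert q K) d))
      \<partial>Pi\<^sub>M (insert p (insert q K)) (\<lambda>_. lborel) \<partial>Pi\<^sub>M (insert q K) (\<lambda>_. lborel))
    = ennreal \<kappa> * (\<integral>\<^sup>+d. \<integral>\<^sup>+c. P (max (sqnorm (insert p (insert q K)) c) (sqnorm (insert p (insert q K)) d))
      \<partial>Pi\<^sub>M (insert p (insert q K)) (\<lambda>_. lborel :: (real \<times> real) measure)
      \<partial>Pi\<^sub>M (insert p (insert q K)) (\<lambda>_. lborel :: (real \<times> real) measure))"
proof -
  let ?V = "lborel :: (real \<times> real) measure"
  let ?I' = "insert q K"
  let ?I = "insert p (insert q K)"
  let ?PI' = "Pi\<^sub>M ?I' (\<lambda>_. ?V)"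
  let ?PI = "Pi\<^sub>M ?I (\<lambda>_. ?V)"
  interpret I: sigma_finite_measure ?PI using K by (intro sigma_finite_PiM_lborel) auto
  let ?w = "\<lambda>(d, c). ennreal \<bar>cross2 (c q) (d q)\<bar>"
  let ?t1 = "\<lambda>(d, c). max (sqnorm ?I c) ((norm (c p))\<^sup>2 + sqnorm ?I' d)"
  let ?t2 = "\<lambda>(d, c). max (sqnorm ?I c) (sqnorm ?I d)"
  let ?N1 = "distr (density (?PI' \<Otimes>\<^sub>M ?PI) ?w) borel ?t1"
  let ?N2 = "density (distr (?PI \<Otimes>\<^sub>M ?PI) borel ?t2) (\<lambda>_. ennreal \<kappa>)"
  have w[measurable]: "?w \<in> borel_measurable (?PI' \<Otimes>\<^sub>M ?PI)"
    by measurable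
  have t1[measurable]: "?t1 \<in> borel_measurable (?PI' \<Otimes>\<^sub>M ?PI)"
    by measurable
  have t2[measurable]: "?t2 \<in> borel_measurable (?PI \<Otimes>\<^sub>M ?PI)"
    by measurable
  have N1: "integral\<^sup>N ?N1 g = (\<integral>\<^sup>+d. \<integral>\<^sup>+c. ennreal \<bar>cross2 (c q) (d q)\<bar> *
      g (max (sqnorm ?I c) ((norm (c p))\<^sup>2 + sqnorm ?I' d)) \<partial>?PI \<partial>?PI')"
    if [measurable]: "g \<in> borel_measurable borel" for g
  proof -
    have "integral\<^sup>N ?N1 g = (\<integral>\<^sup>+x. ?w x * g (?t1 x) \<partial>(?PI' \<Otimes>\<^sub>M ?PI))"
      by (subst nn_integral_distr, simp, simp, subst nn_integral_density) auto
    also have "\<dots> = (\<integral>\<^sup>+d. \<integral>\<^sup>+c. ?w (d, c) * g (?t1 (d, c)) \<partial>?PI \<partial>?PI')"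
      by (rule I.nn_integral_fst[symmetric]) measurable
    finally show ?thesis by simp
  qed
  have N2: "integral\<^sup>N ?N2 g = ennreal \<kappa> * (\<integral>\<^sup>+d. \<integral>\<^sup>+c. g (max (sqnorm ?I c) (sqnorm ?I d)) \<partial>?PI \<partial>?PI)"
    if [measurable]: "g \<in> borel_measurable borel" for g
  proof -
    have "integral\<^sup>N ?N2 g = ennreal \<kappa> * (\<integral>\<^sup>+x. g (?t2 x) \<partial>(?PI \<Otimes>\<^sub>M ?PI))"
      by (subst nn_integral_density, simp, simp, subst nn_integral_cmult, simp, subst nn_integral_distr) auto
    also have "(\<integral>\<^sup>+x. g (?t2 x) \<partial>(?PI \<Otimes>\<^sub>M ?PI)) = (\<integral>\<^sup>+d. \<integral>\<^sup>+c. g (?t2 (d, c)) \<partial>?PI \<partial>?PI)"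
      by (rule I.nn_integral_fst[symmetric]) measurable
    finally show ?thesis by simp
  qed
  have card: "card ?I = card K + 2" using K by simp
  have e1: "emeasure ?N1 {..<R} = ennreal (8 * pi\<^sup>2 / 9 * (pi ^ card K / pochhammer (5 / 2) (card K))\<^sup>2
      / (2 * card K + 4) * pos_powr (2 * card K + 4) R)" for R
  proof -
    have "emeasure ?N1 {..<R} = integral\<^sup>N ?N1 (indicator {..<R})" by simp
    also have "\<dots> = (\<integral>\<^sup>+d. \<integral>\<^sup>+c. ennreal \<bar>cross2 (c q) (d q)\<bar> *
      indicator {..<R} (max (sqnorm ?I c) ((norm (c p))\<^sup>2 + sqnorm ?I' d)) \<partial>?PI \<partial>?PI')"
      by (rule N1) simp
    finally show ?thesis
      unfolding indicator_max_lessThan nn_integral_common_coordinate_ball[OF K] .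
  qed
  have e2: "emeasure ?N2 {..<R} = ennreal \<kappa> * ennreal ((pi ^ (card K + 2) / fact (card K + 2))\<^sup>2 * pos_powr (2 * (card K + 2)) R)" for R
  proof -
    have "emeasure ?N2 {..<R} = integral\<^sup>N ?N2 (indicator {..<R})" by simp
    also have "\<dots> = ennreal \<kappa> * (\<integral>\<^sup>+d. \<integral>\<^sup>+c. indicator {..<R} (max (sqnorm ?I c) (sqnorm ?I d)) \<partial>?PI \<partial>?PI)"
      by (rule N2) simp
    finally show ?thesis
      unfolding indicator_max_lessThan using nn_integral_two_balls[of ?I R] K(1) unfolding card by simp
  qed
  have "?N1 = ?N2"
  proof (rule measure_eqI_lessThan_real)
    show "emeasure ?N1 {..<R} = emeasure ?N2 {..<R}" for R
    proof -
      \<comment> \<open>Since \<open>card ?I = card K + 2\<close>, both volumes carry the power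
        \<open>2 * card K + 4\<close> of \<open>R\<close>, and \<open>\<kappa>\<close> is the
        quotient of their coefficients.\<close>
      have eq: "\<kappa> * ((pi ^ (card K + 2) / fact (card K + 2))\<^sup>2 * pos_powr (2 * (card K + 2)) R)
          = 8 * pi\<^sup>2 / 9 * (pi ^ card K / pochhammer (5 / 2) (card K))\<^sup>2 / (2 * card K + 4) * pos_powr (2 * card K + 4) R"
        by (simp add: \<kappa>_def add.commute)
      have "0 \<le> \<kappa>" by (simp add: \<kappa>_def)
      then show ?thesis unfolding e1 e2 eq[symmetric] by (simp only: ennreal_mult')
    qed
    show "emeasure ?N1 {..<R} \<noteq> \<infinity>" for R unfolding e1 by simp
  qed auto
  then show ?thesis using N1[OF P] N2[OF P] by simp
qed

text \<open>The number \<open>3 * pochhammer (5 / 2) k\<close> is the product of the odd numbers up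
  to \<open>2 * k + 3\<close> divided by \<open>2 ^ k\<close>, hence a quotient of factorials up to
  a power of 2. At \<open>k = 2 * N - 1\<close> these are \<open>fact (4 * N + 1)\<close> and
  \<open>fact (2 * N)\<close>.\<close>

lemma pochhammer_five_halves:
  "3 * pochhammer (5 / 2 :: real) k * 2 ^ (2 * k + 2) * fact (k + 1) = 2 * fact (2 * k + 3)"
proof (induction k)
  case 0
  then show ?case by (simp add: fact_numeral)
next
  case (Suc k)
  have "3 * pochhammer (5 / 2 :: real) (Suc k) * 2 ^ (2 * Suc k + 2) * fact (Suc k + 1)
      = (3 * pochhammer (5 / 2) k * 2 ^ (2 * k + 2) * fact (k + 1)) * ((5 / 2 + k) * 4 * (k + 2))"
    by (simp add: pochhammer_Suc algebra_simps)
  also have "\<dots> = 2 * fact (2 * k + 3) * ((5 / 2 + k) * 4 * (k + 2))"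
    by (simp only: Suc.IH)
  also have "(5 / 2 + real k) * 4 * (k + 2) = (2 * k + 4) * (2 * k + 5)"
    by (simp add: algebra_simps)
  also have "2 * fact (2 * k + 3) * real ((2 * k + 4) * (2 * k + 5)) = 2 * fact (2 * Suc k + 3)"
  proof -
    have "2 * Suc k + 3 = Suc (Suc (2 * k + 3))" by simp
    then show ?thesis by (simp only: fact_Suc) (simp add: algebra_simps)
  qed
  finally show ?case by simp
qed

section \<open>Pairs of curves meeting at given parameters\<close>

lemma nn_integral_affine_plane:
  fixes f :: "real \<times> real \<Rightarrow> ennreal"
  assumes [measurable]: "f \<in> borel_measurable borel" and "k \<noteq> 0"
  shows "integral\<^sup>N lborel f = ennreal (k\<^sup>2) * (\<integral>\<^sup>+x. f (t + k *\<^sub>R x) \<partial>lborel)"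
  by (subst lborel_affine[OF \<open>k \<noteq> 0\<close>, of t])
    (simp add: nn_integral_density nn_integral_distr nn_integral_cmult power2_eq_square)

lemma lincomb_insert_upd:
  "finite I \<Longrightarrow> i \<notin> I \<Longrightarrow> lincomb (insert i I) u (c(i := x)) = u i *\<^sub>R x + lincomb I u c"
  by (auto simp: lincomb_def intro!: sum.cong)

lemma cross2_scaleR: "cross2 (a *\<^sub>R x) (b *\<^sub>R z) = a * b * cross2 x z"
  by (simp add: cross2_def algebra_simps)

text \<open>The left side is the integral over the pairs of curves meeting at two given parameters,
  with the \<open>p\<close>-th coefficient of the first curve eliminated.  Rotating first \<open>d\<close> and then \<open>c\<close>
  turns the two points and the two tangents into coordinates.\<close>

lemma nn_integral_incidence:
  fixes K :: "'i set" and P :: "real \<Rightarrow> ennreal"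
  assumes K: "finite K" "q \<notin> K" "p \<notin> insert q K" "K \<noteq> {}" and P[measurable]: "P \<in> borel_measurable borel"
  defines "I' \<equiv> insert q K" and "I \<equiv> insert p (insert q K)"
  assumes p: "u p \<noteq> 0" "v p = 0" and \<epsilon>: "0 < \<epsilon>" "(\<Sum>k\<in>I. u k * u k) = \<epsilon>" "(\<Sum>k\<in>I. u2 k * u2 k) = \<epsilon>"
    and \<sigma>: "(\<Sum>k\<in>I. v k * v k) = \<sigma>" "(\<Sum>k\<in>I. v2 k * v2 k) = \<sigma>"
    and orth: "(\<Sum>k\<in>I. u k * v k) = 0" "(\<Sum>k\<in>I. u2 k * v2 k) = 0"
  shows "(\<integral>\<^sup>+d. \<integral>\<^sup>+c. P (max ((norm ((1 / u p) *\<^sub>R (lincomb I u2 d - lincomb I' u c)))\<^sup>2 + sqnorm I' c) (sqnorm I d))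
        * ennreal \<bar>cross2 (lincomb I' v c) (lincomb I v2 d)\<bar> \<partial>Pi\<^sub>M I' (\<lambda>_. lborel) \<partial>Pi\<^sub>M I (\<lambda>_. lborel))
    = ennreal ((u p)\<^sup>2 * \<sigma> / \<epsilon>) * (\<integral>\<^sup>+d. \<integral>\<^sup>+c. ennreal \<bar>cross2 (c q) (d q)\<bar> * P (max (sqnorm I c) ((norm (c p))\<^sup>2 + sqnorm I' d))
      \<partial>Pi\<^sub>M I (\<lambda>_. lborel) \<partial>Pi\<^sub>M I' (\<lambda>_. lborel))"
proof -
  let ?V = "lborel :: (real \<times> real) measure"
  let ?PI' = "Pi\<^sub>M I' (\<lambda>_. ?V)" and ?PI = "Pi\<^sub>M I (\<lambda>_. ?V)"
  interpret product_sigma_finite "\<lambda>_::'i. ?V" by unfold_locales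
  have I': "finite I'" "p \<notin> I'" "q \<in> I'" and I: "I = insert p I'" and fin: "finite I" "p \<in> I" "q \<in> I" "p \<noteq> q" "I - {p, q} \<noteq> {}"
    using K by (auto simp: I_def I'_def)
  interpret PI': sigma_finite_measure ?PI' using I'(1) by (rule sigma_finite_PiM_lborel)
  interpret P: pair_sigma_finite ?V ?PI' ..
  have comp: "(\<lambda>d. d k) \<in> borel_measurable ?PI" if "k \<in> I" for k
    using measurable_component_singleton[OF that, of "\<lambda>_. ?V"] by simp
  have sq: "(\<lambda>d. sqnorm I d) \<in> borel_measurable ?PI"
    by (rule measurable_sqnorm) (rule comp)
  have "\<sigma> \<ge> 0" using \<sigma>(1) by (metis sum_nonneg zero_le_square)
  \<comment> \<open>The integrand as a function of the point \<open>w\<close> of the second curve,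
    its tangent \<open>z\<close>, its squared norm \<open>s\<close> and the remaining coefficients
    \<open>c\<close> of the first curve.\<close>
  define g where "g w z s c = P (max ((norm ((1 / u p) *\<^sub>R (w - lincomb I' u c)))\<^sup>2 + sqnorm I' c) s)
      * ennreal \<bar>cross2 (lincomb I' v c) z\<bar>" for w z s c
  define G where "G = (\<lambda>(w, z, s). \<integral>\<^sup>+c. g w z s c \<partial>?PI')"
  have gm[measurable (raw)]: "(\<lambda>x. g (f1 x) (f2 x) (f3 x) (f4 x)) \<in> borel_measurable M"
    if [measurable]: "f1 \<in> borel_measurable M" "f2 \<in> borel_measurable M" "f3 \<in> borel_measurable M"
      and f4: "f4 \<in> M \<rightarrow>\<^sub>M ?PI'"
    for M :: "'m measure" and f1 f2 f3 f4
  proof -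
    have f4': "(\<lambda>x. f4 x k) \<in> borel_measurable M" if "k \<in> I'" for k
      using measurable_compose[OF f4 measurable_component_singleton[OF that]] by simp
    have [measurable]: "(\<lambda>x. lincomb I' w (f4 x)) \<in> borel_measurable M" "(\<lambda>x. sqnorm I' (f4 x)) \<in> borel_measurable M" for w
      using f4' by (auto intro: measurable_lincomb measurable_sqnorm)
    show ?thesis unfolding g_def by measurable
  qed
  have Gm[measurable]: "G \<in> borel_measurable borel"
  proof -
    have "G \<in> borel_measurable ((borel :: (real \<times> real) measure) \<Otimes>\<^sub>M (borel :: (real \<times> real) measure) \<Otimes>\<^sub>M (borel :: real measure))"
      unfolding G_def by measurable
    then show ?thesis by (simp add: borel_prod)
  qed
  have m1: "(\<lambda>d. G (sqrt \<epsilon> *\<^sub>R d p, sqrt \<sigma> *\<^sub>R d q, sqnorm I d)) \<in> borel_measurable ?PI"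
    using fin by (intro measurable_compose[OF _ Gm] borel_measurable_Pair borel_measurable_scaleR borel_measurable_const comp sq)
  have "(\<integral>\<^sup>+d. \<integral>\<^sup>+c. g (lincomb I u2 d) (lincomb I v2 d) (sqnorm I d) c \<partial>?PI' \<partial>?PI)
      = (\<integral>\<^sup>+d. G (lincomb I u2 d, lincomb I v2 d, sqnorm I d) \<partial>?PI)"
    by (simp add: G_def)
  also have "\<dots> = (\<integral>\<^sup>+d. G (sqrt \<epsilon> *\<^sub>R d p, sqrt \<sigma> *\<^sub>R d q, sqnorm I d) \<partial>?PI)"
    using nn_integral_orthogonal_lincombs[OF fin Gm orth(2)] \<epsilon> \<sigma> by simp
  also have "\<dots> = (\<integral>\<^sup>+d. \<integral>\<^sup>+x. G (sqrt \<epsilon> *\<^sub>R (d(p := x)) p, sqrt \<sigma> *\<^sub>R (d(p := x)) q, sqnorm I (d(p := x))) \<partial>?V \<partial>?PI')"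
    unfolding I using I' m1 by (intro product_nn_integral_insert) (auto simp: I[symmetric])
  \<comment> \<open>Writing the norm with \<open>sqrt \<epsilon> *\<^sub>R x\<close> makes
    \<open>x\<close> occur only in this form, so that it can be replaced by the point
    \<open>w\<close>, with Jacobian \<open>\<epsilon>\<close> in the plane.\<close>
  also have "\<dots> = (\<integral>\<^sup>+d. \<integral>\<^sup>+x. G (sqrt \<epsilon> *\<^sub>R x, sqrt \<sigma> *\<^sub>R d q, (norm (sqrt \<epsilon> *\<^sub>R x))\<^sup>2 / \<epsilon> + sqnorm I' d) \<partial>?V \<partial>?PI')"
    using I' fin \<epsilon>(1) unfolding I by (simp add: sqnorm_insert_upd power_mult_distrib)
  also have "\<dots> = (\<integral>\<^sup>+d. ennreal (1 / \<epsilon>) * (\<integral>\<^sup>+w. G (w, sqrt \<sigma> *\<^sub>R d q, (norm w)\<^sup>2 / \<epsilon> + sqnorm I' d) \<partial>?V) \<partial>?PI')"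
  proof (rule nn_integral_cong)
    fix d :: "'i \<Rightarrow> real \<times> real"
    let ?f = "\<lambda>w. G (w, sqrt \<sigma> *\<^sub>R d q, (norm w)\<^sup>2 / \<epsilon> + sqnorm I' d)"
    have "integral\<^sup>N ?V ?f = ennreal ((sqrt \<epsilon>)\<^sup>2) * (\<integral>\<^sup>+x. ?f (0 + sqrt \<epsilon> *\<^sub>R x) \<partial>?V)"
      using \<epsilon>(1) by (intro nn_integral_affine_plane) auto
    then have "ennreal (1 / \<epsilon>) * integral\<^sup>N ?V ?f = ennreal (1 / \<epsilon> * \<epsilon>) * (\<integral>\<^sup>+x. ?f (sqrt \<epsilon> *\<^sub>R x) \<partial>?V)"
      using \<epsilon>(1) by (subst ennreal_mult) (auto simp: mult.assoc)
    then show "(\<integral>\<^sup>+x. ?f (sqrt \<epsilon> *\<^sub>R x) \<partial>?V) = ennreal (1 / \<epsilon>) * integral\<^sup>N ?V ?f"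
      using \<epsilon>(1) by simp
  qed
  \<comment> \<open>The point \<open>w\<close> becomes the innermost variable, to be traded for the
    eliminated coefficient of the first curve.\<close>
  also have "\<dots> = (\<integral>\<^sup>+d. ennreal (1 / \<epsilon>) * (\<integral>\<^sup>+c. \<integral>\<^sup>+w. g w (sqrt \<sigma> *\<^sub>R d q) ((norm w)\<^sup>2 / \<epsilon> + sqnorm I' d) c \<partial>?V \<partial>?PI') \<partial>?PI')"
    unfolding G_def prod.case by (intro nn_integral_cong arg_cong2[where f = "(*)"] refl P.Fubini'[symmetric]) measurable
  also have "\<dots> = (\<integral>\<^sup>+d. ennreal (1 / \<epsilon>) * (ennreal ((u p)\<^sup>2 * \<sigma>) * (\<integral>\<^sup>+c. ennreal \<bar>cross2 (c q) (d q)\<bar> *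
      P (max (sqnorm I c) ((norm (c p))\<^sup>2 + sqnorm I' d)) \<partial>?PI)) \<partial>?PI')"
  proof (intro nn_integral_cong arg_cong2[where f = "(*)"] refl)
    fix d :: "'i \<Rightarrow> real \<times> real"
    define k where "k = (\<lambda>(w :: real \<times> real, z, s). P (max s ((norm w)\<^sup>2 / \<epsilon> + sqnorm I' d)) * ennreal \<bar>cross2 z (sqrt \<sigma> *\<^sub>R d q)\<bar>)"
    have km[measurable]: "k \<in> borel_measurable borel"
    proof -
      have "k \<in> borel_measurable ((borel :: (real \<times> real) measure) \<Otimes>\<^sub>M (borel :: (real \<times> real) measure) \<Otimes>\<^sub>M (borel :: real measure))"
        unfolding k_def by measurable
      then show ?thesis by (simp add: borel_prod)
    qed
    \<comment> \<open>The substitution \<open>w = lincomb I' u c + u p *\<^sub>R x\<close> restores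
      the eliminated coefficient \<open>x\<close> at the cost of \<open>(u p)\<^sup>2\<close>; the
      tangent does not involve \<open>x\<close> since \<open>v p = 0\<close>. The integral then runs
      over all coefficients of the first curve, which can be rotated like those of the second. After
      that \<open>w\<close> is \<open>sqrt \<epsilon> *\<^sub>R c p\<close>, so
      \<open>(norm w)\<^sup>2 / \<epsilon>\<close> becomes \<open>(norm (c p))\<^sup>2\<close> and
      the curves share the coordinate \<open>c p\<close>.\<close>
    have "(\<integral>\<^sup>+w. g w (sqrt \<sigma> *\<^sub>R d q) ((norm w)\<^sup>2 / \<epsilon> + sqnorm I' d) c \<partial>?V)
        = ennreal ((u p)\<^sup>2) * (\<integral>\<^sup>+x. k (lincomb I u (c(p := x)), lincomb I v (c(p := x)), sqnorm I (c(p := x))) \<partial>?V)" for c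
    proof -
      have "(\<integral>\<^sup>+w. g w (sqrt \<sigma> *\<^sub>R d q) ((norm w)\<^sup>2 / \<epsilon> + sqnorm I' d) c \<partial>?V)
          = ennreal ((u p)\<^sup>2) * (\<integral>\<^sup>+x. g (lincomb I' u c + u p *\<^sub>R x) (sqrt \<sigma> *\<^sub>R d q)
            ((norm (lincomb I' u c + u p *\<^sub>R x))\<^sup>2 / \<epsilon> + sqnorm I' d) c \<partial>?V)"
        using p(1) unfolding g_def by (intro nn_integral_affine_plane) measurable
      also have "(\<lambda>x. g (lincomb I' u c + u p *\<^sub>R x) (sqrt \<sigma> *\<^sub>R d q)
            ((norm (lincomb I' u c + u p *\<^sub>R x))\<^sup>2 / \<epsilon> + sqnorm I' d) c)
          = (\<lambda>x. k (lincomb I u (c(p := x)), lincomb I v (c(p := x)), sqnorm I (c(p := x))))"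
        using p I' unfolding g_def k_def I
        by (simp add: lincomb_insert_upd sqnorm_insert_upd add.commute fun_eq_iff)
      finally show ?thesis .
    qed
    then have "(\<integral>\<^sup>+c. \<integral>\<^sup>+w. g w (sqrt \<sigma> *\<^sub>R d q) ((norm w)\<^sup>2 / \<epsilon> + sqnorm I' d) c \<partial>?V \<partial>?PI')
        = (\<integral>\<^sup>+c. ennreal ((u p)\<^sup>2) * (\<integral>\<^sup>+x. k (lincomb I u (c(p := x)), lincomb I v (c(p := x)), sqnorm I (c(p := x))) \<partial>?V) \<partial>?PI')"
      by simp
    also have "\<dots> = ennreal ((u p)\<^sup>2) * (\<integral>\<^sup>+c. \<integral>\<^sup>+x. k (lincomb I u (c(p := x)), lincomb I v (c(p := x)), sqnorm I (c(p := x))) \<partial>?V \<partial>?PI')"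
      unfolding I by (rule nn_integral_cmult) measurable
    also have "(\<integral>\<^sup>+c. \<integral>\<^sup>+x. k (lincomb I u (c(p := x)), lincomb I v (c(p := x)), sqnorm I (c(p := x))) \<partial>?V \<partial>?PI')
        = (\<integral>\<^sup>+c. k (lincomb I u c, lincomb I v c, sqnorm I c) \<partial>?PI)"
      unfolding I using I' by (intro product_nn_integral_insert[symmetric]) auto
    also have "\<dots> = (\<integral>\<^sup>+c. k (sqrt \<epsilon> *\<^sub>R c p, sqrt \<sigma> *\<^sub>R c q, sqnorm I c) \<partial>?PI)"
      using nn_integral_orthogonal_lincombs[OF fin km orth(1)] \<epsilon> \<sigma> by simp
    \<comment> \<open>The two tangents contribute a factor \<open>sqrt \<sigma>\<close>
      each.\<close>
    also have "\<dots> = (\<integral>\<^sup>+c. ennreal \<sigma> * (ennreal \<bar>cross2 (c q) (d q)\<bar> * P (max (sqnorm I c) ((norm (c p))\<^sup>2 + sqnorm I' d))) \<partial>?PI)"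
      using \<epsilon>(1) \<open>\<sigma> \<ge> 0\<close> unfolding k_def prod.case cross2_scaleR
      by (simp add: power_mult_distrib abs_mult ennreal_mult mult_ac)
    also have "\<dots> = ennreal \<sigma> * (\<integral>\<^sup>+c. ennreal \<bar>cross2 (c q) (d q)\<bar> * P (max (sqnorm I c) ((norm (c p))\<^sup>2 + sqnorm I' d)) \<partial>?PI)"
      using fin by (intro nn_integral_cmult) measurable
    finally show "(\<integral>\<^sup>+c. \<integral>\<^sup>+w. g w (sqrt \<sigma> *\<^sub>R d q) ((norm w)\<^sup>2 / \<epsilon> + sqnorm I' d) c \<partial>?V \<partial>?PI')
        = ennreal ((u p)\<^sup>2 * \<sigma>) * (\<integral>\<^sup>+c. ennreal \<bar>cross2 (c q) (d q)\<bar> *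
          P (max (sqnorm I c) ((norm (c p))\<^sup>2 + sqnorm I' d)) \<partial>?PI)"
      using \<open>\<sigma> \<ge> 0\<close> by (simp add: ennreal_mult mult.assoc)
  qed
  also have "\<dots> = ennreal ((u p)\<^sup>2 * \<sigma> / \<epsilon>) * (\<integral>\<^sup>+d. \<integral>\<^sup>+c. ennreal \<bar>cross2 (c q) (d q)\<bar> *
      P (max (sqnorm I c) ((norm (c p))\<^sup>2 + sqnorm I' d)) \<partial>?PI \<partial>?PI')"
  proof -
    interpret PI: sigma_finite_measure ?PI using fin(1) by (rule sigma_finite_PiM_lborel)
    have "ennreal ((u p)\<^sup>2 * \<sigma> / \<epsilon>) = ennreal (1 / \<epsilon>) * ennreal ((u p)\<^sup>2 * \<sigma>)"
      using \<open>\<sigma> \<ge> 0\<close> \<epsilon>(1) by (simp flip: ennreal_mult)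
    moreover have "(\<lambda>d. \<integral>\<^sup>+c. ennreal \<bar>cross2 (c q) (d q)\<bar> * P (max (sqnorm I c) ((norm (c p))\<^sup>2 + sqnorm I' d)) \<partial>?PI)
        \<in> borel_measurable ?PI'"
      using fin I' by measurable
    ultimately show ?thesis
      by (simp add: nn_integral_cmult mult.assoc)
  qed
  finally show ?thesis unfolding g_def .
qed

section \<open>Trigonometric curves\<close>

lemma curve_of_coords_lincomb:
  "curve_of_coords N c \<phi> = lincomb {..2 * N} (\<lambda>k. trig_basis k \<phi>) c"
  by (simp add: curve_of_coords_def lincomb_def)

lemma L2_norm_curve_sqnorm: "L2_norm_curve (curve_of_coords N c) = sqrt (sqnorm {..2 * N} c)"
  by (simp add: L2_norm_curve_of_coords sqnorm_def)

definition trig_basis' :: "nat \<Rightarrow> real \<Rightarrow> real" where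
  "trig_basis' k \<phi> =
    (if k = 0 then 0
     else if odd k then - real ((k + 1) div 2) * sin (real ((k + 1) div 2) * \<phi>)
     else real (k div 2) * cos (real (k div 2) * \<phi>))"

lemma has_real_derivative_trig_basis[derivative_intros]:
  "(trig_basis k has_real_derivative trig_basis' k x) (at x)"
proof -
  consider "k = 0" | "k \<noteq> 0" "odd k" | "k \<noteq> 0" "even k" by blast
  then show ?thesis
    by cases (auto simp: trig_basis_def[abs_def] trig_basis'_def algebra_simps intro!: derivative_eq_intros)
qed

lemma continuous_on_trig_basis: "continuous_on UNIV (trig_basis k)"
  by (meson DERIV_isCont continuous_at_imp_continuous_on has_real_derivative_trig_basis)

lemma continuous_on_trig_basis': "continuous_on UNIV (trig_basis' k)"
proof -
  consider "k = 0" | "k \<noteq> 0" "odd k" | "k \<noteq> 0" "even k" by blast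
  then show ?thesis
    by cases (auto simp: trig_basis'_def[abs_def] intro!: continuous_intros)
qed

lemma trig_basis_Suc_double:
  "trig_basis (Suc (2 * n)) \<phi> = cos (real (n + 1) * \<phi>)" "trig_basis (Suc (Suc (2 * n))) \<phi> = sin (real (n + 1) * \<phi>)"
  "trig_basis' (Suc (2 * n)) \<phi> = - real (n + 1) * sin (real (n + 1) * \<phi>)"
  "trig_basis' (Suc (Suc (2 * n))) \<phi> = real (n + 1) * cos (real (n + 1) * \<phi>)"
  by (simp_all add: trig_basis_def trig_basis'_def)

text \<open>Cosine and sine of one frequency combine to a value independent of the parameter; the
  constant function contributes \<open>1 / 2\<close>. With the next two lemmas, the Gram matrix of
  the vectors of values and of derivatives is diagonal and the same at every parameter, as the
  rotations require.\<close>

lemma sum_trig_basis_sq: "(\<Sum>k\<le>2 * N. trig_basis k \<phi> * trig_basis k \<phi>) = N + 1 / 2"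
proof (induction N)
  case 0
  then show ?case by (simp add: trig_basis_def)
next
  case (Suc N)
  have "(\<Sum>k\<le>2 * Suc N. trig_basis k \<phi> * trig_basis k \<phi>) = (\<Sum>k\<le>2 * N. trig_basis k \<phi> * trig_basis k \<phi>)
      + ((cos (real (N + 1) * \<phi>))\<^sup>2 + (sin (real (N + 1) * \<phi>))\<^sup>2)"
    by (simp only: mult_Suc_right add_2_eq_Suc sum.atMost_Suc trig_basis_Suc_double power2_eq_square add.assoc)
  then show ?case using Suc.IH by simp
qed

lemma sum_trig_basis_orthogonal: "(\<Sum>k\<le>2 * N. trig_basis k \<phi> * trig_basis' k \<phi>) = 0"
proof (induction N)
  case 0
  then show ?case by (simp add: trig_basis'_def)
next
  case (Suc N)
  then show ?case
    by (simp only: mult_Suc_right add_2_eq_Suc sum.atMost_Suc trig_basis_Suc_double) (simp add: algebra_simps)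
qed

lemma sum_trig_basis'_sq: "(\<Sum>k\<le>2 * N. trig_basis' k \<phi> * trig_basis' k \<phi>) = (\<Sum>j=1..N. real j ^ 2)"
proof (induction N)
  case 0
  then show ?case by (simp add: trig_basis'_def)
next
  case (Suc N)
  have sq: "(- n * s) * (- n * s) + (n * c) * (n * c) = n\<^sup>2 * (s\<^sup>2 + c\<^sup>2)" for n s c :: real
    by (simp add: power2_eq_square algebra_simps)
  have "(\<Sum>k\<le>2 * Suc N. trig_basis' k \<phi> * trig_basis' k \<phi>) = (\<Sum>k\<le>2 * N. trig_basis' k \<phi> * trig_basis' k \<phi>)
      + (real (N + 1))\<^sup>2 * ((sin (real (N + 1) * \<phi>))\<^sup>2 + (cos (real (N + 1) * \<phi>))\<^sup>2)"
    by (simp only: mult_Suc_right add_2_eq_Suc sum.atMost_Suc trig_basis_Suc_double add.assoc sq)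
  then show ?case using Suc.IH by simp
qed

lemma has_derivative_lincomb_trig_basis:
  "((\<lambda>x. lincomb I (\<lambda>k. trig_basis k x) c) has_derivative (\<lambda>s. s *\<^sub>R lincomb I (\<lambda>k. trig_basis' k x) c)) (at x)"
proof -
  have "((\<lambda>x. \<Sum>k\<in>I. trig_basis k x *\<^sub>R c k) has_derivative (\<lambda>s. \<Sum>k\<in>I. (trig_basis' k x * s) *\<^sub>R c k)) (at x)"
    by (intro has_derivative_sum has_derivative_scaleR_left)
      (use has_real_derivative_trig_basis in \<open>auto simp: has_field_derivative_def\<close>)
  then show ?thesis
    by (simp add: lincomb_def scaleR_sum_right mult.commute)
qed

lemma continuous_on_lincomb_trig:
  fixes c :: "nat \<Rightarrow> 'a::real_normed_vector"
  shows "continuous_on UNIV (\<lambda>x. lincomb I (\<lambda>k. trig_basis k x) c)"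
    "continuous_on UNIV (\<lambda>x. lincomb I (\<lambda>k. trig_basis' k x) c)"
  unfolding lincomb_def by (intro continuous_intros continuous_on_trig_basis continuous_on_trig_basis')+

text \<open>The constant coefficient which makes the first curve pass through the point with
  parameter \<open>snd y\<close> of the second one at the parameter \<open>fst y\<close>.\<close>

definition meeting_coeff :: "nat \<Rightarrow> (nat \<Rightarrow> real \<times> real) \<Rightarrow> (nat \<Rightarrow> real \<times> real) \<Rightarrow> real \<times> real \<Rightarrow> real \<times> real" where
  "meeting_coeff N c d y = sqrt 2 *\<^sub>R (lincomb {..2 * N} (\<lambda>k. trig_basis k (snd y)) d
      - lincomb {1..2 * N} (\<lambda>k. trig_basis k (fst y)) c)"

lemma atMost_insert_0: "{..2 * N} = insert 0 {1..2 * N :: nat}"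
  by auto

lemma meeting_coeff_iff:
  "curve_of_coords N (c(0 := x)) \<phi> = curve_of_coords N d \<psi> \<longleftrightarrow> meeting_coeff N c d (\<phi>, \<psi>) = x"
proof -
  have 1: "curve_of_coords N (c(0 := x)) \<phi> = (1 / sqrt 2) *\<^sub>R x + lincomb {1..2 * N} (\<lambda>k. trig_basis k \<phi>) c"
    unfolding curve_of_coords_lincomb atMost_insert_0
    by (subst lincomb_insert_upd) (auto simp: trig_basis_def)
  define z where "z = lincomb {1..2 * N} (\<lambda>k. trig_basis k \<phi>) c"
  define w where "w = lincomb {..2 * N} (\<lambda>k. trig_basis k \<psi>) d"
  have "(1 / sqrt 2) *\<^sub>R x + z = w \<longleftrightarrow> (1 / sqrt 2) *\<^sub>R x = w - z"
    by (auto simp: algebra_simps)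
  also have "\<dots> \<longleftrightarrow> sqrt 2 *\<^sub>R (1 / sqrt 2) *\<^sub>R x = sqrt 2 *\<^sub>R (w - z)"
    by (simp only: scaleR_cancel_left) simp
  also have "\<dots> \<longleftrightarrow> sqrt 2 *\<^sub>R (w - z) = x"
    by auto
  finally show ?thesis unfolding 1 curve_of_coords_lincomb[of N d] meeting_coeff_def
    by (simp add: z_def w_def)
qed

text \<open>A pair of parameters is an intersection iff \<open>meeting_coeff\<close> maps it to the
  constant coefficient \<open>x\<close>, so the area formula applies to a count of preimages in the
  square of parameters. The columns of the Jacobian matrix are \<open>- sqrt 2\<close> times the
  tangent of the first curve and \<open>sqrt 2\<close> times that of the second, whence the factor
  2.\<close>

lemma nn_integral_over_constant_coeff:
  assumes h[measurable]: "h \<in> borel_measurable borel"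
  shows "(\<integral>\<^sup>+x. h x * intersection_number (curve_of_coords N (c(0 := x))) (curve_of_coords N d) \<partial>lborel)
    = (\<integral>\<^sup>+y\<in>{0..<2 * pi} \<times> {0..<2 * pi}. h (meeting_coeff N c d y) *
        ennreal (2 * \<bar>cross2 (lincomb {1..2 * N} (\<lambda>k. trig_basis' k (fst y)) c)
          (lincomb {..2 * N} (\<lambda>k. trig_basis' k (snd y)) d)\<bar>) \<partial>lborel)"
proof -
  let ?S = "{0..<2 * pi} \<times> {0..<2 * pi}"
  let ?z = "\<lambda>y :: real \<times> real. lincomb {1..2 * N} (\<lambda>k. trig_basis' k (fst y)) c"
  let ?w = "\<lambda>y :: real \<times> real. lincomb {..2 * N} (\<lambda>k. trig_basis' k (snd y)) d"
  have "intersection_number (curve_of_coords N (c(0 := x))) (curve_of_coords N d)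
      = emeasure (count_space UNIV) {y \<in> ?S. meeting_coeff N c d y = x}" for x
    unfolding intersection_number_def meeting_coeff_iff
    by (rule arg_cong[where f = "emeasure _"]) auto
  then have "(\<integral>\<^sup>+x. h x * intersection_number (curve_of_coords N (c(0 := x))) (curve_of_coords N d) \<partial>lborel)
      = (\<integral>\<^sup>+x. h x * emeasure (count_space UNIV) {y \<in> ?S. meeting_coeff N c d y = x} \<partial>lborel)"
    by simp
  also have "\<dots> = (\<integral>\<^sup>+y\<in>?S. h (meeting_coeff N c d y) *
      ennreal \<bar>(- sqrt 2 * fst (?z y)) * (sqrt 2 * snd (?w y)) - (sqrt 2 * fst (?w y)) * (- sqrt 2 * snd (?z y))\<bar> \<partial>lborel)"
  proof (rule area_formula_plane)
    fix x :: "real \<times> real"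
    have "((\<lambda>y. lincomb {1..2 * N} (\<lambda>k. trig_basis k (fst y)) c) has_derivative (\<lambda>s. fst s *\<^sub>R ?z x)) (at x)"
      by (rule has_derivative_compose[OF bounded_linear.has_derivative[OF bounded_linear_fst has_derivative_ident]
            has_derivative_lincomb_trig_basis])
    moreover have "((\<lambda>y. lincomb {..2 * N} (\<lambda>k. trig_basis k (snd y)) d) has_derivative (\<lambda>s. snd s *\<^sub>R ?w x)) (at x)"
      by (rule has_derivative_compose[OF bounded_linear.has_derivative[OF bounded_linear_snd has_derivative_ident]
            has_derivative_lincomb_trig_basis])
    ultimately have "(meeting_coeff N c d has_derivative (\<lambda>s. sqrt 2 *\<^sub>R (snd s *\<^sub>R ?w x - fst s *\<^sub>R ?z x))) (at x)"
      unfolding meeting_coeff_def by (intro has_derivative_scaleR_right has_derivative_diff)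
    also have "(\<lambda>s. sqrt 2 *\<^sub>R (snd s *\<^sub>R ?w x - fst s *\<^sub>R ?z x))
        = (\<lambda>(s, t). ((- sqrt 2 * fst (?z x)) * s + (sqrt 2 * fst (?w x)) * t,
            (- sqrt 2 * snd (?z x)) * s + (sqrt 2 * snd (?w x)) * t))"
      by (auto simp: fun_eq_iff prod_eq_iff algebra_simps)
    finally show "(meeting_coeff N c d has_derivative \<dots>) (at x)" .
  next
    have z: "continuous_on UNIV ?z"
      by (rule continuous_on_compose2[OF continuous_on_lincomb_trig(2)]) (auto intro: continuous_intros)
    have w: "continuous_on UNIV ?w"
      by (rule continuous_on_compose2[OF continuous_on_lincomb_trig(2)]) (auto intro: continuous_intros)
    show "continuous_on UNIV (\<lambda>y. - sqrt 2 * fst (?z y))" "continuous_on UNIV (\<lambda>y. sqrt 2 * fst (?w y))"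
      "continuous_on UNIV (\<lambda>y. - sqrt 2 * snd (?z y))" "continuous_on UNIV (\<lambda>y. sqrt 2 * snd (?w y))"
      by (intro continuous_intros z w)+
    show "?S \<in> sets borel" by (auto simp: borel_prod[symmetric])
  qed (rule h)
  also have "\<dots> = (\<integral>\<^sup>+y\<in>?S. h (meeting_coeff N c d y) * ennreal (2 * \<bar>cross2 (?z y) (?w y)\<bar>) \<partial>lborel)"
  proof -
    have "\<bar>(- sqrt 2 * z1) * (sqrt 2 * w2) - (sqrt 2 * w1) * (- sqrt 2 * z2)\<bar> = 2 * \<bar>z1 * w2 - z2 * w1\<bar>" for z1 z2 w1 w2 :: real
    proof -
      have "(- sqrt 2 * z1) * (sqrt 2 * w2) - (sqrt 2 * w1) * (- sqrt 2 * z2) = - (sqrt 2 * sqrt 2) * (z1 * w2 - z2 * w1)"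
        by algebra
      also have "\<dots> = (- 2) * (z1 * w2 - z2 * w1)" by simp
      finally show ?thesis by (simp only: abs_mult)
    qed
    then show ?thesis by (simp only: cross2_def)
  qed
  finally show ?thesis .
qed

section \<open>Expected number of intersections in coordinates\<close>

abbreviation coord_measure :: "nat set \<Rightarrow> (nat \<Rightarrow> real \<times> real) measure" where
  "coord_measure I \<equiv> Pi\<^sub>M I (\<lambda>_. lborel)"

lemma borel_measurable_trig_basis[measurable]:
  "trig_basis k \<in> borel_measurable borel" "trig_basis' k \<in> borel_measurable borel"
  by (intro borel_measurable_continuous_onI continuous_on_trig_basis continuous_on_trig_basis')+

lemma measurable_coord:
  assumes "f \<in> M \<rightarrow>\<^sub>M coord_measure I" "k \<in> I"
  shows "(\<lambda>x. f x k) \<in> borel_measurable M"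
  using measurable_compose[OF assms(1) measurable_component_singleton[OF assms(2)]] by simp

lemma measurable_lincomb_trig:
  assumes f: "f \<in> M \<rightarrow>\<^sub>M coord_measure I" and [measurable]: "t \<in> borel_measurable M"
  shows "(\<lambda>x. lincomb I (\<lambda>k. trig_basis k (t x)) (f x)) \<in> borel_measurable M"
    "(\<lambda>x. lincomb I (\<lambda>k. trig_basis' k (t x)) (f x)) \<in> borel_measurable M"
proof -
  have [measurable]: "(\<lambda>x. f x k) \<in> borel_measurable M" if "k \<in> I" for k
    using f that by (rule measurable_coord)
  show "(\<lambda>x. lincomb I (\<lambda>k. trig_basis k (t x)) (f x)) \<in> borel_measurable M"
    "(\<lambda>x. lincomb I (\<lambda>k. trig_basis' k (t x)) (f x)) \<in> borel_measurable M"
    unfolding lincomb_def by measurable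
qed

lemma measurable_sqnorm_coord:
  assumes f: "f \<in> M \<rightarrow>\<^sub>M coord_measure I"
  shows "(\<lambda>x. sqnorm I (f x)) \<in> borel_measurable M"
  by (rule measurable_sqnorm) (rule measurable_coord[OF f])

text \<open>Intersections are the zeros of the difference of the two curves as a function of both
  parameters. The pair is ordered \<open>(d, c)\<close> because the coefficients of the second curve
  form the outer variable of integration.\<close>

lemma borel_measurable_intersection_number_coords:
  "(\<lambda>(d, c). intersection_number (curve_of_coords N c) (curve_of_coords N d))
    \<in> borel_measurable (coord_measure {..2 * N} \<Otimes>\<^sub>M coord_measure {..2 * N})"
proof -
  let ?F = "\<lambda>x y. curve_of_coords N (snd x) (fst y) - curve_of_coords N (fst x) (snd y)"
  have "(\<lambda>(d, c). intersection_number (curve_of_coords N c) (curve_of_coords N d))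
      = (\<lambda>x. emeasure (count_space UNIV) {y \<in> {0..<2 * pi} \<times> {0..<2 * pi}. ?F x y = 0})"
    by (auto simp: fun_eq_iff intersection_number_def intro!: arg_cong[where f = "emeasure _"])
  moreover have "(\<lambda>x. emeasure (count_space UNIV) {y \<in> {0..<2 * pi} \<times> {0..<2 * pi}. ?F x y = 0})
      \<in> borel_measurable (coord_measure {..2 * N} \<Otimes>\<^sub>M coord_measure {..2 * N})"
  proof (rule borel_measurable_count_zeros)
    fix x :: "(nat \<Rightarrow> real \<times> real) \<times> (nat \<Rightarrow> real \<times> real)"
    have "continuous_on UNIV (\<lambda>y :: real \<times> real. curve_of_coords N (snd x) (fst y))"
      "continuous_on UNIV (\<lambda>y :: real \<times> real. curve_of_coords N (fst x) (snd y))"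
      unfolding curve_of_coords_lincomb
      by (rule continuous_on_compose2[OF continuous_on_lincomb_trig(1)]; auto intro: continuous_intros)+
    then show "continuous_on UNIV (?F x)" by (intro continuous_on_diff)
  next
    fix y :: "real \<times> real"
    show "(\<lambda>x. ?F x y) \<in> borel_measurable (coord_measure {..2 * N} \<Otimes>\<^sub>M coord_measure {..2 * N})"
      unfolding curve_of_coords_lincomb
      by (intro borel_measurable_diff measurable_lincomb_trig) measurable
  qed
  ultimately show ?thesis by simp
qed

text \<open>Exchanging integrals puts the parameters outermost. The integral over the curves meeting
  at given parameters is the same for all of them, so the square of parameters contributes just its
  area \<open>(2 * pi)\<^sup>2\<close>.\<close>

lemma nn_integral_intersection_number_coords:
  fixes P :: "real \<Rightarrow> ennreal"
  assumes N: "N \<ge> 1" and P[measurable]: "P \<in> borel_measurable borel"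
  shows "(\<integral>\<^sup>+d. \<integral>\<^sup>+c. P (max (sqnorm {..2 * N} c) (sqnorm {..2 * N} d)) *
        intersection_number (curve_of_coords N c) (curve_of_coords N d)
      \<partial>coord_measure {..2 * N} \<partial>coord_measure {..2 * N})
    = ennreal ((2 * pi)\<^sup>2 * ((\<Sum>j=1..N. real j ^ 2) / (N + 1 / 2))) *
      (\<integral>\<^sup>+d. \<integral>\<^sup>+c. ennreal \<bar>cross2 (c 1) (d 1)\<bar> * P (max (sqnorm {..2 * N} c) ((norm (c 0))\<^sup>2 + sqnorm {1..2 * N} d))
        \<partial>coord_measure {..2 * N} \<partial>coord_measure {1..2 * N})"
proof -
  interpret product_sigma_finite "\<lambda>_::nat. lborel :: (real \<times> real) measure" by unfold_locales
  let ?PI = "coord_measure {..2 * N}" and ?PI' = "coord_measure {1..2 * N}"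
  let ?S = "{0..<2 * pi} \<times> {0..<2 * pi}"
  let ?\<sigma> = "\<Sum>j=1..N. real j ^ 2"
  interpret PI: sigma_finite_measure ?PI by (rule sigma_finite_PiM_lborel) simp
  interpret PI': sigma_finite_measure ?PI' by (rule sigma_finite_PiM_lborel) simp
  interpret L1: pair_sigma_finite ?PI' "lborel :: (real \<times> real) measure" ..
  interpret L2: pair_sigma_finite ?PI "lborel :: (real \<times> real) measure" ..
  \<comment> \<open>Density times Jacobian at the parameters \<open>y\<close>, without the factor 2
    of the Jacobian.\<close>
  define \<Psi> where "\<Psi> y d c = P (max ((norm (meeting_coeff N c d y))\<^sup>2 + sqnorm {1..2 * N} c) (sqnorm {..2 * N} d)) *
      ennreal \<bar>cross2 (lincomb {1..2 * N} (\<lambda>k. trig_basis' k (fst y)) c) (lincomb {..2 * N} (\<lambda>k. trig_basis' k (snd y)) d)\<bar>"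
    for y d c
  have S[measurable]: "?S \<in> sets borel" by (auto simp: borel_prod[symmetric])
  have \<Psi>m[measurable (raw)]: "(\<lambda>x. \<Psi> (f1 x) (f2 x) (f3 x)) \<in> borel_measurable M"
    if [measurable]: "f1 \<in> borel_measurable M" and f2: "f2 \<in> M \<rightarrow>\<^sub>M ?PI" and f3: "f3 \<in> M \<rightarrow>\<^sub>M ?PI'"
    for M :: "'m measure" and f1 f2 f3
  proof -
    have [measurable]: "(\<lambda>x. fst (f1 x)) \<in> borel_measurable M" "(\<lambda>x. snd (f1 x)) \<in> borel_measurable M"
      using that(1) by (auto simp: borel_prod[symmetric])
    note [measurable] = measurable_lincomb_trig[OF f2] measurable_lincomb_trig[OF f3]
      measurable_sqnorm_coord[OF f2] measurable_sqnorm_coord[OF f3]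
    show ?thesis unfolding \<Psi>_def meeting_coeff_def by measurable
  qed
  have eliminate: "(\<integral>\<^sup>+c. P (max (sqnorm {..2 * N} c) (sqnorm {..2 * N} d)) *
        intersection_number (curve_of_coords N c) (curve_of_coords N d) \<partial>?PI)
      = (\<integral>\<^sup>+y. 2 * (\<integral>\<^sup>+c. \<Psi> y d c \<partial>?PI') * indicator ?S y \<partial>lborel)"
    if d: "d \<in> space ?PI" for d
  proof -
    have m: "(\<lambda>c. P (max (sqnorm {..2 * N} c) (sqnorm {..2 * N} d)) *
        intersection_number (curve_of_coords N c) (curve_of_coords N d)) \<in> borel_measurable ?PI"
      using measurable_compose[OF measurable_Pair1'[OF d] borel_measurable_intersection_number_coords]
        measurable_sqnorm_coord[OF measurable_ident]
      by (auto intro!: borel_measurable_times measurable_compose[OF _ P] borel_measurable_max)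
    have "(\<integral>\<^sup>+c. P (max (sqnorm {..2 * N} c) (sqnorm {..2 * N} d)) *
        intersection_number (curve_of_coords N c) (curve_of_coords N d) \<partial>?PI)
      = (\<integral>\<^sup>+c. \<integral>\<^sup>+x. P (max (sqnorm {..2 * N} (c(0 := x))) (sqnorm {..2 * N} d)) *
        intersection_number (curve_of_coords N (c(0 := x))) (curve_of_coords N d) \<partial>lborel \<partial>?PI')"
      using m unfolding atMost_insert_0 by (intro product_nn_integral_insert) auto
    also have "\<dots> = (\<integral>\<^sup>+c. \<integral>\<^sup>+x. P (max ((norm x)\<^sup>2 + sqnorm {1..2 * N} c) (sqnorm {..2 * N} d)) *
        intersection_number (curve_of_coords N (c(0 := x))) (curve_of_coords N d) \<partial>lborel \<partial>?PI')"
      unfolding atMost_insert_0 by (simp add: sqnorm_insert_upd)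
    also have "\<dots> = (\<integral>\<^sup>+c. \<integral>\<^sup>+y. 2 * \<Psi> y d c * indicator ?S y \<partial>lborel \<partial>?PI')"
      by (subst nn_integral_over_constant_coeff, measurable) (simp add: \<Psi>_def ennreal_mult mult_ac)
    also have "\<dots> = (\<integral>\<^sup>+y. \<integral>\<^sup>+c. 2 * \<Psi> y d c * indicator ?S y \<partial>?PI' \<partial>lborel)"
      using d by (intro L1.Fubini'[symmetric]) measurable
    also have "\<dots> = (\<integral>\<^sup>+y. 2 * (\<integral>\<^sup>+c. \<Psi> y d c \<partial>?PI') * indicator ?S y \<partial>lborel)"
    proof (rule nn_integral_cong)
      fix y :: "real \<times> real"
      have m'[measurable]: "(\<lambda>c. \<Psi> y d c) \<in> borel_measurable ?PI'" using d by measurable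
      show "(\<integral>\<^sup>+c. 2 * \<Psi> y d c * indicator ?S y \<partial>?PI') = 2 * (\<integral>\<^sup>+c. \<Psi> y d c \<partial>?PI') * indicator ?S y"
        by (subst nn_integral_multc, measurable, subst nn_integral_cmult, rule m', rule refl)
    qed
    finally show ?thesis .
  qed
  have inner: "2 * (\<integral>\<^sup>+d. \<integral>\<^sup>+c. \<Psi> y d c \<partial>?PI' \<partial>?PI) = ennreal (?\<sigma> / (N + 1 / 2)) *
      (\<integral>\<^sup>+d. \<integral>\<^sup>+c. ennreal \<bar>cross2 (c 1) (d 1)\<bar> * P (max (sqnorm {..2 * N} c) ((norm (c 0))\<^sup>2 + sqnorm {1..2 * N} d))
        \<partial>?PI \<partial>?PI')" for y
  proof -
    \<comment> \<open>Index 0 is the eliminated constant coefficient, and index 1 is the one onto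
      which the tangents are rotated. For \<open>N \<ge> 1\<close> the set of further indices is
      nonempty, as the rotations require.\<close>
    have sets: "{1..2 * N} = insert 1 {2..2 * N}" "{..2 * N} = insert 0 (insert 1 {2..2 * N})"
      using N by auto
    let ?u = "\<lambda>t k. trig_basis k t" and ?v = "\<lambda>t k. trig_basis' k t"
    have u0: "sqrt 2 = 1 / ?u (fst y) 0" by (simp add: trig_basis_def)
    have "(\<integral>\<^sup>+d. \<integral>\<^sup>+c. \<Psi> y d c \<partial>?PI' \<partial>?PI)
      = ennreal ((?u (fst y) 0)\<^sup>2 * ?\<sigma> / (N + 1 / 2)) *
      (\<integral>\<^sup>+d. \<integral>\<^sup>+c. ennreal \<bar>cross2 (c 1) (d 1)\<bar> * P (max (sqnorm {..2 * N} c) ((norm (c 0))\<^sup>2 + sqnorm {1..2 * N} d))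
        \<partial>?PI \<partial>?PI')"
      unfolding \<Psi>_def meeting_coeff_def u0
    proof (rule nn_integral_incidence[of "{2..2 * N}" 1 0 P "?u (fst y)" "?v (fst y)" "N + 1 / 2" "?u (snd y)" ?\<sigma> "?v (snd y)",
          folded sets])
      show "?u (fst y) 0 \<noteq> 0" "?v (fst y) 0 = 0" by (simp_all add: trig_basis_def trig_basis'_def)
    qed (use N in \<open>auto simp: sum_trig_basis_sq sum_trig_basis'_sq sum_trig_basis_orthogonal\<close>)
    then have "2 * (\<integral>\<^sup>+d. \<integral>\<^sup>+c. \<Psi> y d c \<partial>?PI' \<partial>?PI)
      = 2 * (ennreal ((?u (fst y) 0)\<^sup>2 * ?\<sigma> / (N + 1 / 2)) *
      (\<integral>\<^sup>+d. \<integral>\<^sup>+c. ennreal \<bar>cross2 (c 1) (d 1)\<bar> * P (max (sqnorm {..2 * N} c) ((norm (c 0))\<^sup>2 + sqnorm {1..2 * N} d))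
        \<partial>?PI \<partial>?PI'))" by (rule arg_cong)
    also have "\<dots> = ennreal (2 * ((?u (fst y) 0)\<^sup>2 * ?\<sigma> / (N + 1 / 2))) *
      (\<integral>\<^sup>+d. \<integral>\<^sup>+c. ennreal \<bar>cross2 (c 1) (d 1)\<bar> * P (max (sqnorm {..2 * N} c) ((norm (c 0))\<^sup>2 + sqnorm {1..2 * N} d))
        \<partial>?PI \<partial>?PI')"
      by (subst ennreal_mult') (auto simp: mult.assoc)
    \<comment> \<open>The squared value \<open>1 / 2\<close> of the constant basis function cancels
      the factor 2 of the Jacobian.\<close>
    also have "2 * ((?u (fst y) 0)\<^sup>2 * ?\<sigma> / (N + 1 / 2)) = ?\<sigma> / (N + 1 / 2)"
    proof -
      have "(?u (fst y) 0)\<^sup>2 = 1 / 2" by (simp add: trig_basis_def power_divide)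
      moreover have "2 * (1 / 2 * s / e) = s / e" for s e :: real by simp
      ultimately show ?thesis by (simp only:)
    qed
    finally show ?thesis .
  qed
  have "(\<integral>\<^sup>+d. \<integral>\<^sup>+c. P (max (sqnorm {..2 * N} c) (sqnorm {..2 * N} d)) *
        intersection_number (curve_of_coords N c) (curve_of_coords N d) \<partial>?PI \<partial>?PI)
      = (\<integral>\<^sup>+d. \<integral>\<^sup>+y. 2 * (\<integral>\<^sup>+c. \<Psi> y d c \<partial>?PI') * indicator ?S y \<partial>lborel \<partial>?PI)"
    by (intro nn_integral_cong eliminate)
  also have "\<dots> = (\<integral>\<^sup>+y. \<integral>\<^sup>+d. 2 * (\<integral>\<^sup>+c. \<Psi> y d c \<partial>?PI') * indicator ?S y \<partial>?PI \<partial>lborel)"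
    by (intro L2.Fubini'[symmetric]) measurable
  also have "\<dots> = (\<integral>\<^sup>+y. 2 * (\<integral>\<^sup>+d. \<integral>\<^sup>+c. \<Psi> y d c \<partial>?PI' \<partial>?PI) * indicator ?S y \<partial>lborel)"
  proof (rule nn_integral_cong)
    fix y :: "real \<times> real"
    have m'[measurable]: "(\<lambda>d. \<integral>\<^sup>+c. \<Psi> y d c \<partial>?PI') \<in> borel_measurable ?PI" by measurable
    show "(\<integral>\<^sup>+d. 2 * (\<integral>\<^sup>+c. \<Psi> y d c \<partial>?PI') * indicator ?S y \<partial>?PI)
        = 2 * (\<integral>\<^sup>+d. \<integral>\<^sup>+c. \<Psi> y d c \<partial>?PI' \<partial>?PI) * indicator ?S y"
      by (subst nn_integral_multc, measurable, subst nn_integral_cmult, rule m', rule refl)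
  qed
  also have "\<dots> = ennreal (?\<sigma> / (N + 1 / 2)) *
      (\<integral>\<^sup>+d. \<integral>\<^sup>+c. ennreal \<bar>cross2 (c 1) (d 1)\<bar> * P (max (sqnorm {..2 * N} c) ((norm (c 0))\<^sup>2 + sqnorm {1..2 * N} d))
        \<partial>?PI \<partial>?PI') * emeasure lborel ?S"
    unfolding inner by (rule nn_integral_cmult_indicator) simp
  also have "emeasure lborel ?S = ennreal ((2 * pi)\<^sup>2)"
    by (subst lborel_prod[symmetric], subst lborel.emeasure_pair_measure_Times)
      (auto simp: power2_eq_square simp flip: ennreal_mult)
  finally have total: "(\<integral>\<^sup>+d. \<integral>\<^sup>+c. P (max (sqnorm {..2 * N} c) (sqnorm {..2 * N} d)) *
        intersection_number (curve_of_coords N c) (curve_of_coords N d) \<partial>?PI \<partial>?PI)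
      = ennreal (?\<sigma> / (N + 1 / 2)) *
      (\<integral>\<^sup>+d. \<integral>\<^sup>+c. ennreal \<bar>cross2 (c 1) (d 1)\<bar> * P (max (sqnorm {..2 * N} c) ((norm (c 0))\<^sup>2 + sqnorm {1..2 * N} d))
        \<partial>?PI \<partial>?PI') * ennreal ((2 * pi)\<^sup>2)" .
  have "0 \<le> ?\<sigma>" by (rule sum_nonneg) simp
  then have "ennreal ((2 * pi)\<^sup>2 * (?\<sigma> / (N + 1 / 2))) = ennreal ((2 * pi)\<^sup>2) * ennreal (?\<sigma> / (N + 1 / 2))"
    by (intro ennreal_mult divide_nonneg_nonneg) simp_all
  then show ?thesis unfolding total by (simp only: mult_ac)
qed

text \<open>The left side is the area of the square of parameters, times the ratio of the squared
  lengths of the derivative and value vectors (with \<open>s\<close> for the sum of squares), times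
  the ratio of volumes with \<open>card K = 2 * N - 1\<close>. All powers of \<open>pi\<close>
  cancel, and \<open>pochhammer_five_halves\<close> turns the half-integer product into
  factorials.\<close>

lemma intersection_constant:
  assumes "N \<ge> 1"
  shows "(2 * pi)\<^sup>2 * (s / (real N + 1 / 2)) *
      (8 * pi\<^sup>2 / 9 * (pi ^ (2 * N - 1) / pochhammer (5 / 2) (2 * N - 1))\<^sup>2 / real (2 * (2 * N - 1) + 4)
        / (pi ^ (2 * N - 1 + 2) / fact (2 * N - 1 + 2))\<^sup>2)
    = 2 ^ (8 * N + 3) * fact (2 * N) ^ 4 / fact (4 * N + 1) ^ 2 * s"
proof -
  obtain m where m: "2 * N = Suc m" using assms by (cases "2 * N") auto
  define x y q a :: real where "x = fact (2 * N)" and "y = fact (4 * N + 1)" and "q = 2 ^ (4 * N)" and "a = pochhammer (5 / 2) m"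
  have pos: "x > 0" "y > 0" "q > 0" "a > 0" by (auto simp: x_def y_def q_def a_def intro!: pochhammer_pos)
  have e: "2 * m + 2 = 4 * N" "2 * m + 3 = 4 * N + 1" using m by auto
  have "3 * a * q * x = 2 * y"
    using pochhammer_five_halves[of m] unfolding e by (simp add: x_def y_def q_def a_def m)
  then have a: "a = 2 * y / (3 * q * x)" using pos by (simp add: field_simps)
  have "fact (m + 2) = (2 * real N + 1) * x"
    using m by (simp add: x_def)
  moreover have "2 ^ (8 * N + 3) = 8 * q\<^sup>2"
    by (simp add: q_def power_add flip: power_mult)
  moreover have "real (2 * m + 4) = 2 * (2 * real N + 1)" using m by (simp add: of_nat_mult[symmetric] del: of_nat_mult)
  moreover have "2 * N - 1 = m" using m by simp
  ultimately have "(2 * pi)\<^sup>2 * (s / (real N + 1 / 2)) *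
      (8 * pi\<^sup>2 / 9 * (pi ^ (2 * N - 1) / pochhammer (5 / 2) (2 * N - 1))\<^sup>2 / real (2 * (2 * N - 1) + 4)
        / (pi ^ (2 * N - 1 + 2) / fact (2 * N - 1 + 2))\<^sup>2)
    = (2 * pi)\<^sup>2 * (s / (real N + 1 / 2)) *
      (8 * pi\<^sup>2 / 9 * (pi ^ m / a)\<^sup>2 / (2 * (2 * real N + 1)) / (pi ^ (m + 2) / ((2 * real N + 1) * x))\<^sup>2)"
    by (simp add: a_def)
  also have "\<dots> = (32 / 9) * s * x\<^sup>2 / a\<^sup>2"
  proof -
    define t where "t = 2 * real N + 1"
    have t: "t > 0" "real N + 1 / 2 = t / 2" by (simp_all add: t_def)
    have "pi ^ (m + 2) = pi ^ m * pi\<^sup>2" by (simp add: power_add power2_eq_square)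
    then show ?thesis
      unfolding t(2) t_def[symmetric] using pos t(1)
      by (simp add: field_simps power2_eq_square)
  qed
  also have "\<dots> = 8 * q\<^sup>2 * x ^ 4 / y\<^sup>2 * s"
    using pos unfolding a by (simp add: field_simps power2_eq_square power4_eq_xxxx)
  finally show ?thesis using \<open>2 ^ (8 * N + 3) = 8 * q\<^sup>2\<close> by (simp add: x_def y_def)
qed

section \<open>From coordinates to the space of curves\<close>

lemma measurable_coords_of_curve:
  "inv_into (space (coord_measure {..2 * N})) (curve_of_coords N) \<in> curve_volume N \<rightarrow>\<^sub>M coord_measure {..2 * N}"
  unfolding curve_volume_def
proof (rule measurable_embed_measure1)
  show "(\<lambda>c. inv_into (space (coord_measure {..2 * N})) (curve_of_coords N) (curve_of_coords N c))
      \<in> coord_measure {..2 * N} \<rightarrow>\<^sub>M coord_measure {..2 * N}"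
    by (rule measurable_cong[THEN iffD2, OF _ measurable_ident])
      (simp add: inv_into_f_f[OF inj_on_curve_of_coords])
qed

lemma measurable_curve_of_coords:
  "curve_of_coords N \<in> coord_measure {..2 * N} \<rightarrow>\<^sub>M curve_volume N"
  unfolding curve_volume_def by (rule measurable_embed_measure2'[OF inj_on_curve_of_coords])

lemma borel_measurable_intersection_number:
  "(\<lambda>(f, g). intersection_number f g) \<in> borel_measurable (curve_volume N \<Otimes>\<^sub>M curve_volume N)"
proof -
  let ?M = "coord_measure {..2 * N}"
  let ?R = "inv_into (space ?M) (curve_of_coords N)"
  have R: "curve_of_coords N (?R f) = f" if "f \<in> space (curve_volume N)" for f
    using that unfolding curve_volume_def space_embed_measure by (rule f_inv_into_f)
  have "(\<lambda>x. (?R (snd x), ?R (fst x))) \<in> curve_volume N \<Otimes>\<^sub>M curve_volume N \<rightarrow>\<^sub>M ?M \<Otimes>\<^sub>M ?M"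
    using measurable_coords_of_curve by measurable
  from measurable_compose[OF this borel_measurable_intersection_number_coords]
  have "(\<lambda>x. intersection_number (curve_of_coords N (?R (fst x))) (curve_of_coords N (?R (snd x))))
      \<in> borel_measurable (curve_volume N \<Otimes>\<^sub>M curve_volume N)"
    by simp
  then show ?thesis
    by (rule measurable_cong[THEN iffD1, rotated]) (auto simp: space_pair_measure R)
qed

lemma nn_integral_curve_volume_pair:
  assumes F[measurable]: "F \<in> borel_measurable (curve_volume N \<Otimes>\<^sub>M curve_volume N)"
  shows "integral\<^sup>N (curve_volume N \<Otimes>\<^sub>M curve_volume N) F
    = (\<integral>\<^sup>+d. \<integral>\<^sup>+c. F (curve_of_coords N c, curve_of_coords N d) \<partial>coord_measure {..2 * N} \<partial>coord_measure {..2 * N})"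
proof -
  let ?M = "coord_measure {..2 * N}" and ?C = "curve_of_coords N"
  interpret C: sigma_finite_measure "curve_volume N" by (rule sigma_finite_curve_volume)
  interpret CC: pair_sigma_finite "curve_volume N" "curve_volume N" ..
  note embed = nn_integral_embed_measure'[OF inj_on_curve_of_coords, of _ N, folded curve_volume_def]
  have "integral\<^sup>N (curve_volume N \<Otimes>\<^sub>M curve_volume N) F = (\<integral>\<^sup>+g. \<integral>\<^sup>+f. F (f, g) \<partial>curve_volume N \<partial>curve_volume N)"
    by (rule CC.nn_integral_snd[symmetric]) (simp add: F)
  also have "\<dots> = (\<integral>\<^sup>+d. \<integral>\<^sup>+f. F (f, ?C d) \<partial>curve_volume N \<partial>?M)"
    by (rule embed) measurable
  also have "\<dots> = (\<integral>\<^sup>+d. \<integral>\<^sup>+c. F (?C c, ?C d) \<partial>?M \<partial>?M)"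
  proof (rule nn_integral_cong)
    fix d assume "d \<in> space ?M"
    then have "?C d \<in> space (curve_volume N)" using measurable_curve_of_coords by (rule measurable_space[rotated])
    then show "(\<integral>\<^sup>+f. F (f, ?C d) \<partial>curve_volume N) = (\<integral>\<^sup>+c. F (?C c, ?C d) \<partial>?M)"
      by (intro embed) measurable
  qed
  finally show ?thesis .
qed

text \<open>Measurability is given for the density on pairs of curves, not for \<open>p\<close>.
  Pairing a constant curve of norm \<open>sqrt (max 0 t)\<close>, which depends measurably on
  \<open>t\<close>, with the zero curve makes the maximum run through all nonnegative numbers; the
  density along this path is the profile.\<close>

lemma borel_measurable_density_profile:
  assumes p: "(\<lambda>(f, g). ennreal (p (max (L2_norm_curve f) (L2_norm_curve g))))
      \<in> borel_measurable (curve_volume N \<Otimes>\<^sub>M curve_volume N)"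
  shows "(\<lambda>t. ennreal (p (sqrt (max 0 t)))) \<in> borel_measurable borel"
proof -
  let ?M = "coord_measure {..2 * N}"
  let ?c = "\<lambda>t. \<lambda>k\<in>{..2 * N}. if k = 0 then (sqrt (max 0 t), 0 :: real) else 0"
  let ?z = "\<lambda>k\<in>{..2 * N}. 0 :: real \<times> real"
  have "(\<lambda>t. if k = 0 then (sqrt (max 0 t), 0 :: real) else 0) \<in> borel_measurable borel" for k :: nat
    by (cases "k = 0") auto
  then have c: "?c \<in> borel \<rightarrow>\<^sub>M ?M"
    by (intro measurable_restrict) simp
  have z: "?z \<in> space ?M" by (auto simp: space_PiM)
  have "(\<lambda>t. (curve_of_coords N (?c t), curve_of_coords N ?z)) \<in> borel \<rightarrow>\<^sub>M curve_volume N \<Otimes>\<^sub>M curve_volume N"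
    by (rule measurable_Pair[OF measurable_compose[OF c measurable_curve_of_coords]
          measurable_const[OF measurable_space[OF measurable_curve_of_coords z]]])
  from measurable_compose[OF this p]
  have "(\<lambda>t. ennreal (p (max (L2_norm_curve (curve_of_coords N (?c t))) (L2_norm_curve (curve_of_coords N ?z)))))
      \<in> borel_measurable borel"
    by simp
  moreover have "L2_norm_curve (curve_of_coords N ?z) = 0"
    by (simp add: L2_norm_curve_sqnorm sqnorm_def)
  moreover have "L2_norm_curve (curve_of_coords N (?c t)) = sqrt (max 0 t)" for t
  proof -
    have "sqnorm {..2 * N} (?c t) = (\<Sum>k\<le>2 * N. if k = 0 then max 0 t else 0)"
      unfolding sqnorm_def by (intro sum.cong) (auto simp: norm_Pair)
    then show ?thesis by (simp add: L2_norm_curve_sqnorm)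
  qed
  ultimately show ?thesis by simp
qed

theorem corollary2:
  fixes N :: nat and p :: "real \<Rightarrow> real" and \<mu> :: "(curve \<times> curve) measure"
  assumes "N \<ge> 1"
    and "\<And>r. r \<ge> 0 \<Longrightarrow> p r \<ge> 0"
    and "integrable (curve_volume N \<Otimes>\<^sub>M curve_volume N)
           (\<lambda>(f, g). p (max (L2_norm_curve f) (L2_norm_curve g)))"
    and "\<mu> = density (curve_volume N \<Otimes>\<^sub>M curve_volume N)
           (\<lambda>(f, g). ennreal (p (max (L2_norm_curve f) (L2_norm_curve g))))"
    and "prob_space \<mu>"
  shows "(\<lambda>(f, g). intersection_number f g) \<in> borel_measurable \<mu> \<and>
    (\<integral>\<^sup>+ (f, g). intersection_number f g \<partial>\<mu>) =
      ennreal (2 ^ (8 * N + 3) * (fact (2 * N)) ^ 4 / (fact (4 * N + 1)) ^ 2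
               * (\<Sum>j=1..N. real j ^ 2))"
proof
  let ?CC = "curve_volume N \<Otimes>\<^sub>M curve_volume N"
  let ?M = "coord_measure {..2 * N}" and ?M' = "coord_measure {1..2 * N}"
  let ?\<rho> = "\<lambda>(f, g). ennreal (p (max (L2_norm_curve f) (L2_norm_curve g)))"
  let ?n = "\<lambda>(f, g). intersection_number f g"
  \<comment> \<open>The profile as a function of the squared radius, the variable in which the
    volumes are computed. The truncation at 0 ensures that \<open>p\<close> is evaluated only at
    nonnegative radii.\<close>
  define P where "P t = ennreal (p (sqrt (max 0 t)))" for t
  have n: "?n \<in> borel_measurable ?CC" by (rule borel_measurable_intersection_number)
  then show "?n \<in> borel_measurable \<mu>" by (simp add: assms(4))
  have "(\<lambda>x. ennreal (case x of (f, g) \<Rightarrow> p (max (L2_norm_curve f) (L2_norm_curve g)))) \<in> borel_measurable ?CC"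
    using borel_measurable_integrable[OF assms(3)] by measurable
  then have \<rho>: "?\<rho> \<in> borel_measurable ?CC"
    by (simp add: case_prod_unfold)
  then have P: "P \<in> borel_measurable borel"
    unfolding P_def by (rule borel_measurable_density_profile)
  have \<rho>_eq: "?\<rho> (curve_of_coords N c, curve_of_coords N d) = P (max (sqnorm {..2 * N} c) (sqnorm {..2 * N} d))" for c d
  proof -
    have "0 \<le> sqnorm {..2 * N} c" by (simp add: sqnorm_def sum_nonneg)
    then have "max 0 (max (sqnorm {..2 * N} c) (sqnorm {..2 * N} d)) = max (sqnorm {..2 * N} c) (sqnorm {..2 * N} d)"
      by linarith
    moreover have "sqrt (max a b) = max (sqrt a) (sqrt b)" for a b by (auto simp: max_def)
    ultimately show ?thesis by (simp add: P_def L2_norm_curve_sqnorm)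
  qed
  have "1 = integral\<^sup>N ?CC ?\<rho>"
  proof -
    have "emeasure \<mu> (space \<mu>) = (\<integral>\<^sup>+x. ?\<rho> x * indicator (space ?CC) x \<partial>?CC)"
      unfolding assms(4) using \<rho> by (simp add: emeasure_density)
    also have "\<dots> = integral\<^sup>N ?CC ?\<rho>" by (intro nn_integral_cong) simp
    finally show ?thesis using prob_space.emeasure_space_1[OF assms(5)] by simp
  qed
  \<comment> \<open>The total mass in coordinates. This is the integral of \<open>P\<close> that
    \<open>nn_integral_common_coordinate\<close> leaves over, so the profile disappears from the
    result.\<close>
  then have one: "(\<integral>\<^sup>+d. \<integral>\<^sup>+c. P (max (sqnorm {..2 * N} c) (sqnorm {..2 * N} d)) \<partial>?M \<partial>?M) = 1"
    unfolding nn_integral_curve_volume_pair[OF \<rho>] \<rho>_eq ..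
  have sets: "{1..2 * N} = insert 1 {2..2 * N}" "{..2 * N} = insert 0 (insert 1 {2..2 * N})"
    using assms(1) by auto
  have "integral\<^sup>N \<mu> ?n = (\<integral>\<^sup>+x. ?\<rho> x * ?n x \<partial>?CC)"
    unfolding assms(4) by (rule nn_integral_density[OF \<rho> n])
  also have "\<dots> = (\<integral>\<^sup>+d. \<integral>\<^sup>+c. P (max (sqnorm {..2 * N} c) (sqnorm {..2 * N} d)) *
        intersection_number (curve_of_coords N c) (curve_of_coords N d) \<partial>?M \<partial>?M)"
  proof -
    have "(\<lambda>x. ?\<rho> x * ?n x) \<in> borel_measurable ?CC" using \<rho> n by (rule borel_measurable_times_ennreal)
    from nn_integral_curve_volume_pair[OF this] show ?thesis unfolding prod.case \<rho>_eq[unfolded prod.case] .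
  qed
  also have "\<dots> = ennreal ((2 * pi)\<^sup>2 * ((\<Sum>j=1..N. real j ^ 2) / (N + 1 / 2))) *
      (\<integral>\<^sup>+d. \<integral>\<^sup>+c. ennreal \<bar>cross2 (c 1) (d 1)\<bar> * P (max (sqnorm {..2 * N} c) ((norm (c 0))\<^sup>2 + sqnorm {1..2 * N} d))
        \<partial>?M \<partial>?M')"
    by (rule nn_integral_intersection_number_coords[OF assms(1) P])
  also have "\<dots> = ennreal ((2 * pi)\<^sup>2 * ((\<Sum>j=1..N. real j ^ 2) / (N + 1 / 2))) *
      ennreal (8 * pi\<^sup>2 / 9 * (pi ^ (2 * N - 1) / pochhammer (5 / 2) (2 * N - 1))\<^sup>2 / real (2 * (2 * N - 1) + 4)
        / (pi ^ (2 * N - 1 + 2) / fact (2 * N - 1 + 2))\<^sup>2)"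
  proof -
    have "card {2..2 * N} = 2 * N - 1" by simp
    with nn_integral_common_coordinate[of "{2..2 * N}" 1 0 P, folded sets] P one assms(1)
    show ?thesis by simp
  qed
  also have "\<dots> = ennreal ((2 * pi)\<^sup>2 * ((\<Sum>j=1..N. real j ^ 2) / (N + 1 / 2)) *
      (8 * pi\<^sup>2 / 9 * (pi ^ (2 * N - 1) / pochhammer (5 / 2) (2 * N - 1))\<^sup>2 / real (2 * (2 * N - 1) + 4)
        / (pi ^ (2 * N - 1 + 2) / fact (2 * N - 1 + 2))\<^sup>2))"
    by (rule ennreal_mult[symmetric]) (auto intro!: mult_nonneg_nonneg divide_nonneg_nonneg sum_nonneg)
  also have "\<dots> = ennreal (2 ^ (8 * N + 3) * (fact (2 * N)) ^ 4 / (fact (4 * N + 1)) ^ 2 * (\<Sum>j=1..N. real j ^ 2))"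
    unfolding intersection_constant[OF assms(1)] ..
  finally show "integral\<^sup>N \<mu> ?n
      = ennreal (2 ^ (8 * N + 3) * (fact (2 * N)) ^ 4 / (fact (4 * N + 1)) ^ 2 * (\<Sum>j=1..N. real j ^ 2))" .
qed

end
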